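(* Let $K$ be a perfect field, $\mathcal{A}$ a commutative domain of essentially finite type over $K$ with Jacobian ideal $\mathfrak{a}_r$, $\mathcal{D}(\mathcal{A})$ the algebra of differential operators on $\mathcal{A}$, $R$ a subalgebra of $\mathcal{D}(\mathcal{A})$ containing $\mathcal{A}$, and suppose $S^{-1}R=S^{-1}\mathcal{D}(\mathcal{A})$ for some multiplicative subset $S$ of $\mathcal{A}$. Let $R_i=R\cap\mathcal{D}(\mathcal{A})_i$, $\mathfrak{b}_i=\{a\in\mathcal{A}\mid a\mathcal{D}(\mathcal{A})_i\subseteq R_i\}$ and $\mathfrak{c}_i=\{a\in\mathcal{A}\mid\mathcal{D}(\mathcal{A})_ia\subseteq R_i\}$ for $i\ge1$, and fix elements $s_i,t_i\in S$ with $s_i\in\mathfrak{b}_i$ and $t_i\in\mathfrak{c}_i$ for $i\geq1$. The following are equivalent: (1) $R$ is simple. (2) For all $i\geq1$, $\mathcal{D}(\mathcal{A})\mathfrak{a}_r^i\mathcal{D}(\mathcal{A})=\mathcal{D}(\mathcal{A})$ and $Rs_it_iR=R$. (3) $\mathcal{D}(\mathcal{A})$ is simple and $Rs_it_iR=R$ for all $i\ge1$. (4) For all $i\geq1$, $\mathcal{D}(\mathcal{A})\mathfrak{a}_r^i\mathcal{D}(\mathcal{A})=\mathcal{D}(\mathcal{A})$; moreover $Rs_1^2R=R$ and $Rs_1\cdots s_{i-1}s_i^2R=R$ for all $i\ge2$. (5) $\mathcal{D}(\mathcal{A})$ is simple, $Rs_1^2R=R$ and $Rs_1\cdots s_{i-1}s_i^2R=R$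 for all $i\geq2$. (6) For all $i\geq1$, $\mathcal{D}(\mathcal{A})\mathfrak{a}_r^i\mathcal{D}(\mathcal{A})=\mathcal{D}(\mathcal{A})$; moreover $Rt_1^2R=R$ and $Rt_1\cdots t_{i-1}t_i^2R=R$ for all $i\ge2$. (7) $\mathcal{D}(\mathcal{A})$ is simple, $Rt_1^2R=R$ and $Rt_1\cdots t_{i-1}t_i^2R=R$ for all $i\geq2$.
   Context: For a commutative $K$-algebra $R'$, $\mathcal{D}(R')=\bigcup_{i\ge0}\mathcal{D}(R')_i\subseteq\mathrm{End}_K(R')$ with $\mathcal{D}(R')_{-1}=0$, $\mathcal{D}(R')_i=\{u\mid ru-ur\in\mathcal{D}(R')_{i-1}\ \forall r\in R'\}$, and $R'=\mathcal{D}(R')_0$. Essentially finite type: a localization of a finitely generated commutative algebra. Write $\mathcal{A}=T^{-1}(P_n/I)$ with $P_n=K[x_1,\dots,x_n]$, $I=(f_1,\dots,f_m)$ prime; let $\overline{J}=(\overline{\partial f_i/\partial x_j})$ be the Jacobi matrix over $P_n/I$ and $r$ its rank over the fraction field; the Jacobian ideal $\mathfrak{a}_r$ is the ideal of $\mathcal{A}$ generated by all $r\times r$ minors of $\overline{J}$. $S^{-1}R$, $S^{-1}\mathcal{D}(\mathcal{A})$ denote localizations of these domains at the Ore set $S$. *)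

theory Defs
  imports "HOL-Library.Poly_Mapping" "HOL-Combinatorics.Permutations"
begin

definition perfect_field :: "'k::field itself \<Rightarrow> bool" where
  "perfect_field _ \<longleftrightarrow> CHAR('k) = 0 \<or> (\<forall>y::'k. \<exists>z. z ^ CHAR('k) = y)"

definition k_algebra_map :: "('k::field \<Rightarrow> 'a::comm_ring_1) \<Rightarrow> bool" where
  "k_algebra_map \<phi> \<longleftrightarrow> \<phi> 1 = 1 \<and> (\<forall>a b. \<phi> (a + b) = \<phi> a + \<phi> b) \<and> (\<forall>a b. \<phi> (a * b) = \<phi> a * \<phi> b)"

type_synonym 'k mpoly = "(nat \<Rightarrow>\<^sub>0 nat) \<Rightarrow>\<^sub>0 'k"

definition in_Pn :: "nat \<Rightarrow> ('k::zero) mpoly \<Rightarrow> bool" where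
  "in_Pn n p \<longleftrightarrow> (\<forall>mon\<in>Poly_Mapping.keys p. \<forall>v\<in>Poly_Mapping.keys mon. v < n)"

definition mp_eval :: "('k::zero \<Rightarrow> 'a::comm_ring_1) \<Rightarrow> (nat \<Rightarrow> 'a) \<Rightarrow> 'k mpoly \<Rightarrow> 'a" where
  "mp_eval \<phi> x p = (\<Sum>mo\<in>Poly_Mapping.keys p. \<phi> (Poly_Mapping.lookup p mo) * (\<Prod>v\<in>Poly_Mapping.keys mo. x v ^ Poly_Mapping.lookup mo v))"

definition mp_eval_pderiv :: "('k::zero \<Rightarrow> 'a::comm_ring_1) \<Rightarrow> (nat \<Rightarrow> 'a) \<Rightarrow> nat \<Rightarrow> 'k mpoly \<Rightarrow> 'a" where
  "mp_eval_pderiv \<phi> x j p =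
     (\<Sum>mo\<in>Poly_Mapping.keys p. \<phi> (Poly_Mapping.lookup p mo) * (of_nat (Poly_Mapping.lookup mo j) * x j ^ (Poly_Mapping.lookup mo j - 1))
                    * (\<Prod>v\<in>Poly_Mapping.keys mo - {j}. x v ^ Poly_Mapping.lookup mo v))"

text \<open>A = T^{-1}(P_n/I), I = (f_0,...,f_(m-1)), presented via the images x_0..x_(n-1) of the
  variables: I is the kernel of evaluation at x on P_n, and every element of A is b/t with
  b, t in the image B of P_n and t invertible in A.\<close>
definition is_presentation ::
  "('k::field \<Rightarrow> 'a::idom) \<Rightarrow> nat \<Rightarrow> nat \<Rightarrow> (nat \<Rightarrow> 'a) \<Rightarrow> (nat \<Rightarrow> 'k mpoly) \<Rightarrow> bool" where
  "is_presentation \<phi> n m x f \<longleftrightarrow>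
     (\<forall>i<m. in_Pn n (f i)) \<and>
     (\<forall>p. in_Pn n p \<longrightarrow>
        (mp_eval \<phi> x p = 0 \<longleftrightarrow> (\<exists>g. (\<forall>i<m. in_Pn n (g i)) \<and> p = (\<Sum>i<m. g i * f i)))) \<and>
     (\<forall>a. \<exists>p q. in_Pn n p \<and> in_Pn n q \<and> mp_eval \<phi> x q dvd 1 \<and> a * mp_eval \<phi> x q = mp_eval \<phi> x p)"

definition det_sq :: "nat \<Rightarrow> (nat \<Rightarrow> nat \<Rightarrow> 'a::comm_ring_1) \<Rightarrow> 'a" where
  "det_sq k M = (\<Sum>p | p permutes {..<k}. of_int (sign p) * (\<Prod>i<k. M i (p i)))"

definition minors :: "nat \<Rightarrow> nat \<Rightarrow> (nat \<Rightarrow> nat \<Rightarrow> 'a::comm_ring_1) \<Rightarrow> nat \<Rightarrow> 'a set" where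
  "minors m n M k = {det_sq k (\<lambda>a b. M (\<rho> a) (\<gamma> b)) | \<rho> \<gamma>.
      inj_on \<rho> {..<k} \<and> \<rho> ` {..<k} \<subseteq> {..<m} \<and> inj_on \<gamma> {..<k} \<and> \<gamma> ` {..<k} \<subseteq> {..<n}}"

text \<open>Rank (over the fraction field of the domain) = largest size of a nonzero minor.\<close>
definition mat_rank :: "nat \<Rightarrow> nat \<Rightarrow> (nat \<Rightarrow> nat \<Rightarrow> 'a::comm_ring_1) \<Rightarrow> nat" where
  "mat_rank m n M = Max {k. \<exists>d\<in>minors m n M k. d \<noteq> 0}"

definition ideal_gen :: "'a::comm_ring_1 set \<Rightarrow> 'a set" where
  "ideal_gen X = {\<Sum>j<(N::nat). c j * g j | N c g. \<forall>j<N. g j \<in> X}"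

fun ideal_pow :: "'a::comm_ring_1 set \<Rightarrow> nat \<Rightarrow> 'a set" where
  "ideal_pow J 0 = UNIV"
| "ideal_pow J (Suc i) = ideal_gen {a * b | a b. a \<in> J \<and> b \<in> ideal_pow J i}"

definition jacobian_matrix :: "('k::field \<Rightarrow> 'a::idom) \<Rightarrow> (nat \<Rightarrow> 'a) \<Rightarrow> (nat \<Rightarrow> 'k mpoly) \<Rightarrow> nat \<Rightarrow> nat \<Rightarrow> 'a" where
  "jacobian_matrix \<phi> x f i j = mp_eval_pderiv \<phi> x j (f i)"

definition jacobian_ideal ::
  "('k::field \<Rightarrow> 'a::idom) \<Rightarrow> (nat \<Rightarrow> 'a) \<Rightarrow> (nat \<Rightarrow> 'k mpoly) \<Rightarrow> nat \<Rightarrow> nat \<Rightarrow> 'a set" where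
  "jacobian_ideal \<phi> x f m n =
     ideal_gen (minors m n (jacobian_matrix \<phi> x f) (mat_rank m n (jacobian_matrix \<phi> x f)))"

definition klinear :: "('k \<Rightarrow> 'a::comm_ring_1) \<Rightarrow> ('a \<Rightarrow> 'a) \<Rightarrow> bool" where
  "klinear \<phi> u \<longleftrightarrow> (\<forall>a b. u (a + b) = u a + u b) \<and> (\<forall>c a. u (\<phi> c * a) = \<phi> c * u a)"

fun dop :: "('k \<Rightarrow> 'a::comm_ring_1) \<Rightarrow> nat \<Rightarrow> ('a \<Rightarrow> 'a) set" where
  "dop \<phi> 0 = {u. klinear \<phi> u \<and> (\<forall>r a. r * u a - u (r * a) = 0)}"
| "dop \<phi> (Suc i) = {u. klinear \<phi> u \<and> (\<forall>r. (\<lambda>a. r * u a - u (r * a)) \<in> dop \<phi> i)}"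

definition Dall :: "('k \<Rightarrow> 'a::comm_ring_1) \<Rightarrow> ('a \<Rightarrow> 'a) set" where
  "Dall \<phi> = (\<Union>i. dop \<phi> i)"

definition mo :: "'a::comm_ring_1 \<Rightarrow> 'a \<Rightarrow> 'a" where
  "mo a = (\<lambda>y. a * y)"

definition subalg :: "('k \<Rightarrow> 'a::comm_ring_1) \<Rightarrow> ('a \<Rightarrow> 'a) set \<Rightarrow> ('a \<Rightarrow> 'a) set \<Rightarrow> bool" where
  "subalg \<phi> D R \<longleftrightarrow> R \<subseteq> D \<and> id \<in> R \<and>
     (\<forall>u\<in>R. \<forall>v\<in>R. (\<lambda>a. u a + v a) \<in> R \<and> (\<lambda>a. u a - v a) \<in> R \<and> u \<circ> v \<in> R) \<and>
     (\<forall>c. \<forall>u\<in>R. (\<lambda>a. \<phi> c * u a) \<in> R)"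

definition two_sided_ideal :: "('a \<Rightarrow> 'a::comm_ring_1) set \<Rightarrow> ('a \<Rightarrow> 'a) set \<Rightarrow> bool" where
  "two_sided_ideal R J \<longleftrightarrow> J \<subseteq> R \<and> (\<lambda>a. 0) \<in> J \<and>
     (\<forall>u\<in>J. \<forall>v\<in>J. (\<lambda>a. u a + v a) \<in> J \<and> (\<lambda>a. u a - v a) \<in> J) \<and>
     (\<forall>r\<in>R. \<forall>u\<in>J. r \<circ> u \<in> J \<and> u \<circ> r \<in> J)"

definition simple_ring :: "('a \<Rightarrow> 'a::comm_ring_1) set \<Rightarrow> bool" where
  "simple_ring R \<longleftrightarrow> (\<exists>u\<in>R. u \<noteq> (\<lambda>a. 0)) \<and>
     (\<forall>J. two_sided_ideal R J \<longrightarrow> J = {\<lambda>a. 0} \<or> J = R)"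

definition tsid :: "('a \<Rightarrow> 'a::comm_ring_1) set \<Rightarrow> ('a \<Rightarrow> 'a) set \<Rightarrow> ('a \<Rightarrow> 'a) set" where
  "tsid R X = {(\<lambda>a. \<Sum>j<(N::nat). u j (y j (v j a))) | N u y v.
      \<forall>j<N. u j \<in> R \<and> y j \<in> X \<and> v j \<in> R}"

definition bset :: "('k \<Rightarrow> 'a::comm_ring_1) \<Rightarrow> ('a \<Rightarrow> 'a) set \<Rightarrow> nat \<Rightarrow> 'a set" where
  "bset \<phi> R i = {a. \<forall>d\<in>dop \<phi> i. mo a \<circ> d \<in> R \<inter> dop \<phi> i}"

definition cset :: "('k \<Rightarrow> 'a::comm_ring_1) \<Rightarrow> ('a \<Rightarrow> 'a) set \<Rightarrow> nat \<Rightarrow> 'a set" where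
  "cset \<phi> R i = {a. \<forall>d\<in>dop \<phi> i. d \<circ> mo a \<in> R \<inter> dop \<phi> i}"

end

theory Submission
  imports Defs "Jordan_Normal_Form.Char_Poly" "HOL-Computational_Algebra.Formal_Power_Series"
begin

text \<open>
  Every nonzero two-sided ideal of a ring R between A and D(A) contains a nonzero element of A, since
  commutators with elements of A lower the order. If D(A) is simple, such an element c gives
  1 = \<Sum> u c v with u, v of some order at most i; multiplying by s_i on the left and by t_i on the right
  moves u and v into R. The products s_1 ... s_i lie in c_i, and t_1 ... t_i lie in b_i, because
  commutators lower the order; so one of the two sequences suffices.

  D(A) is simple if it is generated by all powers of the Jacobian ideal: it is enough that a nonzero
  ideal of D(A) contains a power of every nonzero r \<times> r minor d. The variables outside the columns of d are
  algebraically independent (this uses that K is perfect), and Frac A is separable algebraic over the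
  field generated by these parameters, as Frac A has no derivation over that field. Hence the substitution
  x_c \<mapsto> x_c + X of a parameter extends to a homomorphism from A to (Frac A)[[X]], whose coefficients have
  powers of d as denominators by Cramer's rule. These coefficients are differential operators in every
  characteristic. A nonzero ideal of A contains a nonzero polynomial in the parameters; taking top
  coefficients in one parameter after the other with these operators leads to a nonzero constant, up to a power of d.
\<close>

section \<open>Evaluation of multivariate polynomials\<close>

text \<open>In characteristic p, derivations need not generate D(A) and do not see all top
  coefficients (x^p is killed by d/dx), and iterating a derivation produces factorials; hence whole
  Taylor expansions. They are taken modulo X^K: only finitely many coefficients are used at a time,
  so roots are lifted by finitely many Newton steps, and one exponent e serves all coefficients
  below K. Modulo X^2 the same curves are derivations into the fraction field, so a single extension
  lemma serves both the differential criterion for separability and the construction of the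
  operators.

  The nonzero minor plays three roles. Injectivity of its matrix forces a derivation that kills the
  parameters to be 0. Maximality of its size gives a kernel vector of the Jacobi matrix for each
  parameter, hence a derivation that is nonzero on this parameter only. Its adjugate controls
  denominators: the k-th coefficient of a curve needs at most d^(e k), linear in k, so scaling by
  d^(e k) keeps the Leibniz rule.\<close>

lemma k_algebra_map_simps:
  assumes "k_algebra_map \<phi>"
  shows "\<phi> 0 = 0" "\<phi> 1 = 1" "\<phi> (a + b) = \<phi> a + \<phi> b" "\<phi> (a * b) = \<phi> a * \<phi> b"
proof -
  show h: "\<phi> 1 = 1" "\<phi> (a + b) = \<phi> a + \<phi> b" "\<phi> (a * b) = \<phi> a * \<phi> b" for a b
    using assms by (auto simp: k_algebra_map_def)
  show "\<phi> 0 = 0" using h(2)[of 0 0] by simp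
qed

lemma k_algebra_map_pow: "k_algebra_map \<phi> \<Longrightarrow> \<phi> (a ^ n) = \<phi> a ^ n"
  by (induction n) (simp_all add: k_algebra_map_simps)

lemma k_algebra_map_eq_0_iff:
  fixes \<phi> :: "'k::field \<Rightarrow> 'a::comm_ring_1"
  assumes "k_algebra_map \<phi>" shows "\<phi> c = 0 \<longleftrightarrow> c = 0"
proof
  assume "\<phi> c = 0"
  show "c = 0"
  proof (rule ccontr)
    assume "c \<noteq> 0"
    then have "\<phi> (c * inverse c) = 1" using k_algebra_map_simps[OF assms] by simp
    then show False using k_algebra_map_simps(4)[OF assms, of c "inverse c"] \<open>\<phi> c = 0\<close> by simp
  qed
qed (simp add: k_algebra_map_simps[OF assms])

lemma k_algebra_map_of_nat: "k_algebra_map \<phi> \<Longrightarrow> \<phi> (of_nat n) = of_nat n"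
  by (induction n) (simp_all add: k_algebra_map_simps)

definition mon_eval :: "(nat \<Rightarrow> 'a::comm_ring_1) \<Rightarrow> (nat \<Rightarrow>\<^sub>0 nat) \<Rightarrow> 'a" where
  "mon_eval x u = (\<Prod>v\<in>Poly_Mapping.keys u. x v ^ Poly_Mapping.lookup u v)"

lemma mon_eval_superset:
  assumes "finite B" "Poly_Mapping.keys u \<subseteq> B"
  shows "mon_eval x u = (\<Prod>v\<in>B. x v ^ Poly_Mapping.lookup u v)"
  unfolding mon_eval_def
  by (rule prod.mono_neutral_left) (use assms in \<open>auto simp: in_keys_iff\<close>)

lemma mon_eval_0 [simp]: "mon_eval x 0 = 1"
  by (simp add: mon_eval_def)

lemma mon_eval_add: "mon_eval x (u + w) = mon_eval x u * mon_eval x w"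
proof -
  let ?B = "Poly_Mapping.keys u \<union> Poly_Mapping.keys w"
  have "Poly_Mapping.keys (u + w) \<subseteq> ?B" by (rule keys_add)
  then show ?thesis
    by (subst (1 2 3) mon_eval_superset[of ?B])
       (auto simp: lookup_add power_add prod.distrib)
qed

lemma mon_eval_hom:
  assumes "comm_ring_hom h"
  shows "h (mon_eval x u) = mon_eval (\<lambda>v. h (x v)) u"
proof -
  interpret comm_ring_hom h by fact
  show ?thesis by (simp add: mon_eval_def hom_prod hom_power)
qed

lemma mp_eval_alt: "mp_eval \<phi> x p = (\<Sum>u\<in>Poly_Mapping.keys p. \<phi> (Poly_Mapping.lookup p u) * mon_eval x u)"
  by (simp add: mp_eval_def mon_eval_def)

lemma poly_mapping_as_sum:
  "p = (\<Sum>u\<in>Poly_Mapping.keys p. Poly_Mapping.single u (Poly_Mapping.lookup p u))"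
  by (rule poly_mapping_eqI)
     (simp add: lookup_sum lookup_single when_def in_keys_iff)

context
  fixes \<phi> :: "'k::field \<Rightarrow> 'a::comm_ring_1"
  assumes alg: "k_algebra_map \<phi>"
begin

lemma mp_eval_superset:
  assumes "finite B" "Poly_Mapping.keys p \<subseteq> B"
  shows "mp_eval \<phi> x p = (\<Sum>u\<in>B. \<phi> (Poly_Mapping.lookup p u) * mon_eval x u)"
  unfolding mp_eval_alt
  by (rule sum.mono_neutral_left) (use assms in \<open>auto simp: in_keys_iff k_algebra_map_simps[OF alg]\<close>)

lemma mp_eval_0 [simp]: "mp_eval \<phi> x 0 = 0"
  by (simp add: mp_eval_def)

lemma mp_eval_single: "mp_eval \<phi> x (Poly_Mapping.single u c) = \<phi> c * mon_eval x u"
  by (subst mp_eval_superset[of "{u}"]) auto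

lemma mp_eval_add: "mp_eval \<phi> x (p + q) = mp_eval \<phi> x p + mp_eval \<phi> x q"
proof -
  let ?B = "Poly_Mapping.keys p \<union> Poly_Mapping.keys q"
  have "Poly_Mapping.keys (p + q) \<subseteq> ?B" by (rule keys_add)
  then show ?thesis
    by (subst (1 2 3) mp_eval_superset[of ?B])
       (auto simp: lookup_add k_algebra_map_simps[OF alg] algebra_simps sum.distrib)
qed

lemma mp_eval_sum: "mp_eval \<phi> x (\<Sum>i\<in>I. p i) = (\<Sum>i\<in>I. mp_eval \<phi> x (p i))"
  by (induction I rule: infinite_finite_induct) (auto simp: mp_eval_add)

lemma mp_eval_mult: "mp_eval \<phi> x (p * q) = mp_eval \<phi> x p * mp_eval \<phi> x q"
proof -
  let ?P = "Poly_Mapping.keys p" and ?Q = "Poly_Mapping.keys q"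
  have "p * q = (\<Sum>u\<in>?P. Poly_Mapping.single u (Poly_Mapping.lookup p u)) *
      (\<Sum>w\<in>?Q. Poly_Mapping.single w (Poly_Mapping.lookup q w))"
    using poly_mapping_as_sum[of p] poly_mapping_as_sum[of q] by simp
  also have "\<dots> = (\<Sum>u\<in>?P. \<Sum>w\<in>?Q.
      Poly_Mapping.single (u + w) (Poly_Mapping.lookup p u * Poly_Mapping.lookup q w))"
    by (simp add: sum_product mult_single)
  finally show ?thesis
    by (simp add: mp_eval_sum mp_eval_single mon_eval_add k_algebra_map_simps[OF alg]
        mp_eval_alt[of _ _ p] mp_eval_alt[of _ _ q] sum_product mult_ac)
qed

lemma mp_eval_1 [simp]: "mp_eval \<phi> x 1 = 1"
proof -
  have "(1 :: 'k mpoly) = Poly_Mapping.single 0 1" by simp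
  then show ?thesis using mp_eval_single[of x 0 1] by (simp add: k_algebra_map_simps[OF alg])
qed

lemma mp_eval_ring_hom: "comm_ring_hom (mp_eval \<phi> x)"
  by unfold_locales (simp_all add: mp_eval_add mp_eval_mult)

end

lemma mp_eval_hom:
  assumes "comm_ring_hom h"
  shows "h (mp_eval \<phi> x p) = mp_eval (\<lambda>c. h (\<phi> c)) (\<lambda>v. h (x v)) p"
proof -
  interpret comm_ring_hom h by fact
  show ?thesis by (simp add: mp_eval_alt hom_sum hom_mult mon_eval_hom[OF assms])
qed

lemma mp_eval_cong:
  assumes "\<And>u v. u \<in> Poly_Mapping.keys p \<Longrightarrow> v \<in> Poly_Mapping.keys u \<Longrightarrow> x v = y v"
  shows "mp_eval \<phi> x p = mp_eval \<phi> y p"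
  unfolding mp_eval_def using assms by (intro sum.cong arg_cong2[where f="(*)"] prod.cong) auto

text \<open>Coordinates outside V are set to 0 instead of passing to a polynomial ring in fewer
  variables, so that all evaluations are homomorphisms on one and the same type.\<close>

definition on_set :: "'v set \<Rightarrow> ('v \<Rightarrow> 'a::zero) \<Rightarrow> 'v \<Rightarrow> 'a" where
  "on_set V x = (\<lambda>v. if v \<in> V then x v else 0)"

lemma mp_eval_on_set_lessThan: "in_Pn n p \<Longrightarrow> mp_eval \<phi> (on_set {..<n} x) p = mp_eval \<phi> x p"
  by (rule mp_eval_cong) (auto simp: in_Pn_def on_set_def)

section \<open>First-order Taylor expansion of polynomials\<close>

lemma power_taylor: "\<exists>z. ((a::'a::comm_ring_1) + h * b) ^ m = a ^ m + h * (of_nat m * a ^ (m - 1) * b) + h\<^sup>2 * z"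
proof (induction m)
  case (Suc m)
  then obtain z where z: "(a + h * b) ^ m = a ^ m + h * (of_nat m * a ^ (m - 1) * b) + h\<^sup>2 * z" by blast
  have e: "of_nat m * a ^ (m - 1) * a = of_nat m * a ^ m" by (cases m) (auto simp: mult_ac)
  have "(a + h * b) ^ Suc m = (a + h * b) * (a ^ m + h * (of_nat m * a ^ (m - 1) * b) + h\<^sup>2 * z)"
    by (simp add: z)
  also have "\<dots> = a ^ Suc m + h * ((of_nat m * a ^ (m - 1) * a) * b + a ^ m * b)
      + h\<^sup>2 * (of_nat m * a ^ (m - 1) * b * b + (a + h * b) * z)"
    by (simp add: algebra_simps power2_eq_square)
  also have "(of_nat m * a ^ (m - 1) * a) * b + a ^ m * b = of_nat (Suc m) * a ^ (Suc m - 1) * b"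
    unfolding e by (simp add: algebra_simps)
  finally show ?case by blast
qed (auto intro: exI[of _ 0])

lemma prod_taylor:
  assumes "finite S" and "\<And>v. v \<in> S \<Longrightarrow> \<exists>z. f v = (a v::'a::comm_ring_1) + h * b v + h\<^sup>2 * z"
  shows "\<exists>z. (\<Prod>v\<in>S. f v) = (\<Prod>v\<in>S. a v) + h * (\<Sum>j\<in>S. b j * (\<Prod>v\<in>S - {j}. a v)) + h\<^sup>2 * z"
  using assms
proof (induction S rule: finite_induct)
  case (insert s S)
  then obtain z where z: "(\<Prod>v\<in>S. f v) = (\<Prod>v\<in>S. a v) + h * (\<Sum>j\<in>S. b j * (\<Prod>v\<in>S - {j}. a v)) + h\<^sup>2 * z" by auto
  obtain z' where z': "f s = a s + h * b s + h\<^sup>2 * z'" using insert by auto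
  have 1: "(\<Prod>v\<in>insert s S - {j}. a v) = a s * (\<Prod>v\<in>S - {j}. a v)" if "j \<in> S" for j
  proof -
    have "insert s S - {j} = insert s (S - {j})" using that insert by auto
    then show ?thesis using insert by simp
  qed
  have 2: "(\<Sum>j\<in>insert s S. b j * (\<Prod>v\<in>insert s S - {j}. a v)) =
      b s * (\<Prod>v\<in>S. a v) + a s * (\<Sum>j\<in>S. b j * (\<Prod>v\<in>S - {j}. a v))"
    using insert by (simp add: 1 sum_distrib_left mult_ac Diff_insert0)
  let ?A = "\<Prod>v\<in>S. a v" and ?B = "\<Sum>j\<in>S. b j * (\<Prod>v\<in>S - {j}. a v)"
  have "(\<Prod>v\<in>insert s S. f v) = (a s + h * b s + h\<^sup>2 * z') * (?A + h * ?B + h\<^sup>2 * z)"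
    using insert by (simp add: z z')
  also have "\<dots> = a s * ?A + h * (b s * ?A + a s * ?B)
     + h\<^sup>2 * (b s * ?B + z' * (?A + h * ?B + h\<^sup>2 * z) + (a s + h * b s) * z)"
    by (simp add: algebra_simps power2_eq_square)
  finally show ?case unfolding 2 using insert by auto
qed (auto intro: exI[of _ 0])

lemma sum_taylor_split:
  fixes h :: "'a::comm_ring_1"
  shows "(\<Sum>u\<in>I. c u * (M u + h * D u + k * z u)) =
     (\<Sum>u\<in>I. c u * M u) + h * (\<Sum>u\<in>I. c u * D u) + k * (\<Sum>u\<in>I. c u * z u)"
  by (simp add: distrib_left sum.distrib sum_distrib_left mult_ac)

text \<open>A remainder divisible by h^2 is all that is claimed, so no division occurs and the
  characteristic is arbitrary. With h = X^k the remainder starts in degree 2k, and the coefficient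
  of X^k sees only the linear term.\<close>

lemma mp_eval_taylor:
  fixes \<phi> :: "'k::field \<Rightarrow> 'a::comm_ring_1"
  assumes "in_Pn n p"
  shows "\<exists>z. mp_eval \<phi> (\<lambda>v. x v + h * y v) p =
     mp_eval \<phi> x p + h * (\<Sum>j<n. mp_eval_pderiv \<phi> x j p * y j) + h\<^sup>2 * z"
proof -
  let ?d = "\<lambda>u j. of_nat (Poly_Mapping.lookup u j) * x j ^ (Poly_Mapping.lookup u j - 1)
       * (\<Prod>v\<in>Poly_Mapping.keys u - {j}. x v ^ Poly_Mapping.lookup u v)"
  have "\<forall>u\<in>Poly_Mapping.keys p. \<exists>z. mon_eval (\<lambda>v. x v + h * y v) u =
      mon_eval x u + h * (\<Sum>j<n. ?d u j * y j) + h\<^sup>2 * z"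
  proof
    fix u assume u: "u \<in> Poly_Mapping.keys p"
    let ?b = "\<lambda>j. of_nat (Poly_Mapping.lookup u j) * x j ^ (Poly_Mapping.lookup u j - 1) * y j"
    have "\<exists>z. mon_eval (\<lambda>v. x v + h * y v) u = mon_eval x u + h *
       (\<Sum>j\<in>Poly_Mapping.keys u. ?b j * (\<Prod>v\<in>Poly_Mapping.keys u - {j}. x v ^ Poly_Mapping.lookup u v)) + h\<^sup>2 * z"
      unfolding mon_eval_def by (rule prod_taylor) (simp, rule power_taylor)
    then obtain z where z: "mon_eval (\<lambda>v. x v + h * y v) u = mon_eval x u + h *
       (\<Sum>j\<in>Poly_Mapping.keys u. ?b j * (\<Prod>v\<in>Poly_Mapping.keys u - {j}. x v ^ Poly_Mapping.lookup u v)) + h\<^sup>2 * z"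
      by blast
    have "(\<Sum>j\<in>Poly_Mapping.keys u. ?b j * (\<Prod>v\<in>Poly_Mapping.keys u - {j}. x v ^ Poly_Mapping.lookup u v))
       = (\<Sum>j<n. ?d u j * y j)"
      by (rule sum.mono_neutral_cong_left)
         (use assms u in \<open>auto simp: in_Pn_def in_keys_iff mult_ac\<close>)
    with z show "\<exists>z. mon_eval (\<lambda>v. x v + h * y v) u =
      mon_eval x u + h * (\<Sum>j<n. ?d u j * y j) + h\<^sup>2 * z" by auto
  qed
  from bchoice[OF this] obtain z where z: "\<forall>u\<in>Poly_Mapping.keys p. mon_eval (\<lambda>v. x v + h * y v) u =
      mon_eval x u + h * (\<Sum>j<n. ?d u j * y j) + h\<^sup>2 * z u" by blast
  have "mp_eval \<phi> (\<lambda>v. x v + h * y v) p = (\<Sum>u\<in>Poly_Mapping.keys p. \<phi> (Poly_Mapping.lookup p u) *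
     (mon_eval x u + h * (\<Sum>j<n. ?d u j * y j) + h\<^sup>2 * z u))"
    unfolding mp_eval_alt using z by (intro sum.cong) auto
  also have "\<dots> = mp_eval \<phi> x p
     + h * (\<Sum>u\<in>Poly_Mapping.keys p. \<phi> (Poly_Mapping.lookup p u) * (\<Sum>j<n. ?d u j * y j))
     + h\<^sup>2 * (\<Sum>u\<in>Poly_Mapping.keys p. \<phi> (Poly_Mapping.lookup p u) * z u)"
    unfolding mp_eval_alt by (rule sum_taylor_split)
  also have "(\<Sum>u\<in>Poly_Mapping.keys p. \<phi> (Poly_Mapping.lookup p u) * (\<Sum>j<n. ?d u j * y j))
     = (\<Sum>j<n. mp_eval_pderiv \<phi> x j p * y j)"
    unfolding mp_eval_pderiv_def sum_distrib_left sum_distrib_right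
    by (subst sum.swap) (simp only: mult.assoc)
  finally show ?thesis by blast
qed

definition restrict_vars :: "nat set \<Rightarrow> 'k::field mpoly \<Rightarrow> 'k mpoly" where
  "restrict_vars V p = (\<Sum>u | u \<in> Poly_Mapping.keys p \<and> Poly_Mapping.keys u \<subseteq> V.
     Poly_Mapping.single u (Poly_Mapping.lookup p u))"

definition in_vars :: "nat set \<Rightarrow> 'k::field mpoly \<Rightarrow> bool" where
  "in_vars V p \<longleftrightarrow> (\<forall>u\<in>Poly_Mapping.keys p. Poly_Mapping.keys u \<subseteq> V)"

lemma in_vars_lessThan: "in_vars {..<n} p = in_Pn n p"
  by (auto simp: in_vars_def in_Pn_def)

lemma in_vars_restrict_vars: "in_vars V (restrict_vars V p)"
  unfolding in_vars_def restrict_vars_def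
  by (auto dest!: subsetD[OF keys_sum] split: if_splits)

text \<open>A monomial with a variable outside V evaluates to 0. In this way a value at
  \<open>on_set V x\<close> becomes the value at the full point \<open>x\<close> of a polynomial in
  the variables V.\<close>

lemma mp_eval_restrict_vars:
  assumes \<psi>: "k_algebra_map \<psi>" and z: "\<And>v. v \<notin> V \<Longrightarrow> z v = 0"
  shows "mp_eval \<psi> z (restrict_vars V p) = mp_eval \<psi> z p"
proof -
  have "mp_eval \<psi> z (restrict_vars V p) = (\<Sum>u | u \<in> Poly_Mapping.keys p \<and> Poly_Mapping.keys u \<subseteq> V.
     \<psi> (Poly_Mapping.lookup p u) * mon_eval z u)"
    by (simp add: restrict_vars_def mp_eval_sum[OF \<psi>] mp_eval_single[OF \<psi>])
  also have "\<dots> = (\<Sum>u\<in>Poly_Mapping.keys p. \<psi> (Poly_Mapping.lookup p u) * mon_eval z u)"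
  proof (rule sum.mono_neutral_left)
    show "\<forall>u\<in>Poly_Mapping.keys p - {u \<in> Poly_Mapping.keys p. Poly_Mapping.keys u \<subseteq> V}.
        \<psi> (Poly_Mapping.lookup p u) * mon_eval z u = 0"
    proof
      fix u assume "u \<in> Poly_Mapping.keys p - {u \<in> Poly_Mapping.keys p. Poly_Mapping.keys u \<subseteq> V}"
      then obtain v where "v \<in> Poly_Mapping.keys u" "v \<notin> V" by auto
      then have "mon_eval z u = 0" unfolding mon_eval_def
        by (intro prod_zero) (auto simp: z in_keys_iff zero_power intro!: bexI[of _ v])
      then show "\<psi> (Poly_Mapping.lookup p u) * mon_eval z u = 0" by simp
    qed
  qed auto
  finally show ?thesis by (simp add: mp_eval_alt)
qed

lemma mp_eval_in_vars_cong:
  "in_vars V p \<Longrightarrow> (\<And>v. v \<in> V \<Longrightarrow> y v = z v) \<Longrightarrow> mp_eval \<psi> y p = mp_eval \<psi> z p"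
  by (rule mp_eval_cong) (auto simp: in_vars_def)

section \<open>Separable extensions of homomorphisms into power series\<close>

definition vanish :: "nat \<Rightarrow> 'a::zero fps \<Rightarrow> bool" where
  "vanish K f \<longleftrightarrow> (\<forall>i<K. fps_nth f i = 0)"

lemma vanish_0 [simp]: "vanish K 0"
  by (simp add: vanish_def)

lemma vanish_add: "vanish K f \<Longrightarrow> vanish K g \<Longrightarrow> vanish K (f + (g :: 'a::comm_ring_1 fps))"
  by (simp add: vanish_def)

lemma vanish_diff: "vanish K f \<Longrightarrow> vanish K g \<Longrightarrow> vanish K (f - (g :: 'a::comm_ring_1 fps))"
  by (simp add: vanish_def)

lemma vanish_mult: "vanish K f \<Longrightarrow> vanish K (f * (g :: 'a::comm_ring_1 fps))"
  by (auto simp: vanish_def fps_mult_nth intro!: sum.neutral)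

lemma vanish_mult2: "vanish K f \<Longrightarrow> vanish K (g * (f :: 'a::comm_ring_1 fps))"
  using vanish_mult[of K f g] by (simp add: mult.commute)

lemma vanish_sum: "(\<And>i. i \<in> I \<Longrightarrow> vanish K (f i)) \<Longrightarrow> vanish K (\<Sum>i\<in>I. (f i :: 'a::comm_ring_1 fps))"
  by (induction I rule: infinite_finite_induct) (auto intro: vanish_add)

lemma vanish_X_power_mult: "vanish K (fps_X ^ K * (f :: 'a::comm_ring_1 fps))"
  by (simp add: vanish_def fps_X_power_mult_nth)

lemma vanish_cancel:
  fixes w :: "'a::field fps"
  assumes "vanish K (w * z)" "fps_nth w 0 \<noteq> 0" shows "vanish K z"
proof -
  have "vanish K (inverse w * (w * z))" by (rule vanish_mult2) fact
  also have "inverse w * (w * z) = (inverse w * w) * z" by (simp add: mult.assoc)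
  also have "\<dots> = z" using inverse_mult_eq_1[of w] assms by simp
  finally show ?thesis .
qed

lemma fps_nth_0_hom: "comm_ring_hom (\<lambda>f :: 'a::comm_ring_1 fps. fps_nth f 0)"
  by unfold_locales simp_all

lemma fps_nth_0_idom_hom: "idom_hom (\<lambda>f :: 'a::idom fps. fps_nth f 0)"
  by unfold_locales simp_all

lemma comm_ring_hom_comp:
  assumes "comm_ring_hom f" "comm_ring_hom g" shows "comm_ring_hom (\<lambda>x. f (g x))"
proof -
  interpret f: comm_ring_hom f by fact
  interpret g: comm_ring_hom g by fact
  show ?thesis by unfold_locales (simp_all add: f.hom_add f.hom_mult g.hom_add g.hom_mult)
qed

lemma poly_map_poly_smult:
  assumes "comm_ring_hom h" shows "poly (map_poly h (Polynomial.smult c P)) y = h c * poly (map_poly h P) y"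
proof -
  interpret comm_ring_hom h by fact
  show ?thesis by (simp add: map_poly_hom_smult)
qed

text \<open>Pseudo-division multiplies by powers of the leading coefficient, which is harmless only
  if \<open>h0\<close> does not kill it. Cutting off all coefficients above the degree of the image
  arranges this.\<close>

lemma map_poly_truncate:
  fixes h0 :: "'c::comm_ring_1 \<Rightarrow> 'l::idom"
  assumes h: "comm_ring_hom h0" and "map_poly h0 P \<noteq> 0"
  obtains P' where "map_poly h0 P' = map_poly h0 P" "degree P' = degree (map_poly h0 P)"
    "h0 (lead_coeff P') \<noteq> 0"
proof
  interpret comm_ring_hom h0 by fact
  let ?d = "degree (map_poly h0 P)"
  let ?P = "poly_cutoff (Suc ?d) P"
  show eq: "map_poly h0 ?P = map_poly h0 P"
  proof (rule poly_eqI)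
    fix i show "coeff (map_poly h0 ?P) i = coeff (map_poly h0 P) i"
      using coeff_eq_0[of "map_poly h0 P" i] by (auto simp: coeff_poly_cutoff)
  qed
  show d: "degree ?P = ?d"
  proof (rule antisym)
    show "degree ?P \<le> ?d" by (rule degree_le) (auto simp: coeff_poly_cutoff)
    show "?d \<le> degree ?P" using degree_map_poly_le[of h0 ?P] eq by simp
  qed
  have "h0 (coeff ?P ?d) = lead_coeff (map_poly h0 P)"
    by (simp add: coeff_poly_cutoff)
  then show "h0 (lead_coeff ?P) \<noteq> 0" using assms(2) unfolding d by (metis leading_coeff_0_iff)
qed

lemma pseudo_division:
  fixes g :: "'c::comm_ring_1 poly"
  assumes "g \<noteq> 0"
  obtains k q r where "Polynomial.smult (lead_coeff g ^ k) f = g * q + r" "r = 0 \<or> degree r < degree g"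
  using pseudo_divmod[OF assms, of f "fst (pseudo_divmod f g)" "snd (pseudo_divmod f g)"] by auto

text \<open>The subring h0(C) need not be a field, so division by the minimal polynomial m of y is pseudo-division.\<close>
lemma relative_minpoly:
  fixes h0 :: "'c::comm_ring_1 \<Rightarrow> 'l::field"
  assumes h: "comm_ring_hom h0" and Q: "map_poly h0 Q \<noteq> 0" "poly (map_poly h0 Q) y = 0"
  obtains m where "poly (map_poly h0 m) y = 0" "h0 (lead_coeff m) \<noteq> 0"
    "degree (map_poly h0 m) = degree m"
    "\<And>P. poly (map_poly h0 P) y = 0 \<Longrightarrow> degree (map_poly h0 P) < degree m \<Longrightarrow> map_poly h0 P = 0"
    "\<And>P. poly (map_poly h0 P) y = 0 \<Longrightarrow>
       \<exists>k b r. Polynomial.smult (lead_coeff m ^ k) P = m * b + r \<and> map_poly h0 r = 0"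
proof -
  interpret comm_ring_hom h0 by fact
  interpret mp: map_poly_comm_ring_hom h0 ..
  define good where "good = (\<lambda>P. map_poly h0 P \<noteq> 0 \<and> poly (map_poly h0 P) y = 0)"
  have "good Q" using Q by (simp add: good_def)
  define P where "P = arg_min (\<lambda>P. degree (map_poly h0 P)) good"
  have P: "good P" unfolding P_def by (rule arg_min_natI) fact
  have Pmin: "degree (map_poly h0 P) \<le> degree (map_poly h0 P')" if "good P'" for P'
    unfolding P_def using arg_min_nat_le[of good P' "\<lambda>P. degree (map_poly h0 P)"] that by blast
  obtain m where m: "map_poly h0 m = map_poly h0 P" "degree m = degree (map_poly h0 P)"
    "h0 (lead_coeff m) \<noteq> 0"
    using map_poly_truncate[OF h, of P] P by (auto simp: good_def)
  have my: "poly (map_poly h0 m) y = 0" using P m by (simp add: good_def)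
  have min: "map_poly h0 P' = 0" if "poly (map_poly h0 P') y = 0" "degree (map_poly h0 P') < degree m" for P'
    using Pmin[of P'] that m by (auto simp: good_def)
  have "\<exists>k b r. Polynomial.smult (lead_coeff m ^ k) F = m * b + r \<and> map_poly h0 r = 0"
    if F: "poly (map_poly h0 F) y = 0" for F
  proof -
    have "m \<noteq> 0" using m by auto
    then obtain k b r where r: "Polynomial.smult (lead_coeff m ^ k) F = m * b + r" "r = 0 \<or> degree r < degree m"
      by (rule pseudo_division)
    have "poly (map_poly h0 (Polynomial.smult (lead_coeff m ^ k) F)) y = 0"
      using F by (simp add: poly_map_poly_smult[OF h])
    then have "poly (map_poly h0 r) y = 0"
      unfolding r by (simp add: mp.hom_add mp.hom_mult my)
    moreover have "r = 0 \<or> degree (map_poly h0 r) < degree m"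
      using r(2) degree_map_poly_le[of h0 r] by linarith
    ultimately have "map_poly h0 r = 0" using min by auto
    with r show ?thesis by blast
  qed
  with that[OF my m(3) _ min] m show thesis by simp
qed

lemma vanish_poly:
  fixes P :: "'l::comm_ring_1 fps poly"
  assumes "\<And>i. vanish K (coeff P i)"
  shows "vanish K (poly P y)"
  unfolding poly_altdef by (intro vanish_sum vanish_mult assms)

lemma poly_map_poly_nth_0:
  "fps_nth (poly F \<eta>) 0 = poly (map_poly (\<lambda>f. fps_nth f 0) F) (fps_nth (\<eta> :: 'l::comm_ring_1 fps) 0)"
proof -
  interpret comm_ring_hom "\<lambda>f :: 'l fps. fps_nth f 0" by (rule fps_nth_0_hom)
  show ?thesis using poly_map_poly[of F \<eta>] by simp
qed

lemma map_poly_map_poly_nth_0: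
  fixes h :: "'c::comm_ring_1 \<Rightarrow> 'l::comm_ring_1 fps"
  assumes "comm_ring_hom h"
  shows "map_poly (\<lambda>f. fps_nth f 0) (map_poly h P) = map_poly (\<lambda>c. fps_nth (h c) 0) P"
proof -
  interpret comm_ring_hom h by fact
  show ?thesis by (simp add: map_poly_map_poly o_def)
qed

text \<open>A simple root y of Q, lifted to a root \<eta> of the lift of Q, satisfies the lifts of all
  polynomial equations satisfied by y: each of them is a multiple of the minimal polynomial.\<close>
lemma separable_extension:
  fixes h :: "'c::comm_ring_1 \<Rightarrow> 'l::field fps" and \<eta> :: "'l fps"
  defines "h0 \<equiv> \<lambda>c. fps_nth (h c) 0" and "y \<equiv> fps_nth \<eta> 0"
  assumes h: "comm_ring_hom h" and ker: "\<And>c. h0 c = 0 \<Longrightarrow> vanish K (h c)"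
    and Q: "poly (map_poly h0 Q) y = 0" "poly (pderiv (map_poly h0 Q)) y \<noteq> 0"
      "vanish K (poly (map_poly h Q) \<eta>)"
    and P: "poly (map_poly h0 P) y = 0"
  shows "vanish K (poly (map_poly h P) \<eta>)"
proof -
  interpret comm_ring_hom h by fact
  interpret mp: map_poly_comm_ring_hom h ..
  have h0: "comm_ring_hom h0" unfolding h0_def by (rule comm_ring_hom_comp[OF fps_nth_0_hom h])
  interpret h0: comm_ring_hom h0 by fact
  interpret mp0: map_poly_comm_ring_hom h0 ..
  have nth0: "fps_nth (poly (map_poly h F) \<eta>) 0 = poly (map_poly h0 F) y" for F
    by (simp add: poly_map_poly_nth_0 map_poly_map_poly_nth_0[OF h] h0_def y_def)
  have van: "vanish K (poly (map_poly h r) \<eta>)" if "map_poly h0 r = 0" for r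
  proof (rule vanish_poly)
    fix i have "h0 (coeff r i) = coeff (map_poly h0 r) i" by simp
    also have "\<dots> = 0" using that by simp
    finally show "vanish K (coeff (map_poly h r) i)" using ker by simp
  qed
  have "map_poly h0 Q \<noteq> 0" using Q(2) by auto
  from relative_minpoly[OF h0 this Q(1)] obtain m where
    m: "poly (map_poly h0 m) y = 0" "h0 (lead_coeff m) \<noteq> 0"
    and div: "\<And>P. poly (map_poly h0 P) y = 0 \<Longrightarrow>
       \<exists>k b r. Polynomial.smult (lead_coeff m ^ k) P = m * b + r \<and> map_poly h0 r = 0" by metis
  let ?l = "lead_coeff m"
  obtain k b r where Qm: "Polynomial.smult (?l ^ k) Q = m * b + r" "map_poly h0 r = 0" using div[OF Q(1)] by blast
  \<comment> \<open>Up to a nonzero factor Q is the product m b. As m(y) = 0, the derivative at y is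
    m'(y) b(y), so b(y) is nonzero because y is a simple root of Q. Then b(\<eta>) is a unit and can
    be cancelled from the vanishing of Q(\<eta>).\<close>
  have "Polynomial.smult (h0 ?l ^ k) (map_poly h0 Q) = map_poly h0 m * map_poly h0 b"
    using arg_cong[OF Qm(1), of "map_poly h0"] Qm(2)
    by (simp add: mp0.hom_add mp0.hom_mult h0.map_poly_hom_smult h0.hom_power)
  then have "h0 ?l ^ k * poly (pderiv (map_poly h0 Q)) y =
      poly (pderiv (map_poly h0 m * map_poly h0 b)) y"
    by (metis pderiv_smult poly_smult)
  also have "\<dots> = poly (pderiv (map_poly h0 m)) y * poly (map_poly h0 b) y"
    using m by (simp add: pderiv_mult)
  finally have bny: "poly (map_poly h0 b) y \<noteq> 0" using Q(2) m(2) by auto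
  have "vanish K (poly (map_poly h (Polynomial.smult (?l ^ k) Q)) \<eta>)"
    by (simp add: poly_map_poly_smult[OF h] vanish_mult2 Q(3))
  then have "vanish K (poly (map_poly h b) \<eta> * poly (map_poly h m) \<eta> + poly (map_poly h r) \<eta>)"
    unfolding Qm by (simp add: mp.hom_add mp.hom_mult mult.commute)
  then have "vanish K (poly (map_poly h b) \<eta> * poly (map_poly h m) \<eta>)"
    using vanish_diff[OF _ van[OF Qm(2)]] by fastforce
  then have vm: "vanish K (poly (map_poly h m) \<eta>)"
    by (rule vanish_cancel) (use bny nth0 in simp)
  obtain k' b' r' where Pm: "Polynomial.smult (?l ^ k') P = m * b' + r'" "map_poly h0 r' = 0" using div[OF P] by blast
  have "vanish K (poly (map_poly h (Polynomial.smult (?l ^ k') P)) \<eta>)"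
    unfolding Pm by (simp add: mp.hom_add mp.hom_mult vanish_add vanish_mult vm van Pm)
  then have "vanish K (h ?l ^ k' * poly (map_poly h P) \<eta>)"
    by (simp add: poly_map_poly_smult[OF h] hom_power)
  then show ?thesis
    by (rule vanish_cancel) (use m(2) in \<open>simp add: h0_def\<close>)
qed

section \<open>Lifting simple roots by Newton iteration\<close>

lemma poly_taylor: "\<exists>z. poly P ((a::'a::{comm_ring_1,ring_no_zero_divisors}) + h) = poly P a + h * poly (pderiv P) a + h\<^sup>2 * z"
proof (induction P)
  case (pCons c P)
  then obtain z where z: "poly P (a + h) = poly P a + h * poly (pderiv P) a + h\<^sup>2 * z" by blast
  have "poly (pCons c P) (a + h) = poly (pCons c P) a + h * poly (pderiv (pCons c P)) a
      + h\<^sup>2 * (poly (pderiv P) a + (a + h) * z)"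
    by (simp add: z pderiv_pCons algebra_simps power2_eq_square)
  then show ?case by blast
qed auto

lemma hensel:
  fixes P :: "'l::field fps poly"
  defines "P0 \<equiv> map_poly (\<lambda>f. fps_nth f 0) P"
  assumes root: "poly P0 y = 0" and simple: "poly (pderiv P0) y \<noteq> 0"
  shows "\<exists>\<eta>. fps_nth \<eta> 0 = y \<and> vanish K (poly P \<eta>)"
proof (induction K)
  case 0
  show ?case by (intro exI[of _ "fps_const y"]) (simp add: vanish_def)
next
  case (Suc K)
  then obtain \<eta> where \<eta>: "fps_nth \<eta> 0 = y" "vanish K (poly P \<eta>)" by blast
  show ?case
  proof (cases "K = 0")
    \<comment> \<open>The constant term vanishes already, whereas a correction by a multiple of X^0
      would move y.\<close>
    case True
    have "fps_nth (poly P \<eta>) 0 = 0"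
      using root \<eta>(1) by (simp add: poly_map_poly_nth_0 P0_def)
    with True \<eta>(1) show ?thesis by (auto simp: vanish_def)
  next
    case False
    let ?d = "poly (pderiv P0) y"
    \<comment> \<open>The correction c X^K changes the K-th coefficient by c times the derivative at
      y; the quadratic term is divisible by X^(2K), and 2K > K as K is positive.\<close>
    define c where "c = - fps_nth (poly P \<eta>) K / ?d"
    let ?h = "fps_X ^ K * fps_const c"
    obtain z where z: "poly P (\<eta> + ?h) = poly P \<eta> + ?h * poly (pderiv P) \<eta> + ?h\<^sup>2 * z"
      using poly_taylor by blast
    have d: "fps_nth (poly (pderiv P) \<eta>) 0 = ?d"
      using \<eta>(1) by (simp add: poly_map_poly_nth_0 P0_def idom_hom.map_poly_pderiv[OF fps_nth_0_idom_hom])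
    have sq: "?h\<^sup>2 * z = fps_X ^ Suc K * (fps_X ^ (K - 1) * fps_const c ^ 2 * z)"
    proof -
      have "fps_X ^ Suc K * fps_X ^ (K - 1) = (fps_X ^ K * fps_X ^ K :: 'l fps)"
        using False unfolding power_add[symmetric] by (intro arg_cong[where f="(^) fps_X"]) simp
      then show ?thesis by (simp only: power2_eq_square power_mult_distrib mult_ac)
    qed
    have "fps_nth (poly P (\<eta> + ?h)) i = 0" if "i < Suc K" for i
    proof -
      have "fps_nth (?h\<^sup>2 * z) i = 0" unfolding sq using that
        by (simp only: fps_X_power_mult_nth) simp
      moreover have "fps_nth (?h * poly (pderiv P) \<eta>) i = (if i = K then c * ?d else 0)"
        using that d by (auto simp: mult.assoc fps_X_power_mult_nth)
      moreover have "fps_nth (poly P (\<eta> + ?h)) i =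
          fps_nth (poly P \<eta>) i + fps_nth (?h * poly (pderiv P) \<eta>) i + fps_nth (?h\<^sup>2 * z) i"
        unfolding z by (simp only: fps_add_nth)
      moreover have "c * ?d = - fps_nth (poly P \<eta>) K" using simple by (simp add: c_def)
      ultimately show ?thesis using \<eta>(2) that by (auto simp: vanish_def less_Suc_eq)
    qed
    moreover have "fps_nth (\<eta> + ?h) 0 = y" using \<eta>(1) False by (simp add: fps_X_power_mult_nth)
    ultimately show ?thesis unfolding vanish_def by blast
  qed
qed

text \<open>Euclid's algorithm: a nonzero element of J of minimal degree in y has degree 0, since the
  remainder of the minimal polynomial of y by it lies in J again.\<close>
lemma algebraic_descent:
  fixes h0 :: "'c::comm_ring_1 \<Rightarrow> 'l::field"
  assumes h: "comm_ring_hom h0" and Q: "map_poly h0 Q \<noteq> 0" "poly (map_poly h0 Q) y = 0"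
    and J: "\<And>P a. a \<in> J \<Longrightarrow> poly (map_poly h0 P) y * a \<in> J"
    and B: "poly (map_poly h0 B) y \<in> J" "poly (map_poly h0 B) y \<noteq> 0"
  shows "\<exists>c. h0 c \<in> J \<and> h0 c \<noteq> 0"
proof -
  interpret comm_ring_hom h0 by fact
  interpret mp: map_poly_comm_ring_hom h0 ..
  let ?e = "\<lambda>P. poly (map_poly h0 P) y"
  obtain m where m: "?e m = 0" "h0 (lead_coeff m) \<noteq> 0" "degree (map_poly h0 m) = degree m"
    and min: "\<And>P. ?e P = 0 \<Longrightarrow> degree (map_poly h0 P) < degree m \<Longrightarrow> map_poly h0 P = 0"
    using relative_minpoly[OF h Q] by metis
  define good where "good = (\<lambda>P. ?e P \<in> J \<and> ?e P \<noteq> 0)"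
  have "good B" using B by (simp add: good_def)
  define D where "D = arg_min (\<lambda>P. degree (map_poly h0 P)) good"
  have D: "good D" unfolding D_def by (rule arg_min_natI) fact
  have Dmin: "degree (map_poly h0 D) \<le> degree (map_poly h0 P')" if "good P'" for P'
    unfolding D_def using arg_min_nat_le[of good P' "\<lambda>P. degree (map_poly h0 P)"] that by blast
  have "map_poly h0 D \<noteq> 0" using D by (auto simp: good_def)
  then obtain E where E: "map_poly h0 E = map_poly h0 D" "degree E = degree (map_poly h0 D)"
      "h0 (lead_coeff E) \<noteq> 0"
    using map_poly_truncate[OF h] by metis
  have eE: "?e E \<in> J" "?e E \<noteq> 0" using D E by (auto simp: good_def)
  have degE: "degree E = 0"
  proof (rule ccontr)
    assume dE: "degree E \<noteq> 0"
    \<comment> \<open>If m has smaller degree than E, reducing E modulo m keeps the value at y up to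
      a nonzero factor and contradicts the minimality of E. Otherwise the remainder of m by E has a
      value in J, which must be 0; the quotient is then a relation of degree deg m - deg E, against
      the minimality of m.\<close>
    show False
    proof (cases "degree m < degree E")
      case True
      have "m \<noteq> 0" using m by auto
      then obtain k q r where r: "Polynomial.smult (lead_coeff m ^ k) E = m * q + r" "r = 0 \<or> degree r < degree m"
        by (rule pseudo_division)
      have "?e r = h0 (lead_coeff m) ^ k * ?e E"
        using arg_cong[OF r(1), of ?e] m(1)
        by (simp add: mp.hom_add mp.hom_mult poly_map_poly_smult[OF h] hom_power)
      moreover have "h0 (lead_coeff m) ^ k * ?e E = ?e [:lead_coeff m ^ k:] * ?e E"
        by (simp add: map_poly_pCons_hom hom_power)
      moreover have "h0 (lead_coeff m) ^ k * ?e E \<noteq> 0" using eE(2) m(2) by simp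
      ultimately have "good r" using J[OF eE(1), of "[:lead_coeff m ^ k:]"] unfolding good_def by metis
      from Dmin[OF this] show False using r(2) True degree_map_poly_le[of h0 r] E(2) \<open>good r\<close>
        by (auto simp: good_def)
    next
      case False
      have "E \<noteq> 0" using dE by auto
      then obtain k q r where r: "Polynomial.smult (lead_coeff E ^ k) m = E * q + r" "r = 0 \<or> degree r < degree E"
        by (rule pseudo_division)
      have er: "?e r = ?e (- q) * ?e E"
        using arg_cong[OF r(1), of ?e] m(1)
        by (simp add: mp.hom_add mp.hom_mult mp.hom_uminus poly_map_poly_smult[OF h] hom_power)
           (simp add: add_eq_0_iff mult.commute)
      have "degree (map_poly h0 r) < degree E"
        using r(2) degree_map_poly_le[of h0 r] dE by (cases "r = 0") auto
      then have "?e r = 0" using Dmin[of r] J[OF eE(1), of "- q"] er E(2) by (auto simp: good_def)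
      with er eE have eq: "?e q = 0" by (simp add: mp.hom_uminus)
      have id: "Polynomial.smult (h0 (lead_coeff E) ^ k) (map_poly h0 m) = map_poly h0 E * map_poly h0 q + map_poly h0 r"
        using arg_cong[OF r(1), of "map_poly h0"]
        by (simp add: mp.hom_add mp.hom_mult map_poly_hom_smult hom_power)
      have "degree (Polynomial.smult (h0 (lead_coeff E) ^ k) (map_poly h0 m)) = degree m"
        using E(3) m(3) by simp
      then have dd: "degree (map_poly h0 E * map_poly h0 q + map_poly h0 r) = degree m" by (simp add: id)
      have "map_poly h0 q \<noteq> 0"
        using dd \<open>degree (map_poly h0 r) < degree E\<close> False by auto
      moreover have "degree (map_poly h0 q) < degree m"
      proof -
        have dEq: "degree (map_poly h0 E * map_poly h0 q) = degree E + degree (map_poly h0 q)"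
          using \<open>map_poly h0 q \<noteq> 0\<close> \<open>map_poly h0 D \<noteq> 0\<close> E by (simp add: degree_mult_eq)
        then have "degree (map_poly h0 E * map_poly h0 q + map_poly h0 r) = degree E + degree (map_poly h0 q)"
          using \<open>degree (map_poly h0 r) < degree E\<close> by (subst degree_add_eq_left) auto
        then show ?thesis using dd dE by simp
      qed
      ultimately show False using min[OF eq] by blast
    qed
  qed
  then obtain c where "E = [:c:]" by (metis degree_eq_zeroE)
  then have "?e E = h0 c" by (simp add: map_poly_pCons_hom)
  then show ?thesis using eE by auto
qed

section \<open>Truncated curves\<close>

text \<open>The coefficients stay in the full polynomial type but no longer contain the variable
  \<open>i\<close>, so an evaluation of them can be continued by an arbitrary value for
  \<open>i\<close>.\<close>

definition as_univariate :: "nat \<Rightarrow> 'k::field mpoly \<Rightarrow> 'k mpoly poly" where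
  "as_univariate i p = (\<Sum>u\<in>Poly_Mapping.keys p.
     monom (Poly_Mapping.single (u - Poly_Mapping.single i (Poly_Mapping.lookup u i)) (Poly_Mapping.lookup p u))
       (Poly_Mapping.lookup u i))"

lemma mon_eval_fun_upd:
  "mon_eval (\<xi>(i := \<eta>)) u = mon_eval \<xi> (u - Poly_Mapping.single i (Poly_Mapping.lookup u i)) * \<eta> ^ Poly_Mapping.lookup u i"
proof -
  let ?w = "u - Poly_Mapping.single i (Poly_Mapping.lookup u i)"
  let ?B = "insert i (Poly_Mapping.keys u)"
  have l: "Poly_Mapping.lookup ?w v = (if v = i then 0 else Poly_Mapping.lookup u v)" for v
    by (auto simp: lookup_minus lookup_single when_def)
  have "Poly_Mapping.keys ?w \<subseteq> ?B" by (auto simp: in_keys_iff l split: if_splits)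
  then have "mon_eval \<xi> ?w = (\<Prod>v\<in>?B. \<xi> v ^ Poly_Mapping.lookup ?w v)"
    by (intro mon_eval_superset) auto
  also have "\<dots> = (\<Prod>v\<in>?B - {i}. \<xi> v ^ Poly_Mapping.lookup ?w v)"
    by (subst prod.remove[of ?B i]) (auto simp: l)
  also have "\<dots> = (\<Prod>v\<in>?B - {i}. (\<xi>(i := \<eta>)) v ^ Poly_Mapping.lookup u v)"
    by (rule prod.cong) (auto simp: l)
  finally have 1: "mon_eval \<xi> ?w = \<dots>" .
  have "mon_eval (\<xi>(i := \<eta>)) u = (\<Prod>v\<in>?B. (\<xi>(i := \<eta>)) v ^ Poly_Mapping.lookup u v)"
    by (intro mon_eval_superset) auto
  also have "\<dots> = \<eta> ^ Poly_Mapping.lookup u i * (\<Prod>v\<in>?B - {i}. (\<xi>(i := \<eta>)) v ^ Poly_Mapping.lookup u v)"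
    by (subst prod.remove[of ?B i]) auto
  finally show ?thesis using 1 by (simp only: mult.commute)
qed

lemma mp_eval_as_univariate:
  assumes "k_algebra_map \<psi>"
  shows "mp_eval \<psi> (\<xi>(i := \<eta>)) p = poly (map_poly (mp_eval \<psi> \<xi>) (as_univariate i p)) \<eta>"
proof -
  interpret comm_ring_hom "mp_eval \<psi> \<xi>" by (rule mp_eval_ring_hom[OF assms])
  interpret m: map_poly_comm_ring_hom "mp_eval \<psi> \<xi>" ..
  show ?thesis
    by (simp add: as_univariate_def m.hom_sum poly_hom.hom_sum poly_monom mp_eval_single[OF assms]
        mp_eval_alt[of \<psi> "\<xi>(i := \<eta>)"] mon_eval_fun_upd mult.assoc)
qed

lemma on_set_insert: "on_set (insert i V) x = (on_set V x)(i := x i)"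
  by (auto simp: on_set_def)

text \<open>The point \<open>x\<close> is meant to be the generic point: the images of the variables
  in the fraction field of A.\<close>

locale field_point =
  fixes \<phi> :: "'k::field \<Rightarrow> 'l::field" and x :: "nat \<Rightarrow> 'l"
  assumes alg: "k_algebra_map \<phi>"
begin

abbreviation ev :: "nat set \<Rightarrow> 'k mpoly \<Rightarrow> 'l" where
  "ev V \<equiv> mp_eval \<phi> (on_set V x)"

abbreviation ev_fps :: "(nat \<Rightarrow> 'l fps) \<Rightarrow> 'k mpoly \<Rightarrow> 'l fps" where
  "ev_fps \<xi> \<equiv> mp_eval (\<lambda>c. fps_const (\<phi> c)) \<xi>"

text \<open>A truncated curve through the point x restricted to the variables V: it satisfies, up to
  order K, all the polynomial relations of x in these variables. The remaining variables are set to 0.\<close>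
definition curve :: "nat \<Rightarrow> nat set \<Rightarrow> (nat \<Rightarrow> 'l fps) \<Rightarrow> bool" where
  "curve K V \<xi> \<longleftrightarrow> (\<forall>v. fps_nth (\<xi> v) 0 = on_set V x v) \<and> (\<forall>v. v \<notin> V \<longrightarrow> \<xi> v = 0) \<and>
     (\<forall>p. ev V p = 0 \<longrightarrow> vanish K (ev_fps \<xi> p))"

text \<open>The coefficients of Q come from the ring generated by the coordinates in V and not from
  its fraction field; clearing denominators does not affect simple roots.\<close>

definition sep_algebraic :: "nat set \<Rightarrow> nat \<Rightarrow> bool" where
  "sep_algebraic V i \<longleftrightarrow> (\<exists>Q. poly (map_poly (ev V) Q) (x i) = 0 \<and> poly (pderiv (map_poly (ev V) Q)) (x i) \<noteq> 0)"

text \<open>A curve modulo X^2 is a derivation of the ring generated by the coordinates in V, given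
  by the coefficients of X. So no nonzero derivation kills the coordinates in
  \<open>V\<^sub>0\<close>.\<close>

definition rigid :: "nat set \<Rightarrow> nat set \<Rightarrow> bool" where
  "rigid V\<^sub>0 V \<longleftrightarrow> (\<forall>\<xi>. curve 2 V \<xi> \<longrightarrow> (\<forall>c\<in>V\<^sub>0. fps_nth (\<xi> c) 1 = 0) \<longrightarrow> (\<forall>v. fps_nth (\<xi> v) 1 = 0))"

lemma alg_fps: "k_algebra_map (\<lambda>c. fps_const (\<phi> c))"
  unfolding k_algebra_map_def using k_algebra_map_simps[OF alg] by simp

lemma ev_hom: "comm_ring_hom (ev V)"
  by (rule mp_eval_ring_hom[OF alg])

lemma ev_fps_hom: "comm_ring_hom (ev_fps \<xi>)"
  by (rule mp_eval_ring_hom[OF alg_fps])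

lemma nth_0_ev_fps: "fps_nth (ev_fps \<xi> p) 0 = mp_eval \<phi> (\<lambda>v. fps_nth (\<xi> v) 0) p"
  using mp_eval_hom[OF fps_nth_0_hom, of "\<lambda>c. fps_const (\<phi> c)" \<xi> p] by simp

lemma curve_nth_0: "curve K V \<xi> \<Longrightarrow> fps_nth (ev_fps \<xi> p) 0 = ev V p"
  unfolding nth_0_ev_fps by (simp add: curve_def)

lemma ev_fps_const: "ev_fps (\<lambda>v. fps_const (z v)) p = fps_const (mp_eval \<phi> z p)"
proof -
  have "comm_ring_hom (fps_const :: 'l \<Rightarrow> _)" by unfold_locales auto
  from mp_eval_hom[OF this, of \<phi> z p] show ?thesis by simp
qed

text \<open>A relation in the variables V and \<open>i\<close> is a polynomial equation for
  \<open>x i\<close> over the V-coordinates, so \<open>separable_extension\<close> applies with the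
  polynomial ring as ring of coefficients.\<close>

lemma curve_extend:
  assumes c: "curve K V \<xi>" and i: "i \<notin> V" and \<eta>: "fps_nth \<eta> 0 = x i"
    and Q: "poly (map_poly (ev V) Q) (x i) = 0" "poly (pderiv (map_poly (ev V) Q)) (x i) \<noteq> 0"
      "vanish K (poly (map_poly (ev_fps \<xi>) Q) \<eta>)"
  shows "curve K (insert i V) (\<xi>(i := \<eta>))"
  unfolding curve_def
proof (intro conjI allI impI)
  fix v show "fps_nth ((\<xi>(i := \<eta>)) v) 0 = on_set (insert i V) x v"
    using c \<eta> by (auto simp: curve_def on_set_def)
next
  fix v assume "v \<notin> insert i V"
  then show "(\<xi>(i := \<eta>)) v = 0" using c by (auto simp: curve_def)
next
  fix p assume p: "ev (insert i V) p = 0"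
  have e: "(\<lambda>c. fps_nth (ev_fps \<xi> c) 0) = ev V" using curve_nth_0[OF c] by blast
  have "vanish K (poly (map_poly (ev_fps \<xi>) (as_univariate i p)) \<eta>)"
  proof (rule separable_extension[where Q = Q, OF ev_fps_hom])
    show "poly (map_poly (\<lambda>c. fps_nth (ev_fps \<xi> c) 0) (as_univariate i p)) (fps_nth \<eta> 0) = 0"
      using p unfolding e \<eta> on_set_insert mp_eval_as_univariate[OF alg] .
    show "vanish K (ev_fps \<xi> q)" if "fps_nth (ev_fps \<xi> q) 0 = 0" for q
      using c that curve_nth_0[OF c] by (auto simp: curve_def)
  qed (use Q \<eta> e in auto)
  then show "vanish K (ev_fps (\<xi>(i := \<eta>)) p)"
    unfolding mp_eval_as_univariate[OF alg_fps] .
qed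

lemma curve_extend_ex:
  assumes c: "curve K V \<xi>" and i: "i \<notin> V" and s: "sep_algebraic V i"
  shows "\<exists>\<eta>. curve K (insert i V) (\<xi>(i := \<eta>))"
proof -
  obtain Q where Q: "poly (map_poly (ev V) Q) (x i) = 0" "poly (pderiv (map_poly (ev V) Q)) (x i) \<noteq> 0"
    using s by (auto simp: sep_algebraic_def)
  have e: "map_poly (\<lambda>f. fps_nth f 0) (map_poly (ev_fps \<xi>) Q) = map_poly (ev V) Q"
    unfolding map_poly_map_poly_nth_0[OF ev_fps_hom] using curve_nth_0[OF c] by presburger
  obtain \<eta> where "fps_nth \<eta> 0 = x i" "vanish K (poly (map_poly (ev_fps \<xi>) Q) \<eta>)"
    using hensel[of "map_poly (ev_fps \<xi>) Q" "x i" K] Q unfolding e by blast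
  from curve_extend[OF c i this(1) Q this(2)] show ?thesis by blast
qed

text \<open>Every polynomial over the V-coordinates that vanishes at \<open>x i\<close> then has
  vanishing derivative there, be \<open>x i\<close> transcendental or inseparable. Moving
  \<open>x i\<close> alone with speed 1 therefore violates no relation to first order.\<close>

lemma curve_not_sep_algebraic:
  assumes i: "i \<notin> V" and s: "\<not> sep_algebraic V i"
  shows "curve 2 (insert i V) ((\<lambda>v. fps_const (on_set V x v))(i := fps_const (x i) + fps_X))"
  unfolding curve_def
proof (intro conjI allI impI)
  fix p assume p: "ev (insert i V) p = 0"
  define F where "F = map_poly (ev V) (as_univariate i p)"
  have hc: "comm_ring_hom (fps_const :: 'l \<Rightarrow> _)" by unfold_locales auto
  interpret fps_const: idom_hom "fps_const :: 'l \<Rightarrow> 'l fps" by unfold_locales auto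
  interpret ev: comm_ring_hom "ev V" by (rule ev_hom)
  have F: "poly F (x i) = 0" using p unfolding F_def on_set_insert mp_eval_as_univariate[OF alg] .
  then have dF: "poly (pderiv F) (x i) = 0" using s by (auto simp: sep_algebraic_def F_def)
  have "ev_fps ((\<lambda>v. fps_const (on_set V x v))(i := fps_const (x i) + fps_X)) p =
      poly (map_poly fps_const F) (fps_const (x i) + fps_X)"
    unfolding mp_eval_as_univariate[OF alg_fps] ev_fps_const F_def
    by (simp add: map_poly_map_poly o_def)
  moreover obtain z where "poly (map_poly fps_const F) (fps_const (x i) + fps_X)
     = poly (map_poly fps_const F) (fps_const (x i)) + fps_X * poly (pderiv (map_poly fps_const F)) (fps_const (x i)) + fps_X\<^sup>2 * z"
    using poly_taylor by blast
  ultimately have "ev_fps ((\<lambda>v. fps_const (on_set V x v))(i := fps_const (x i) + fps_X)) p = fps_X\<^sup>2 * z"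
    by (simp add: F dF flip: fps_const.map_poly_pderiv)
  then show "vanish 2 (ev_fps ((\<lambda>v. fps_const (on_set V x v))(i := fps_const (x i) + fps_X)) p)"
    using vanish_X_power_mult by metis
qed (auto simp: on_set_def)

text \<open>If \<open>x i\<close> were not separable over V, the curve moving \<open>x i\<close>
  alone would contradict rigidity. Once it is separable, every derivation on V extends to
  \<open>i\<close>, so rigidity descends to V.\<close>

lemma rigid_insert:
  assumes i: "i \<notin> V" and V: "V\<^sub>0 \<subseteq> V" and r: "rigid V\<^sub>0 (insert i V)"
  shows "sep_algebraic V i" "rigid V\<^sub>0 V"
proof -
  show s: "sep_algebraic V i"
  proof (rule ccontr)
    assume "\<not> sep_algebraic V i"
    from curve_not_sep_algebraic[OF i this]
    have "fps_nth (((\<lambda>v. fps_const (on_set V x v))(i := fps_const (x i) + fps_X)) i) 1 = 0"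
      by (rule r[unfolded rigid_def, rule_format]) (use i V in auto)
    then show False by simp
  qed
  show "rigid V\<^sub>0 V"
    unfolding rigid_def
  proof (intro allI impI)
    fix \<xi> v assume \<xi>: "curve 2 V \<xi>" "\<forall>c\<in>V\<^sub>0. fps_nth (\<xi> c) 1 = 0"
    obtain \<eta> where c: "curve 2 (insert i V) (\<xi>(i := \<eta>))" using curve_extend_ex[OF \<xi>(1) i s] by blast
    have "fps_nth ((\<xi>(i := \<eta>)) v) 1 = 0"
      by (rule r[unfolded rigid_def, rule_format, OF c]) (use \<xi> i V in auto)
    moreover have "\<xi> i = 0" using \<xi>(1) i by (auto simp: curve_def)
    ultimately show "fps_nth (\<xi> v) 1 = 0" by (cases "v = i") auto
  qed
qed

text \<open>Rigidity is known only for the full set of variables, so the columns are removed from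
  the last one down; each removal shows the removed coordinate to be separable over the remaining
  ones.\<close>

lemma rigid_imp_sep_algebraic:
  fixes \<gamma> :: "nat \<Rightarrow> nat"
  assumes r: "rigid V\<^sub>0 (V\<^sub>0 \<union> \<gamma> ` {..<r})" and inj: "inj_on \<gamma> {..<r}" and dis: "\<gamma> ` {..<r} \<inter> V\<^sub>0 = {}"
    and "k < r"
  shows "sep_algebraic (V\<^sub>0 \<union> \<gamma> ` {..<k}) (\<gamma> k)"
proof -
  have ni: "\<gamma> k \<notin> V\<^sub>0 \<union> \<gamma> ` {..<k}" if "k < r" for k
  proof -
    have "\<gamma> k \<noteq> \<gamma> j" if "j < k" for j
      using inj_onD[OF inj, of k j] that \<open>k < r\<close> by auto
    then show ?thesis using dis that by auto
  qed
  have ins: "insert (\<gamma> k) (V\<^sub>0 \<union> \<gamma> ` {..<k}) = V\<^sub>0 \<union> \<gamma> ` {..<Suc k}" for k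
    by (auto simp: lessThan_Suc)
  have "rigid V\<^sub>0 (V\<^sub>0 \<union> \<gamma> ` {..<Suc k})"
    if "k < r" for k
  proof -
    have "Suc k \<le> r" using that by simp
    then show ?thesis
    proof (induction rule: inc_induct)
      case (step j)
      show ?case by (rule rigid_insert(2)[OF ni]) (use step ins in auto)
    qed (fact r)
  qed
  then show ?thesis
    using rigid_insert(1)[OF ni[OF \<open>k < r\<close>], of V\<^sub>0] \<open>k < r\<close> ins by auto
qed

lemma curve_extend_all:
  fixes \<gamma> :: "nat \<Rightarrow> nat"
  assumes s: "\<And>k. k < r \<Longrightarrow> sep_algebraic (V\<^sub>0 \<union> \<gamma> ` {..<k}) (\<gamma> k)"
    and inj: "inj_on \<gamma> {..<r}" and dis: "\<gamma> ` {..<r} \<inter> V\<^sub>0 = {}"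
    and \<xi>\<^sub>0: "curve K V\<^sub>0 \<xi>\<^sub>0"
  shows "\<exists>\<xi>. curve K (V\<^sub>0 \<union> \<gamma> ` {..<r}) \<xi> \<and> (\<forall>v\<in>V\<^sub>0. \<xi> v = \<xi>\<^sub>0 v)"
  using s inj dis
proof (induction r)
  case 0
  then show ?case using \<xi>\<^sub>0 by auto
next
  case (Suc r)
  then obtain \<xi> where \<xi>: "curve K (V\<^sub>0 \<union> \<gamma> ` {..<r}) \<xi>" "\<forall>v\<in>V\<^sub>0. \<xi> v = \<xi>\<^sub>0 v"
    by (force simp: lessThan_Suc)
  have ni: "\<gamma> r \<notin> V\<^sub>0 \<union> \<gamma> ` {..<r}" using Suc.prems(2,3) by (auto simp: lessThan_Suc)
  obtain \<eta> where "curve K (insert (\<gamma> r) (V\<^sub>0 \<union> \<gamma> ` {..<r})) (\<xi>(\<gamma> r := \<eta>))"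
    using curve_extend_ex[OF \<xi>(1) ni] Suc.prems(1)[of r] by auto
  moreover have "insert (\<gamma> r) (V\<^sub>0 \<union> \<gamma> ` {..<r}) = V\<^sub>0 \<union> \<gamma> ` {..<Suc r}" by (auto simp: lessThan_Suc)
  moreover have "\<forall>v\<in>V\<^sub>0. (\<xi>(\<gamma> r := \<eta>)) v = \<xi>\<^sub>0 v" using \<xi>(2) ni by auto
  ultimately show ?case by metis
qed

text \<open>The coordinates are eliminated in the reverse of the order in which curves are extended.
  J is a mere subset of the field closed under multiplication by the ring, so that it can stand for
  the image of an ideal.\<close>

lemma descent_all:
  fixes \<gamma> :: "nat \<Rightarrow> nat"
  assumes s: "\<And>k. k < r \<Longrightarrow> sep_algebraic (V\<^sub>0 \<union> \<gamma> ` {..<k}) (\<gamma> k)"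
    and J: "\<And>p a. a \<in> J \<Longrightarrow> ev (V\<^sub>0 \<union> \<gamma> ` {..<r}) p * a \<in> J"
    and inj: "inj_on \<gamma> {..<r}" and dis: "\<gamma> ` {..<r} \<inter> V\<^sub>0 = {}"
    and p: "ev (V\<^sub>0 \<union> \<gamma> ` {..<r}) p \<in> J" "ev (V\<^sub>0 \<union> \<gamma> ` {..<r}) p \<noteq> 0"
  shows "\<exists>p. ev V\<^sub>0 p \<in> J \<and> ev V\<^sub>0 p \<noteq> 0"
  using assms
proof (induction r arbitrary: p)
  case 0
  then show ?case by auto
next
  case (Suc r)
  let ?V = "V\<^sub>0 \<union> \<gamma> ` {..<r}" and ?i = "\<gamma> r"
  have V: "V\<^sub>0 \<union> \<gamma> ` {..<Suc r} = insert ?i ?V" by (auto simp: lessThan_Suc)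
  have ni: "?i \<notin> ?V" using Suc.prems(3,4) by (auto simp: lessThan_Suc)
  obtain Q where Q: "poly (map_poly (ev ?V) Q) (x ?i) = 0" "poly (pderiv (map_poly (ev ?V) Q)) (x ?i) \<noteq> 0"
    using Suc.prems(1)[of r] by (auto simp: sep_algebraic_def)
  interpret comm_ring_hom "ev ?V" by (rule ev_hom)
  interpret m: map_poly_comm_ring_hom "ev ?V" ..
  \<comment> \<open>\<open>ev ?V\<close> sets the variable \<open>?i\<close> to 0, the larger
    evaluation does not; so the coefficients must first be restricted to the variables in
    \<open>?V\<close>.\<close>
  have emb: "\<exists>p. ev (insert ?i ?V) p = poly (map_poly (ev ?V) P) (x ?i)" for P
  proof (induction P)
    case 0
    show ?case by (rule exI[of _ 0]) (simp add: mp_eval_0[OF alg])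
  next
    case (pCons a P)
    then obtain p where p: "ev (insert ?i ?V) p = poly (map_poly (ev ?V) P) (x ?i)" by blast
    let ?a = "restrict_vars ?V a"
    have "ev (insert ?i ?V) ?a = ev ?V ?a"
      by (rule mp_eval_in_vars_cong[OF in_vars_restrict_vars]) (simp add: on_set_def)
    also have "\<dots> = ev ?V a" by (rule mp_eval_restrict_vars[OF alg]) (simp add: on_set_def)
    finally have "ev (insert ?i ?V) ?a = ev ?V a" .
    moreover have "ev (insert ?i ?V) (Poly_Mapping.single (Poly_Mapping.single ?i 1) 1) = x ?i"
      by (simp add: mp_eval_single[OF alg] k_algebra_map_simps[OF alg] mon_eval_def on_set_def)
    ultimately have "ev (insert ?i ?V) (?a + Poly_Mapping.single (Poly_Mapping.single ?i 1) 1 * p) =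
        poly (map_poly (ev ?V) (pCons a P)) (x ?i)"
      by (simp add: mp_eval_add[OF alg] mp_eval_mult[OF alg] p map_poly_pCons_hom)
    then show ?case by blast
  qed
  have "\<exists>c. ev ?V c \<in> J \<and> ev ?V c \<noteq> 0"
  proof (rule algebraic_descent[OF ev_hom])
    show "map_poly (ev ?V) Q \<noteq> 0" using Q(2) by auto
    show "poly (map_poly (ev ?V) Q) (x ?i) = 0" by fact
    show "poly (map_poly (ev ?V) P) (x ?i) * a \<in> J" if "a \<in> J" for P a
      using emb[of P] Suc.prems(2)[OF that] unfolding V by metis
    show "poly (map_poly (ev ?V) (as_univariate ?i p)) (x ?i) \<in> J"
      "poly (map_poly (ev ?V) (as_univariate ?i p)) (x ?i) \<noteq> 0"
      using Suc.prems(5,6) unfolding V on_set_insert[of ?i] mp_eval_as_univariate[OF alg] .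
  qed
  then obtain c where c: "ev ?V c \<in> J" "ev ?V c \<noteq> 0" by blast
  show ?case
  proof (rule Suc.IH[of c])
    show "ev ?V p * a \<in> J" if "a \<in> J" for p a
    proof -
      obtain q where "ev (insert ?i ?V) q = ev ?V p"
        using emb[of "[:p:]"] by (auto simp: map_poly_pCons_hom)
      then show ?thesis using Suc.prems(2)[OF that, of q] unfolding V by simp
    qed
  qed (use Suc.prems(1,3,4) c in \<open>auto simp: lessThan_Suc\<close>)
qed

end

section \<open>Minors and algebraic independence\<close>

lemma det_sq_eq_det: "det_sq r N = det (mat r r (\<lambda>(a, b). N a b))"
  unfolding det_sq_def det_def'[OF mat_carrier]
  by (auto simp: atLeast0LessThan sign_def intro!: sum.cong prod.cong)

text \<open>C is the adjugate. It is formed without division, so its entries lie in the ring of the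
  matrix entries; this later keeps them in A.\<close>

lemma det_sq_left_inverse:
  obtains C where "\<And>b b'. b < r \<Longrightarrow> b' < r \<Longrightarrow>
    (\<Sum>a<r. C b a * N a b') = (if b = b' then det_sq r (N :: nat \<Rightarrow> nat \<Rightarrow> 'a::comm_ring_1) else 0)"
proof
  fix b b' assume b: "b < r" "b' < r"
  let ?N = "mat r r (\<lambda>(a, b). N a b)"
  have A: "?N \<in> carrier_mat r r" by simp
  have "(adj_mat ?N * ?N) $$ (b, b') = (det_sq r N \<cdot>\<^sub>m 1\<^sub>m r) $$ (b, b')"
    using adj_mat(3)[OF A] by (simp add: det_sq_eq_det)
  then show "(\<Sum>a<r. adj_mat ?N $$ (b, a) * N a b') = (if b = b' then det_sq r N else 0)"
    using b adj_mat(1)[OF A] by (simp add: scalar_prod_def atLeast0LessThan)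
qed

lemma det_sq_injective:
  fixes N :: "nat \<Rightarrow> nat \<Rightarrow> 'a::idom"
  assumes "det_sq r N \<noteq> 0" and "\<And>a. a < r \<Longrightarrow> (\<Sum>b<r. N a b * u b) = 0" and "b < r"
  shows "u b = 0"
proof -
  obtain C where C: "\<And>b b'. b < r \<Longrightarrow> b' < r \<Longrightarrow>
    (\<Sum>a<r. C b a * N a b') = (if b = b' then det_sq r N else 0)" by (rule det_sq_left_inverse[of r N]) blast
  have "0 = (\<Sum>a<r. C b a * (\<Sum>b'<r. N a b' * u b'))" using assms(2) by simp
  also have "\<dots> = (\<Sum>b'<r. (\<Sum>a<r. C b a * N a b') * u b')"
    unfolding sum_distrib_left sum_distrib_right by (subst sum.swap) (simp add: mult.assoc)
  also have "\<dots> = (\<Sum>b'<r. if b = b' then det_sq r N * u b' else 0)"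
    using C[OF \<open>b < r\<close>] by (intro sum.cong) auto
  also have "\<dots> = det_sq r N * u b" using \<open>b < r\<close> by simp
  finally show ?thesis using assms(1) by simp
qed

lemma det_sq_0_kernel:
  fixes N :: "nat \<Rightarrow> nat \<Rightarrow> 'a::idom"
  assumes "det_sq r N = 0"
  obtains u b where "b < r" "u b \<noteq> 0" "\<And>a. a < r \<Longrightarrow> (\<Sum>b<r. N a b * u b) = 0"
proof -
  let ?N = "mat r r (\<lambda>(a, b). N a b)"
  obtain v where v: "v \<in> carrier_vec r" "v \<noteq> 0\<^sub>v r" "?N *\<^sub>v v = 0\<^sub>v r"
    using det_0_iff_vec_prod_zero[of ?N r] assms by (auto simp: det_sq_eq_det)
  obtain b where b: "b < r" "v $ b \<noteq> 0" using v(1,2) by (auto simp: vec_eq_iff)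
  have "(\<Sum>b<r. N a b * v $ b) = 0" if "a < r" for a
    using arg_cong[OF v(3), of "\<lambda>w. w $ a"] that v(1) by (simp add: scalar_prod_def atLeast0LessThan)
  with b show thesis by (rule that)
qed

text \<open>The vector extends the solution of the r \<times> r system to all rows, as the bordered minors vanish.\<close>
lemma minor_kernel:
  fixes M :: "nat \<Rightarrow> nat \<Rightarrow> 'a::idom"
  assumes \<rho>: "inj_on \<rho> {..<r}" "\<rho> ` {..<r} \<subseteq> {..<m}" and \<gamma>: "inj_on \<gamma> {..<r}" "\<gamma> ` {..<r} \<subseteq> {..<n}"
    and d: "det_sq r (\<lambda>a b. M (\<rho> a) (\<gamma> b)) \<noteq> 0"
    and rank: "\<And>d. d \<in> minors m n M (Suc r) \<Longrightarrow> d = 0"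
    and c: "c < n" "c \<notin> \<gamma> ` {..<r}"
  shows "\<exists>v. v c \<noteq> 0 \<and> (\<forall>j. j \<noteq> c \<longrightarrow> j \<notin> \<gamma> ` {..<r} \<longrightarrow> v j = 0) \<and> (\<forall>i<m. (\<Sum>j<n. M i j * v j) = 0)"
proof -
  let ?\<gamma> = "\<gamma>(r := c)"
  have row: "(\<Sum>b<Suc r. M i (?\<gamma> b) * w b) = (\<Sum>b<r. M i (\<gamma> b) * w b) + M i c * w r" for i w
    by (simp add: lessThan_Suc add.commute)
  have ex: "\<exists>w. w r \<noteq> 0 \<and> (\<forall>a<r. (\<Sum>b<r. M (\<rho> a) (\<gamma> b) * w b) + M (\<rho> a) c * w r = 0) \<and>
      (\<Sum>b<r. M i (\<gamma> b) * w b) + M i c * w r = 0" if i: "i < m" for i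
  proof -
    let ?\<rho> = "\<rho>(r := i)"
    \<comment> \<open>Bordering the minor by row i and column c gives determinant 0, by the rank or
      because row i is repeated. The kernel vector has a nonzero last entry, since the r \<times> r
      block is injective.\<close>
    have "det_sq (Suc r) (\<lambda>a b. M (?\<rho> a) (?\<gamma> b)) = 0"
    proof (cases "i \<in> \<rho> ` {..<r}")
      case True
      then obtain a where a: "a < r" "i = \<rho> a" by auto
      show ?thesis unfolding det_sq_eq_det
      proof (rule det_identical_rows[of _ "Suc r" a r])
        show "row (mat (Suc r) (Suc r) (\<lambda>(a, b). M (?\<rho> a) (?\<gamma> b))) a =
          row (mat (Suc r) (Suc r) (\<lambda>(a, b). M (?\<rho> a) (?\<gamma> b))) r"
          using a by (intro eq_vecI) auto
      qed (use a in auto)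
    next
      case False
      have "inj_on ?\<rho> {..<Suc r}" "inj_on ?\<gamma> {..<Suc r}" "?\<rho> ` {..<Suc r} \<subseteq> {..<m}" "?\<gamma> ` {..<Suc r} \<subseteq> {..<n}"
        using \<rho> \<gamma> c i False by (auto simp: lessThan_Suc inj_on_def)
      then show ?thesis by (intro rank) (unfold minors_def, blast)
    qed
    then obtain w b where w: "b < Suc r" "w b \<noteq> 0"
      "\<And>a. a < Suc r \<Longrightarrow> (\<Sum>b<Suc r. M (?\<rho> a) (?\<gamma> b) * w b) = 0"
      by (rule det_sq_0_kernel) blast
    have 1: "(\<Sum>b<r. M (\<rho> a) (\<gamma> b) * w b) + M (\<rho> a) c * w r = 0" if "a < r" for a
      using w(3)[of a] that unfolding row by simp
    have 2: "(\<Sum>b<r. M i (\<gamma> b) * w b) + M i c * w r = 0"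
      using w(3)[of r] unfolding row by simp
    have "w r \<noteq> 0"
    proof
      assume "w r = 0"
      then have "w b = 0" if "b < r" for b
        using det_sq_injective[OF d _ that, of w] 1 by simp
      with \<open>w r = 0\<close> w(1,2) show False by (auto simp: less_Suc_eq)
    qed
    with 1 2 show ?thesis by blast
  qed
  have "\<exists>w. w r \<noteq> 0 \<and> (\<forall>i<m. (\<Sum>b<r. M i (\<gamma> b) * w b) + M i c * w r = 0)"
  proof (cases "m = 0")
    case False
    then obtain w where w: "w r \<noteq> 0" "\<forall>a<r. (\<Sum>b<r. M (\<rho> a) (\<gamma> b) * w b) + M (\<rho> a) c * w r = 0"
      using ex[of 0] by auto
    have "(\<Sum>b<r. M i (\<gamma> b) * w b) + M i c * w r = 0" if i: "i < m" for i
    proof -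
      obtain w' where w': "w' r \<noteq> 0" "\<forall>a<r. (\<Sum>b<r. M (\<rho> a) (\<gamma> b) * w' b) + M (\<rho> a) c * w' r = 0"
        "(\<Sum>b<r. M i (\<gamma> b) * w' b) + M i c * w' r = 0" using ex[OF i] by blast
      \<comment> \<open>The kernel vector still depends on the row i. Two such vectors are
        proportional, because their combination with last entry 0 solves the homogeneous r \<times>
        r system; so one vector serves all rows.\<close>
      have "w' r * w b - w r * w' b = 0" if "b < r" for b
      proof (rule det_sq_injective[OF d _ that, where u = "\<lambda>b. w' r * w b - w r * w' b"])
        fix a assume "a < r"
        have "(\<Sum>b<r. M (\<rho> a) (\<gamma> b) * (w' r * w b - w r * w' b)) =
          w' r * ((\<Sum>b<r. M (\<rho> a) (\<gamma> b) * w b) + M (\<rho> a) c * w r) -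
          w r * ((\<Sum>b<r. M (\<rho> a) (\<gamma> b) * w' b) + M (\<rho> a) c * w' r)"
          by (simp add: algebra_simps sum_subtractf sum_distrib_left)
        then show "(\<Sum>b<r. M (\<rho> a) (\<gamma> b) * (w' r * w b - w r * w' b)) = 0"
          using w w' \<open>a < r\<close> by simp
      qed
      then have e: "w' r * w b = w r * w' b" if "b < r" for b using that by simp
      have "w' r * ((\<Sum>b<r. M i (\<gamma> b) * w b) + M i c * w r) =
          (\<Sum>b<r. M i (\<gamma> b) * (w' r * w b)) + M i c * (w r * w' r)"
        by (simp add: algebra_simps sum_distrib_left)
      also have "\<dots> = w r * ((\<Sum>b<r. M i (\<gamma> b) * w' b) + M i c * w' r)"
        by (simp add: e algebra_simps sum_distrib_left)
      finally show ?thesis using w' by simp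
    qed
    with w show ?thesis by blast
  qed (auto intro: exI[of _ "\<lambda>_. 1"])
  then obtain w where w: "w r \<noteq> 0" "\<And>i. i < m \<Longrightarrow> (\<Sum>b<r. M i (\<gamma> b) * w b) + M i c * w r = 0" by blast
  define v where "v = (\<lambda>j. if j = c then w r else if j \<in> \<gamma> ` {..<r} then w (the_inv_into {..<r} \<gamma> j) else 0)"
  have v\<gamma>: "v (\<gamma> b) = w b" if "b < r" for b
    using that c by (auto simp: v_def the_inv_into_f_f[OF \<gamma>(1)])
  have "(\<Sum>j<n. M i j * v j) = 0" if "i < m" for i
  proof -
    have "(\<Sum>j<n. M i j * v j) = (\<Sum>j\<in>insert c (\<gamma> ` {..<r}). M i j * v j)"
      by (rule sum.mono_neutral_right) (use c \<gamma> in \<open>auto simp: v_def\<close>)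
    also have "\<dots> = M i c * v c + (\<Sum>b<r. M i (\<gamma> b) * v (\<gamma> b))"
      using c by (simp add: sum.reindex[OF \<gamma>(1)])
    finally show ?thesis using w(2)[OF that] v\<gamma> by (simp add: v_def add.commute)
  qed
  moreover have "v c \<noteq> 0" using w by (simp add: v_def)
  ultimately show ?thesis by (intro exI[of _ v]) (auto simp: v_def)
qed

section \<open>Algebraic independence over a perfect field\<close>

definition mpderiv :: "nat \<Rightarrow> 'k::field mpoly \<Rightarrow> 'k mpoly" where
  "mpderiv c p = (\<Sum>u\<in>Poly_Mapping.keys p. Poly_Mapping.single (u - Poly_Mapping.single c 1)
     (Poly_Mapping.lookup p u * of_nat (Poly_Mapping.lookup u c)))"

text \<open>Subtraction of exponents is truncated: a monomial without the variable \<open>c\<close>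
  is mapped to itself, but with coefficient 0, so it does not disturb the formula.\<close>

lemma lookup_mpderiv:
  "Poly_Mapping.lookup (mpderiv c p) w =
     Poly_Mapping.lookup p (w + Poly_Mapping.single c 1) * of_nat (Suc (Poly_Mapping.lookup w c))"
proof -
  let ?w = "w + Poly_Mapping.single c 1"
  have eq: "u = ?w" if "u - Poly_Mapping.single c 1 = w" "Poly_Mapping.lookup u c \<noteq> 0" for u
  proof (rule poly_mapping_eqI)
    fix v
    have "Poly_Mapping.lookup w v = Poly_Mapping.lookup u v - Poly_Mapping.lookup (Poly_Mapping.single c 1) v"
      unfolding that(1)[symmetric] by (rule lookup_minus)
    then show "Poly_Mapping.lookup u v = Poly_Mapping.lookup ?w v"
      using that(2) by (auto simp: lookup_add lookup_single when_def)
  qed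
  have "Poly_Mapping.lookup (mpderiv c p) w = (\<Sum>u\<in>Poly_Mapping.keys p.
     (Poly_Mapping.lookup p u * of_nat (Poly_Mapping.lookup u c) when u - Poly_Mapping.single c 1 = w))"
    by (simp add: mpderiv_def lookup_sum lookup_single)
  also have "\<dots> = (\<Sum>u\<in>Poly_Mapping.keys p. if u = ?w then Poly_Mapping.lookup p u * of_nat (Poly_Mapping.lookup u c) else 0)"
    by (rule sum.cong) (use eq in \<open>force simp: when_def\<close>)+
  also have "\<dots> = Poly_Mapping.lookup p ?w * of_nat (Poly_Mapping.lookup ?w c)"
    by (simp add: in_keys_iff)
  finally show ?thesis by (simp add: lookup_add)
qed

lemma mp_eval_mpderiv:
  assumes \<psi>: "k_algebra_map \<psi>"
  shows "mp_eval \<psi> y (mpderiv c p) = mp_eval_pderiv \<psi> y c p"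
proof -
  have "of_nat (Poly_Mapping.lookup u c) * mon_eval y (u - Poly_Mapping.single c 1) =
     of_nat (Poly_Mapping.lookup u c) * y c ^ (Poly_Mapping.lookup u c - 1) *
       (\<Prod>v\<in>Poly_Mapping.keys u - {c}. y v ^ Poly_Mapping.lookup u v)" for u
  proof (cases "Poly_Mapping.lookup u c = 0")
    case False
    let ?w = "u - Poly_Mapping.single c 1"
    have l: "Poly_Mapping.lookup ?w v = (if v = c then Poly_Mapping.lookup u c - 1 else Poly_Mapping.lookup u v)" for v
      by (auto simp: lookup_minus lookup_single when_def)
    have "mon_eval y ?w = (\<Prod>v\<in>Poly_Mapping.keys u. y v ^ Poly_Mapping.lookup ?w v)"
    proof (rule mon_eval_superset)
      show "Poly_Mapping.keys ?w \<subseteq> Poly_Mapping.keys u"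
        unfolding subset_iff in_keys_iff l using False by auto
    qed simp
    also have "\<dots> = y c ^ Poly_Mapping.lookup ?w c * (\<Prod>v\<in>Poly_Mapping.keys u - {c}. y v ^ Poly_Mapping.lookup ?w v)"
      using False by (intro prod.remove) (auto simp: in_keys_iff)
    also have "Poly_Mapping.lookup ?w c = Poly_Mapping.lookup u c - 1" using l[of c] by simp
    also have "(\<Prod>v\<in>Poly_Mapping.keys u - {c}. y v ^ Poly_Mapping.lookup ?w v) =
        (\<Prod>v\<in>Poly_Mapping.keys u - {c}. y v ^ Poly_Mapping.lookup u v)"
      by (rule prod.cong) (auto simp: l simp del: One_nat_def)
    finally show ?thesis by (simp add: mult.assoc)
  qed simp
  then show ?thesis
    by (simp add: mpderiv_def mp_eval_sum[OF \<psi>] mp_eval_single[OF \<psi>] k_algebra_map_simps[OF \<psi>]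
        k_algebra_map_of_nat[OF \<psi>] mp_eval_pderiv_def mult.assoc)
qed

lemma k_algebra_map_CHAR:
  fixes \<psi> :: "'k::field \<Rightarrow> 'a::idom"
  assumes \<psi>: "k_algebra_map \<psi>" shows "CHAR('a) = CHAR('k)"
proof (rule CHAR_eqI)
  show "of_nat CHAR('k) = (0 :: 'a)"
    using k_algebra_map_of_nat[OF \<psi>, of "CHAR('k)"] k_algebra_map_simps(1)[OF \<psi>] by simp
  show "CHAR('k) dvd n" if "of_nat n = (0 :: 'a)" for n
    using that k_algebra_map_of_nat[OF \<psi>, of n] k_algebra_map_eq_0_iff[OF \<psi>, of "of_nat n"]
    by (simp add: of_nat_eq_0_iff_char_dvd)
qed

text \<open>A relation of minimal degree has vanishing partial derivatives, hence is a constant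
  or, by perfectness, the p-th power of a relation of smaller degree.\<close>
lemma algebraically_independent:
  fixes \<psi> :: "'k::field \<Rightarrow> 'a::idom"
  assumes \<psi>: "k_algebra_map \<psi>" and perfect: "perfect_field TYPE('k)" and V: "finite V"
    and deriv: "\<And>c p. c \<in> V \<Longrightarrow> in_vars V p \<Longrightarrow> mp_eval \<psi> y p = 0 \<Longrightarrow> mp_eval_pderiv \<psi> y c p = 0"
    and p: "in_vars V p" "mp_eval \<psi> y p = 0"
  shows "p = 0"
proof -
  define deg where "deg = (\<lambda>u::nat \<Rightarrow>\<^sub>0 nat. \<Sum>v\<in>V. Poly_Mapping.lookup u v)"
  have "\<forall>p. in_vars V p \<longrightarrow> mp_eval \<psi> y p = 0 \<longrightarrow> (\<forall>u\<in>Poly_Mapping.keys p. deg u \<le> d) \<longrightarrow> p = 0" for d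
  proof (induction d rule: less_induct)
    case (less d)
    show ?case
    proof (intro allI impI)
      fix p :: "'k mpoly"
      assume p: "in_vars V p" "mp_eval \<psi> y p = 0" and d: "\<forall>u\<in>Poly_Mapping.keys p. deg u \<le> d"
      \<comment> \<open>The partial derivatives are relations of smaller degree, hence 0 by
        induction. So each nonzero coefficient times its exponent in \<open>c\<close> is 0 in the
        field.\<close>
      have z: "of_nat (Poly_Mapping.lookup u c) = (0 :: 'k)" if u: "u \<in> Poly_Mapping.keys p" and c: "c \<in> V" for u c
      proof -
        have key: "w + Poly_Mapping.single c 1 \<in> Poly_Mapping.keys p"
          if "w \<in> Poly_Mapping.keys (mpderiv c p)" for w
          using that by (auto simp: in_keys_iff lookup_mpderiv)
        have degS: "deg (w + Poly_Mapping.single c 1) = Suc (deg w)" for w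
        proof -
          have "deg (w + Poly_Mapping.single c 1) = deg w + (\<Sum>v\<in>V. if v = c then 1 else 0)"
            unfolding deg_def sum.distrib[symmetric]
            by (intro sum.cong) (auto simp: lookup_add lookup_single when_def)
          then show ?thesis using V c by simp
        qed
        have "mpderiv c p = 0"
        proof (cases "d = 0")
          case True
          have "Poly_Mapping.keys (mpderiv c p) = {}" using key d degS True by fastforce
          then show ?thesis by simp
        next
          case False
          have "in_vars V (mpderiv c p)"
            unfolding in_vars_def
          proof
            fix w assume "w \<in> Poly_Mapping.keys (mpderiv c p)"
            from key[OF this] p(1) have k: "Poly_Mapping.keys (w + Poly_Mapping.single c 1) \<subseteq> V"
              by (auto simp: in_vars_def)
            have "Poly_Mapping.keys w \<subseteq> Poly_Mapping.keys (w + Poly_Mapping.single c 1)"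
              by (auto simp: in_keys_iff lookup_add)
            with k show "Poly_Mapping.keys w \<subseteq> V" by blast
          qed
          moreover have "mp_eval \<psi> y (mpderiv c p) = 0"
            using deriv[OF c p] mp_eval_mpderiv[OF \<psi>] by metis
          moreover have "\<forall>w\<in>Poly_Mapping.keys (mpderiv c p). deg w \<le> d - 1"
            using key d degS by fastforce
          ultimately show ?thesis using less[of "d - 1"] False by auto
        qed
        then have "Poly_Mapping.lookup (mpderiv c p) (u - Poly_Mapping.single c 1) = 0" by simp
        moreover have "u - Poly_Mapping.single c 1 + Poly_Mapping.single c 1 = u" if "Poly_Mapping.lookup u c \<noteq> 0"
          by (rule poly_mapping_eqI) (use that in \<open>auto simp: lookup_add lookup_minus lookup_single when_def\<close>)
        ultimately show ?thesis using u
          by (cases "Poly_Mapping.lookup u c = 0")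
             (auto simp: lookup_mpderiv lookup_minus in_keys_iff simp del: of_nat_Suc)
      qed
      have const: "p = 0" if "\<And>u. u \<in> Poly_Mapping.keys p \<Longrightarrow> u = 0"
      proof -
        have "Poly_Mapping.keys p \<subseteq> {0}" using that by blast
        then have "mp_eval \<psi> y p = \<psi> (Poly_Mapping.lookup p 0)"
          by (subst mp_eval_superset[OF \<psi>, of "{0}"]) auto
        then have "Poly_Mapping.lookup p 0 = 0" using p(2) k_algebra_map_eq_0_iff[OF \<psi>] by simp
        then show ?thesis using \<open>Poly_Mapping.keys p \<subseteq> {0}\<close> by (metis in_keys_iff keys_eq_empty subset_singletonD singletonI)
      qed
      have zero: "u = 0" if "u \<in> Poly_Mapping.keys p" "\<And>c. c \<in> V \<Longrightarrow> Poly_Mapping.lookup u c = 0" for u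
      proof (rule poly_mapping_eqI)
        fix v
        have "v \<notin> Poly_Mapping.keys u" if "v \<notin> V" using that \<open>u \<in> _\<close> p(1) by (auto simp: in_vars_def)
        then show "Poly_Mapping.lookup u v = Poly_Mapping.lookup 0 v"
          using that(2)[of v] by (cases "v \<in> V") (simp_all add: in_keys_iff)
      qed
      let ?q = "CHAR('k)"
      show "p = 0"
      proof (cases "?q = 0 \<or> d = 0")
        case True
        show ?thesis
        proof (rule const, rule zero)
          fix u c assume u: "u \<in> Poly_Mapping.keys p" and c: "c \<in> V"
          from True show "Poly_Mapping.lookup u c = 0"
          proof
            assume "?q = 0" then show ?thesis using z[OF u c] by (simp add: of_nat_eq_0_iff_char_dvd)
          next
            assume "d = 0" then show ?thesis using d u c V by (auto simp: deg_def)
          qed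
        qed
      next
        case False
        then have q: "prime ?q" by (intro prime_CHAR_semidom) simp
        define root where "root = (\<lambda>a::'k. SOME b. b ^ ?q = a)"
        have root: "root a ^ ?q = a" for a
        proof -
          have "\<exists>b. b ^ ?q = a" using perfect False unfolding perfect_field_def by blast
          then show ?thesis unfolding root_def by (rule someI_ex)
        qed
        define quot where "quot = (\<lambda>u::nat \<Rightarrow>\<^sub>0 nat. Poly_Mapping.map (\<lambda>e. e div ?q) u)"
        have lq: "Poly_Mapping.lookup (quot u) v = Poly_Mapping.lookup u v div ?q" for u v
          by (simp add: quot_def Poly_Mapping.map.rep_eq when_def)
        have keysq: "Poly_Mapping.keys (quot u) \<subseteq> Poly_Mapping.keys u" for u
        proof
          fix v assume "v \<in> Poly_Mapping.keys (quot u)"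
          then have "Poly_Mapping.lookup u v div ?q \<noteq> 0" by (simp only: in_keys_iff lq not_False_eq_True)
          then have "Poly_Mapping.lookup u v \<noteq> 0" by (metis div_0)
          then show "v \<in> Poly_Mapping.keys u" by (simp add: in_keys_iff)
        qed
        have dv: "Poly_Mapping.lookup u v = ?q * Poly_Mapping.lookup (quot u) v"
          if "u \<in> Poly_Mapping.keys p" for u v
        proof -
          have "?q dvd Poly_Mapping.lookup u v"
          proof (cases "v \<in> V")
            case True
            then show ?thesis using z[OF that] by (simp add: of_nat_eq_0_iff_char_dvd)
          next
            case False
            then have "v \<notin> Poly_Mapping.keys u" using that p(1) by (auto simp: in_vars_def)
            then have "Poly_Mapping.lookup u v = 0" by (simp add: in_keys_iff)
            then show ?thesis by simp
          qed
          then show ?thesis by (simp add: lq)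
        qed
        have inj: "u = u'" if "u \<in> Poly_Mapping.keys p" "u' \<in> Poly_Mapping.keys p" "quot u = quot u'" for u u'
        proof (rule poly_mapping_eqI)
          fix v show "Poly_Mapping.lookup u v = Poly_Mapping.lookup u' v"
            using dv[OF that(1), of v] dv[OF that(2), of v] that(3) by simp
        qed
        \<comment> \<open>A q-th root of p: exponents are divided by q, coefficients replaced by
          their q-th roots. By the Frobenius the value of p is the q-th power of the value of h, so
          h is again a relation.\<close>
        define h where "h = (\<Sum>u\<in>Poly_Mapping.keys p. Poly_Mapping.single (quot u) (root (Poly_Mapping.lookup p u)))"
        have keysh: "Poly_Mapping.keys h \<subseteq> quot ` Poly_Mapping.keys p"
          unfolding h_def by (auto dest!: subsetD[OF keys_sum] split: if_splits)
        have monq: "mon_eval y (quot u) ^ ?q = mon_eval y u" if u: "u \<in> Poly_Mapping.keys p" for u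
        proof -
          have "mon_eval y (quot u) = (\<Prod>v\<in>Poly_Mapping.keys u. y v ^ Poly_Mapping.lookup (quot u) v)"
            by (rule mon_eval_superset) (simp_all add: keysq)
          then have "mon_eval y (quot u) ^ ?q = (\<Prod>v\<in>Poly_Mapping.keys u. (y v ^ Poly_Mapping.lookup (quot u) v) ^ ?q)"
            by (simp add: prod_power_distrib)
          also have "\<dots> = mon_eval y u"
            unfolding mon_eval_def using dv[OF u] by (intro prod.cong) (auto simp: mult.commute simp flip: power_mult)
          finally show ?thesis .
        qed
        have "mp_eval \<psi> y h ^ ?q = mp_eval \<psi> y p"
        proof -
          have "mp_eval \<psi> y h ^ ?q = (\<Sum>u\<in>Poly_Mapping.keys p. \<psi> (root (Poly_Mapping.lookup p u)) * mon_eval y (quot u)) ^ CHAR('a)"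
            by (simp add: h_def mp_eval_sum[OF \<psi>] mp_eval_single[OF \<psi>] k_algebra_map_CHAR[OF \<psi>])
          also have "\<dots> = (\<Sum>u\<in>Poly_Mapping.keys p. (\<psi> (root (Poly_Mapping.lookup p u)) * mon_eval y (quot u)) ^ CHAR('a))"
            by (rule freshmans_dream_sum) (use q k_algebra_map_CHAR[OF \<psi>] in auto)
          also have "\<dots> = mp_eval \<psi> y p"
            unfolding mp_eval_alt k_algebra_map_CHAR[OF \<psi>]
            by (intro sum.cong refl) (simp add: power_mult_distrib monq root flip: k_algebra_map_pow[OF \<psi>])
          finally show ?thesis .
        qed
        then have "mp_eval \<psi> y h = 0" using p(2) by (metis power_not_zero)
        moreover have "in_vars V h"
          unfolding in_vars_def
        proof
          fix w assume "w \<in> Poly_Mapping.keys h"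
          then obtain u where u: "u \<in> Poly_Mapping.keys p" "w = quot u" using keysh by auto
          then have "Poly_Mapping.keys w \<subseteq> Poly_Mapping.keys u" using keysq by simp
          with u p(1) show "Poly_Mapping.keys w \<subseteq> V" by (auto simp: in_vars_def)
        qed
        moreover have "\<forall>w\<in>Poly_Mapping.keys h. deg w \<le> d div ?q"
        proof
          fix w assume "w \<in> Poly_Mapping.keys h"
          then obtain u where u: "u \<in> Poly_Mapping.keys p" "w = quot u" using keysh by auto
          have "deg u = ?q * deg w"
            unfolding deg_def sum_distrib_left u(2) by (intro sum.cong refl dv u)
          then show "deg w \<le> d div ?q" using d u False by (metis div_le_mono nonzero_mult_div_cancel_left)
        qed
        moreover have "d div ?q < d" using False prime_gt_1_nat[OF q] by simp
        ultimately have h0: "h = 0" using less by blast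
        \<comment> \<open>All exponents in p are multiples of q, so dividing them by q is injective
          and no two terms of h are merged.\<close>
        have "Poly_Mapping.lookup p u = 0" if u: "u \<in> Poly_Mapping.keys p" for u
        proof -
          have "Poly_Mapping.lookup h (quot u) =
             (\<Sum>u'\<in>Poly_Mapping.keys p. root (Poly_Mapping.lookup p u') when quot u' = quot u)"
            by (simp add: h_def lookup_sum lookup_single)
          also have "\<dots> = (\<Sum>u'\<in>Poly_Mapping.keys p. if u' = u then root (Poly_Mapping.lookup p u') else 0)"
            by (rule sum.cong) (use inj u in \<open>auto simp: when_def\<close>)
          also have "\<dots> = root (Poly_Mapping.lookup p u)" using u by simp
          finally have "root (Poly_Mapping.lookup p u) = 0" using h0 by simp
          then show ?thesis using root[of "Poly_Mapping.lookup p u"] False by (metis power_0_left)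
        qed
        then show ?thesis by (intro poly_mapping_eqI) (metis in_keys_iff lookup_zero)
      qed
    qed
  qed
  moreover have "\<forall>u\<in>Poly_Mapping.keys p. deg u \<le> Max (deg ` Poly_Mapping.keys p)" by simp
  ultimately show ?thesis using p by blast
qed

section \<open>The Jacobian criterion\<close>

lemma mp_eval_pderiv_cong:
  assumes "in_Pn n p" "j < n" "\<And>v. v < n \<Longrightarrow> y v = z v"
  shows "mp_eval_pderiv \<psi> y j p = mp_eval_pderiv \<psi> z j p"
  unfolding mp_eval_pderiv_def
proof (rule sum.cong[OF refl])
  fix u assume u: "u \<in> Poly_Mapping.keys p"
  have "(\<Prod>v\<in>Poly_Mapping.keys u - {j}. y v ^ Poly_Mapping.lookup u v) = (\<Prod>v\<in>Poly_Mapping.keys u - {j}. z v ^ Poly_Mapping.lookup u v)"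
    by (rule prod.cong) (use assms u in \<open>auto simp: in_Pn_def\<close>)
  then show "\<psi> (Poly_Mapping.lookup p u) * (of_nat (Poly_Mapping.lookup u j) * y j ^ (Poly_Mapping.lookup u j - 1)) *
         (\<Prod>v\<in>Poly_Mapping.keys u - {j}. y v ^ Poly_Mapping.lookup u v) =
         \<psi> (Poly_Mapping.lookup p u) * (of_nat (Poly_Mapping.lookup u j) * z j ^ (Poly_Mapping.lookup u j - 1)) *
         (\<Prod>v\<in>Poly_Mapping.keys u - {j}. z v ^ Poly_Mapping.lookup u v)"
    using assms(2,3) by simp
qed

lemma mp_eval_pderiv_hom:
  assumes "comm_ring_hom h"
  shows "h (mp_eval_pderiv \<psi> y j p) = mp_eval_pderiv (\<lambda>c. h (\<psi> c)) (\<lambda>v. h (y v)) j p"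
proof -
  interpret comm_ring_hom h by fact
  show ?thesis by (simp add: mp_eval_pderiv_def hom_sum hom_mult hom_prod hom_power hom_of_nat)
qed

lemma mp_eval_pderiv_not_in_vars:
  assumes "k_algebra_map \<psi>" "in_vars V p" "j \<notin> V" shows "mp_eval_pderiv \<psi> y j p = 0"
proof -
  have "Poly_Mapping.lookup u j = 0" if "u \<in> Poly_Mapping.keys p" for u
  proof -
    have "j \<notin> Poly_Mapping.keys u" using assms that by (auto simp: in_vars_def)
    then show ?thesis by (simp add: in_keys_iff)
  qed
  then show ?thesis by (simp add: mp_eval_pderiv_def)
qed

lemma fps_cutoff_shift: "f = fps_cutoff k f + fps_X ^ k * fps_shift k (f :: 'a::comm_ring_1 fps)"
  by (rule fps_ext) (simp add: fps_X_power_mult_nth)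

section \<open>The linearised equations for the coefficients of a curve\<close>

context field_point
begin

text \<open>The quadratic remainder starts in degree 2k > k, so the k-th coefficients of the
  coordinates enter the k-th coefficient of an equation linearly, through its partial derivatives at
  the constant terms.\<close>

lemma nth_ev_fps_perturb:
  assumes "in_Pn n p" "k \<ge> 1"
  shows "fps_nth (ev_fps (\<lambda>v. w v + fps_X ^ k * t v) p) k = fps_nth (ev_fps w p) k
     + (\<Sum>j<n. mp_eval_pderiv \<phi> (\<lambda>v. fps_nth (w v) 0) j p * fps_nth (t j) 0)"
proof -
  obtain z where z: "ev_fps (\<lambda>v. w v + fps_X ^ k * t v) p = ev_fps w p +
     fps_X ^ k * (\<Sum>j<n. mp_eval_pderiv (\<lambda>c. fps_const (\<phi> c)) w j p * t j) + (fps_X ^ k)\<^sup>2 * z"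
    using mp_eval_taylor[OF assms(1), of "\<lambda>c. fps_const (\<phi> c)" w "fps_X ^ k" t] by blast
  have "fps_nth ((fps_X ^ k)\<^sup>2 * z) k = 0"
    using assms(2) unfolding power_mult[symmetric] by (simp add: fps_X_power_mult_nth)
  moreover have "fps_nth (mp_eval_pderiv (\<lambda>c. fps_const (\<phi> c)) w j p) 0 = mp_eval_pderiv \<phi> (\<lambda>v. fps_nth (w v) 0) j p" for j
    using mp_eval_pderiv_hom[OF fps_nth_0_hom, of "\<lambda>c. fps_const (\<phi> c)" w j p] by simp
  ultimately show ?thesis
    by (simp add: z fps_X_power_mult_nth fps_sum_nth)
qed

lemma nth_1_ev_fps:
  assumes "in_Pn n p"
  shows "fps_nth (ev_fps \<xi> p) 1 = (\<Sum>j<n. mp_eval_pderiv \<phi> (\<lambda>v. fps_nth (\<xi> v) 0) j p * fps_nth (\<xi> j) 1)"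
proof -
  have "\<xi> v = fps_const (fps_nth (\<xi> v) 0) + fps_X ^ 1 * fps_shift 1 (\<xi> v)" for v
  proof -
    have "fps_cutoff 1 (\<xi> v) = fps_const (fps_nth (\<xi> v) 0)" by (rule fps_ext) simp
    then show ?thesis using fps_cutoff_shift[of "\<xi> v" 1] by simp
  qed
  then have e: "\<xi> = (\<lambda>v. fps_const (fps_nth (\<xi> v) 0) + fps_X ^ 1 * fps_shift 1 (\<xi> v))" by blast
  have "fps_nth (ev_fps \<xi> p) 1 =
     fps_nth (ev_fps (\<lambda>v. fps_const (fps_nth (\<xi> v) 0) + fps_X ^ 1 * fps_shift 1 (\<xi> v)) p) 1"
    using e by simp
  also have "\<dots> = (\<Sum>j<n. mp_eval_pderiv \<phi> (\<lambda>v. fps_nth (\<xi> v) 0) j p * fps_nth (\<xi> j) 1)"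
    by (subst nth_ev_fps_perturb[OF assms]) (simp_all add: ev_fps_const)
  finally show ?thesis .
qed

end

locale presented_point = field_point +
  fixes n m :: nat and f :: "nat \<Rightarrow> 'a mpoly"
  assumes f_Pn: "i < m \<Longrightarrow> in_Pn n (f i)"
    and f_0: "i < m \<Longrightarrow> mp_eval \<phi> x (f i) = 0"
    and relation: "in_Pn n p \<Longrightarrow> mp_eval \<phi> x p = 0 \<Longrightarrow> \<exists>g. p = (\<Sum>i<m. g i * f i)"
begin

text \<open>Each relation among the coordinates is a combination of the generators, so vanishing
  passes from the generators to all relations.\<close>

lemma curve_generators:
  assumes "\<And>v. fps_nth (\<xi> v) 0 = on_set {..<n} x v" "\<And>v. v \<ge> n \<Longrightarrow> \<xi> v = 0"
    and v: "\<And>i. i < m \<Longrightarrow> vanish K (ev_fps \<xi> (f i))"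
  shows "curve K {..<n} \<xi>"
  unfolding curve_def
proof (intro conjI allI impI)
  fix p assume p: "ev {..<n} p = 0"
  let ?p = "restrict_vars {..<n} p"
  have P: "in_Pn n ?p" using in_vars_restrict_vars in_vars_lessThan by blast
  moreover have "mp_eval \<phi> x ?p = 0"
    using p mp_eval_on_set_lessThan[OF P, of \<phi> x] mp_eval_restrict_vars[OF alg, of "{..<n}" "on_set {..<n} x" p]
    by (simp add: on_set_def)
  ultimately obtain g where g: "?p = (\<Sum>i<m. g i * f i)" using relation by blast
  have "ev_fps \<xi> p = ev_fps \<xi> ?p"
    by (rule mp_eval_restrict_vars[OF alg_fps, symmetric]) (use assms in auto)
  also have "\<dots> = (\<Sum>i<m. ev_fps \<xi> (g i) * ev_fps \<xi> (f i))"
    unfolding g by (simp add: mp_eval_sum[OF alg_fps] mp_eval_mult[OF alg_fps])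
  finally show "vanish K (ev_fps \<xi> p)" using v by (auto intro!: vanish_sum vanish_mult2)
qed (use assms in auto)

lemma curve_vanish_f:
  assumes "curve K {..<n} \<xi>" "i < m" shows "vanish K (ev_fps \<xi> (f i))"
  using assms f_0[OF assms(2)] mp_eval_on_set_lessThan[OF f_Pn[OF assms(2)], of \<phi> x]
  by (auto simp: curve_def)

lemma pderiv_curve:
  assumes "curve K {..<n} \<xi>" "in_Pn n p" "j < n"
  shows "mp_eval_pderiv \<phi> (\<lambda>v. fps_nth (\<xi> v) 0) j p = mp_eval_pderiv \<phi> x j p"
  by (rule mp_eval_pderiv_cong[OF assms(2,3)]) (use assms in \<open>auto simp: curve_def on_set_def\<close>)

end

section \<open>The parameters attached to a nonzero minor of maximal size\<close>

locale presented_minor = presented_point +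
  fixes \<rho> \<gamma> :: "nat \<Rightarrow> nat" and r :: nat
  assumes \<rho>: "inj_on \<rho> {..<r}" "\<rho> ` {..<r} \<subseteq> {..<m}"
    and \<gamma>: "inj_on \<gamma> {..<r}" "\<gamma> ` {..<r} \<subseteq> {..<n}"
    and minor: "det_sq r (\<lambda>a b. jacobian_matrix \<phi> x f (\<rho> a) (\<gamma> b)) \<noteq> 0"
    and max_rank: "d \<in> minors m n (jacobian_matrix \<phi> x f) (Suc r) \<Longrightarrow> d = 0"
    and perfect: "perfect_field TYPE('a)"
begin

definition params :: "nat set" where
  "params = {..<n} - \<gamma> ` {..<r}"

lemma params_un: "params \<union> \<gamma> ` {..<r} = {..<n}"
  using \<gamma>(2) by (auto simp: params_def)

lemma \<rho>_less: "a < r \<Longrightarrow> \<rho> a < m"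
  using \<rho>(2) by auto

lemma sum_split:
  fixes g :: "nat \<Rightarrow> 'c::comm_monoid_add"
  shows "(\<Sum>j<n. g j) = (\<Sum>c\<in>params. g c) + (\<Sum>b<r. g (\<gamma> b))"
proof -
  have "(\<Sum>j<n. g j) = (\<Sum>j\<in>params. g j) + (\<Sum>j\<in>\<gamma> ` {..<r}. g j)"
    unfolding params_un[symmetric] by (rule sum.union_disjoint) (auto simp: params_def)
  then show ?thesis by (simp add: sum.reindex[OF \<gamma>(1)])
qed

text \<open>The X-coefficients of a curve solve the linearised equations. If those of the parameters
  are 0, the chosen r rows become a homogeneous system whose determinant is the nonzero
  minor.\<close>

lemma rigid: "rigid params {..<n}"
  unfolding rigid_def
proof (intro allI impI)
  fix \<xi> v assume \<xi>: "curve 2 {..<n} \<xi>" and c: "\<forall>c\<in>params. fps_nth (\<xi> c) 1 = 0"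
  have z: "(\<Sum>b<r. jacobian_matrix \<phi> x f (\<rho> a) (\<gamma> b) * fps_nth (\<xi> (\<gamma> b)) 1) = 0" if a: "a < r" for a
  proof -
    have "0 = fps_nth (ev_fps \<xi> (f (\<rho> a))) 1"
      using curve_vanish_f[OF \<xi> \<rho>_less[OF a]] by (simp add: vanish_def)
    also have "\<dots> = (\<Sum>j<n. jacobian_matrix \<phi> x f (\<rho> a) j * fps_nth (\<xi> j) 1)"
      unfolding nth_1_ev_fps[OF f_Pn[OF \<rho>_less[OF a]]] jacobian_matrix_def
      using pderiv_curve[OF \<xi> f_Pn[OF \<rho>_less[OF a]]] by (intro sum.cong) auto
    also have "\<dots> = (\<Sum>b<r. jacobian_matrix \<phi> x f (\<rho> a) (\<gamma> b) * fps_nth (\<xi> (\<gamma> b)) 1)"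
      unfolding sum_split using c by simp
    finally show ?thesis by simp
  qed
  show "fps_nth (\<xi> v) 1 = 0"
  proof (cases "v < n")
    case True
    then consider "v \<in> params" | b where "b < r" "v = \<gamma> b" using params_un by blast
    then show ?thesis
    proof cases
      case 2
      then show ?thesis
        using det_sq_injective[OF minor z, of b] by simp
    qed (use c in auto)
  next
    case False
    then show ?thesis using \<xi> by (auto simp: curve_def)
  qed
qed

text \<open>A kernel vector of the Jacobi matrix supported on \<open>c\<close> and the columns of
  the minor is a derivation that is nonzero on \<open>x c\<close> and 0 on the other parameters.
  Applied to a relation in the parameters, it leaves only the partial derivative in
  \<open>c\<close>.\<close>

lemma pderiv_param_relation:
  assumes c: "c \<in> params" and p: "in_vars params p" "mp_eval \<phi> x p = 0"
  shows "mp_eval_pderiv \<phi> x c p = 0"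
proof -
  obtain v where v: "v c \<noteq> 0" "\<And>j. j \<noteq> c \<Longrightarrow> j \<notin> \<gamma> ` {..<r} \<Longrightarrow> v j = 0"
    "\<And>i. i < m \<Longrightarrow> (\<Sum>j<n. jacobian_matrix \<phi> x f i j * v j) = 0"
    using minor_kernel[OF \<rho> \<gamma> minor max_rank, of c] c by (auto simp: params_def)
  define \<xi> where "\<xi> = (\<lambda>j. if j < n then fps_const (x j) + fps_X * fps_const (v j / v c) else 0)"
  have \<xi>0: "fps_nth (\<xi> j) 0 = on_set {..<n} x j" for j by (simp add: \<xi>_def on_set_def)
  have \<xi>1: "fps_nth (\<xi> j) 1 = v j / v c" if "j < n" for j using that by (simp add: \<xi>_def)
  have nth1: "fps_nth (ev_fps \<xi> q) 1 = (\<Sum>j<n. mp_eval_pderiv \<phi> x j q * v j) / v c" if q: "in_Pn n q" for q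
  proof -
    have "mp_eval_pderiv \<phi> (\<lambda>v. fps_nth (\<xi> v) 0) j q = mp_eval_pderiv \<phi> x j q" if "j < n" for j
      by (rule mp_eval_pderiv_cong[OF q that]) (simp add: \<xi>0 on_set_def)
    then show ?thesis
      unfolding nth_1_ev_fps[OF q] sum_divide_distrib by (intro sum.cong) (auto simp: \<xi>1[unfolded One_nat_def])
  qed
  have "curve 2 {..<n} \<xi>"
  proof (rule curve_generators)
    fix i assume i: "i < m"
    have "fps_nth (ev_fps \<xi> (f i)) 0 = 0"
      unfolding nth_0_ev_fps \<xi>0 using f_0[OF i] mp_eval_on_set_lessThan[OF f_Pn[OF i], of \<phi> x] by simp
    moreover have "fps_nth (ev_fps \<xi> (f i)) 1 = 0"
      using nth1[OF f_Pn[OF i]] v(3)[OF i] by (simp add: jacobian_matrix_def)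
    ultimately show "vanish 2 (ev_fps \<xi> (f i))"
      by (auto simp: vanish_def less_2_cases_iff)
  qed (rule \<xi>0, simp add: \<xi>_def)
  moreover have P: "in_Pn n p"
    using p(1) unfolding in_vars_lessThan[symmetric] in_vars_def params_def by blast
  ultimately have "fps_nth (ev_fps \<xi> p) 1 = 0"
    using p(2) mp_eval_on_set_lessThan[OF P, of \<phi> x] by (auto simp: curve_def vanish_def)
  then have "0 = (\<Sum>j<n. mp_eval_pderiv \<phi> x j p * v j)" using nth1[OF P] v(1) by simp
  also have "\<dots> = (\<Sum>j<n. if j = c then mp_eval_pderiv \<phi> x c p * v c else 0)"
  proof (rule sum.cong[OF refl])
    fix j assume "j \<in> {..<n}"
    show "mp_eval_pderiv \<phi> x j p * v j = (if j = c then mp_eval_pderiv \<phi> x c p * v c else 0)"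
      using v(2)[of j] mp_eval_pderiv_not_in_vars[OF alg p(1), of j x] by (auto simp: params_def)
  qed
  also have "\<dots> = mp_eval_pderiv \<phi> x c p * v c" using c by (simp add: params_def)
  finally show ?thesis using v(1) by simp
qed

lemma params_independent: "in_vars params p \<Longrightarrow> mp_eval \<phi> x p = 0 \<Longrightarrow> p = 0"
  by (rule algebraically_independent[OF alg perfect, of params x])
     (auto simp: params_def intro: pderiv_param_relation[unfolded params_def])

text \<open>The parameters satisfy no nontrivial relation, so they may move along arbitrary
  series.\<close>

lemma curve_params:
  assumes "\<And>v. fps_nth (\<xi> v) 0 = on_set params x v" "\<And>v. v \<notin> params \<Longrightarrow> \<xi> v = 0"
  shows "curve K params \<xi>"
  unfolding curve_def
proof (intro conjI allI impI)
  fix p assume p: "ev params p = 0"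
  let ?p = "restrict_vars params p"
  have "mp_eval \<phi> x ?p = ev params ?p"
    by (rule mp_eval_in_vars_cong[OF in_vars_restrict_vars]) (simp add: on_set_def)
  also have "\<dots> = 0" using p by (subst mp_eval_restrict_vars[OF alg]) (auto simp: on_set_def)
  finally have "?p = 0" using params_independent[OF in_vars_restrict_vars] by blast
  then have "ev_fps \<xi> p = 0"
    using mp_eval_restrict_vars[OF alg_fps, of params \<xi> p] assms(2) mp_eval_0[OF alg_fps] by metis
  then show "vanish K (ev_fps \<xi> p)" by simp
qed (use assms in auto)

lemma sep_algebraic_minor: "k < r \<Longrightarrow> sep_algebraic (params \<union> \<gamma> ` {..<k}) (\<gamma> k)"
  by (rule rigid_imp_sep_algebraic[OF _ \<gamma>(1)]) (use rigid params_un in \<open>auto simp: params_def\<close>)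

lemma curve_ex:
  assumes "c \<in> params"
  shows "\<exists>\<xi>. curve K {..<n} \<xi> \<and> (\<forall>v\<in>params. \<xi> v = fps_const (x v) + (if v = c then fps_X else 0))"
proof -
  define \<xi>\<^sub>0 where "\<xi>\<^sub>0 = (\<lambda>v. if v \<in> params then fps_const (x v) + (if v = c then fps_X else 0) else 0)"
  have "curve K params \<xi>\<^sub>0"
    by (rule curve_params) (auto simp: \<xi>\<^sub>0_def on_set_def)
  from curve_extend_all[OF sep_algebraic_minor \<gamma>(1) _ this]
  show ?thesis unfolding params_un by (auto simp: \<xi>\<^sub>0_def params_def)
qed

lemma descent_params:
  assumes J: "\<And>p a. a \<in> J \<Longrightarrow> mp_eval \<phi> x p * a \<in> J"
    and p: "in_Pn n p" "mp_eval \<phi> x p \<in> J" "mp_eval \<phi> x p \<noteq> 0"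
  shows "\<exists>p. in_vars params p \<and> mp_eval \<phi> x p \<in> J \<and> mp_eval \<phi> x p \<noteq> 0"
proof -
  have e: "mp_eval \<phi> x (restrict_vars V q) = ev V q" for V q
  proof -
    have "mp_eval \<phi> x (restrict_vars V q) = ev V (restrict_vars V q)"
      by (rule mp_eval_in_vars_cong[OF in_vars_restrict_vars]) (simp add: on_set_def)
    also have "\<dots> = ev V q" by (rule mp_eval_restrict_vars[OF alg]) (simp add: on_set_def)
    finally show ?thesis .
  qed
  have "\<exists>p. ev params p \<in> J \<and> ev params p \<noteq> 0"
  proof (rule descent_all[where r = r and \<gamma> = \<gamma> and p = p, OF sep_algebraic_minor _ \<gamma>(1)])
    show "ev (params \<union> \<gamma> ` {..<r}) q * a \<in> J" if "a \<in> J" for q a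
      using J[OF that] e by metis
    show "\<gamma> ` {..<r} \<inter> params = {}" by (auto simp: params_def)
  qed (use p mp_eval_on_set_lessThan[OF p(1), of \<phi> x] in \<open>simp_all add: params_un\<close>)
  then show ?thesis using e in_vars_restrict_vars by metis
qed

end

section \<open>Hasse-Schmidt derivations\<close>

text \<open>The first k coefficients lie in A after substituting d^e X for X. An exponent linear in
  the index makes the condition stable under products.\<close>

definition bounded_denom :: "'l::field set \<Rightarrow> 'l \<Rightarrow> nat \<Rightarrow> nat \<Rightarrow> 'l fps \<Rightarrow> bool" where
  "bounded_denom A d e k w \<longleftrightarrow> (\<forall>i<k. d ^ (e * i) * fps_nth w i \<in> A)"

locale subring_of_field =
  fixes A :: "'l::field set"
  assumes A_0: "0 \<in> A" and A_1: "1 \<in> A"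
    and A_add: "a \<in> A \<Longrightarrow> b \<in> A \<Longrightarrow> a + b \<in> A"
    and A_mult: "a \<in> A \<Longrightarrow> b \<in> A \<Longrightarrow> a * b \<in> A"
    and A_uminus: "a \<in> A \<Longrightarrow> - a \<in> A"
begin

lemma A_sum: "(\<And>i. i \<in> I \<Longrightarrow> g i \<in> A) \<Longrightarrow> (\<Sum>i\<in>I. g i) \<in> A"
  by (induction I rule: infinite_finite_induct) (auto intro: A_0 A_add)

lemma A_prod: "(\<And>i. i \<in> I \<Longrightarrow> g i \<in> A) \<Longrightarrow> (\<Prod>i\<in>I. g i) \<in> A"
  by (induction I rule: infinite_finite_induct) (auto intro: A_1 A_mult)

lemma A_power: "a \<in> A \<Longrightarrow> a ^ k \<in> A"
  by (induction k) (auto intro: A_1 A_mult)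

lemma A_of_nat: "of_nat k \<in> A"
  by (induction k) (auto intro: A_0 A_1 A_add)

lemma mp_eval_pderiv_in_A:
  assumes "\<And>c. \<phi> c \<in> A" "in_Pn n p" "j < n" "\<And>v. v < n \<Longrightarrow> x v \<in> A"
  shows "mp_eval_pderiv \<phi> x j p \<in> A"
  unfolding mp_eval_pderiv_def
  by (intro A_sum A_mult A_prod A_power A_of_nat assms) (use assms(2) in \<open>auto simp: in_Pn_def\<close>)

abbreviation "bd \<equiv> bounded_denom A"

lemma bd_mult:
  assumes "bd d e k w" "bd d e k z" shows "bd d e k (w * z)"
  unfolding bounded_denom_def
proof (intro allI impI)
  fix i assume i: "i < k"
  have "d ^ (e * i) * fps_nth (w * z) i = (\<Sum>j=0..i. (d ^ (e * j) * fps_nth w j) * (d ^ (e * (i - j)) * fps_nth z (i - j)))"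
    unfolding fps_mult_nth sum_distrib_left
  proof (rule sum.cong[OF refl])
    fix j assume "j \<in> {0..i}"
    then have "e * i = e * j + e * (i - j)" by (simp flip: add_mult_distrib2)
    then have "d ^ (e * i) = d ^ (e * j) * d ^ (e * (i - j))" by (simp flip: power_add)
    then show "d ^ (e * i) * (fps_nth w j * fps_nth z (i - j)) =
      (d ^ (e * j) * fps_nth w j) * (d ^ (e * (i - j)) * fps_nth z (i - j))" by simp
  qed
  also have "\<dots> \<in> A"
  proof (rule A_sum)
    fix j assume "j \<in> {0..i}"
    then show "(d ^ (e * j) * fps_nth w j) * (d ^ (e * (i - j)) * fps_nth z (i - j)) \<in> A"
      using assms i by (intro A_mult[of "d ^ (e * j) * fps_nth w j"]) (auto simp: bounded_denom_def)
  qed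
  finally show "d ^ (e * i) * fps_nth (w * z) i \<in> A" .
qed

lemma bd_const: "a \<in> A \<Longrightarrow> bd d e k (fps_const a)"
  by (auto simp: bounded_denom_def A_0)

lemma bd_sum: "(\<And>i. i \<in> I \<Longrightarrow> bd d e k (g i)) \<Longrightarrow> bd d e k (\<Sum>i\<in>I. g i)"
  unfolding bounded_denom_def by (auto simp: fps_sum_nth sum_distrib_left intro!: A_sum)

lemma bd_prod: "(\<And>i. i \<in> I \<Longrightarrow> bd d e k (g i)) \<Longrightarrow> bd d e k (\<Prod>i\<in>I. g i)"
  using bd_const[OF A_1]
  by (induction I rule: infinite_finite_induct) (auto intro: bd_mult)

lemma bd_power: "bd d e k g \<Longrightarrow> bd d e k (g ^ j)"
  using bd_prod[of "{..<j}" d e k "\<lambda>_. g"] by simp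

lemma bd_mp_eval:
  assumes "\<And>c. \<phi> c \<in> A" "in_Pn n p" "\<And>v. v < n \<Longrightarrow> bd d e k (\<xi> v)"
  shows "bd d e k (mp_eval (\<lambda>c. fps_const (\<phi> c)) \<xi> p)"
  unfolding mp_eval_def
  by (intro bd_sum bd_mult bd_const bd_prod bd_power assms) (use assms(2) in \<open>auto simp: in_Pn_def\<close>)

text \<open>The recursion for the coefficients of the inverse divides by the constant term
  alone.\<close>

lemma bd_inverse:
  assumes w: "bd d e k w" and u: "fps_nth w 0 \<noteq> 0" "inverse (fps_nth w 0) \<in> A"
  shows "bd d e k (inverse w)"
  unfolding bounded_denom_def
proof (intro allI impI)
  fix i assume "i < k"
  then show "d ^ (e * i) * fps_nth (inverse w) i \<in> A"
  proof (induction i rule: less_induct)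
    case (less i)
    show ?case
    proof (cases "i = 0")
      case True
      then show ?thesis using u by simp
    next
      case False
      have "0 = fps_nth (w * inverse w) i" using inverse_mult_eq_1'[OF u(1)] False by simp
      also have "\<dots> = fps_nth w 0 * fps_nth (inverse w) i + (\<Sum>j=1..i. fps_nth w j * fps_nth (inverse w) (i - j))"
        unfolding fps_mult_nth by (simp add: sum.atLeast_Suc_atMost)
      finally have "fps_nth (inverse w) i = - inverse (fps_nth w 0) * (\<Sum>j=1..i. fps_nth w j * fps_nth (inverse w) (i - j))"
        using u(1) by (simp add: field_simps eq_neg_iff_add_eq_0 add.commute)
      then have "d ^ (e * i) * fps_nth (inverse w) i =
         - inverse (fps_nth w 0) * (\<Sum>j=1..i. d ^ (e * i) * (fps_nth w j * fps_nth (inverse w) (i - j)))"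
        by (simp add: sum_distrib_left mult_ac)
      also have "(\<Sum>j=1..i. d ^ (e * i) * (fps_nth w j * fps_nth (inverse w) (i - j))) =
         (\<Sum>j=1..i. (d ^ (e * j) * fps_nth w j) * (d ^ (e * (i - j)) * fps_nth (inverse w) (i - j)))"
      proof (rule sum.cong[OF refl])
        fix j assume "j \<in> {1..i}"
        then have "e * i = e * j + e * (i - j)" by (simp flip: add_mult_distrib2)
        then have "d ^ (e * i) = d ^ (e * j) * d ^ (e * (i - j))" by (simp flip: power_add)
        then show "d ^ (e * i) * (fps_nth w j * fps_nth (inverse w) (i - j)) =
          (d ^ (e * j) * fps_nth w j) * (d ^ (e * (i - j)) * fps_nth (inverse w) (i - j))" by simp
      qed
      also have "- inverse (fps_nth w 0) * \<dots> \<in> A"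
      proof (intro A_mult[of "- inverse (fps_nth w 0)"] A_uminus A_sum u(2))
        fix j assume "j \<in> {1..i}"
        then show "(d ^ (e * j) * fps_nth w j) * (d ^ (e * (i - j)) * fps_nth (inverse w) (i - j)) \<in> A"
          using w less by (intro A_mult[of "d ^ (e * j) * fps_nth w j"]) (auto simp: bounded_denom_def)
      qed
      finally show ?thesis .
    qed
  qed
qed

end

section \<open>Denominators of the coefficients of a curve\<close>

context presented_minor
begin

text \<open>The k-th coefficients of the curve solve a linear system with the Jacobian minor as determinant and
  right-hand side a polynomial in the previous coefficients.\<close>
lemma curve_bounded_denom:
  assumes A: "subring_of_field A" and \<phi>A: "\<And>c. \<phi> c \<in> A" and xA: "\<And>v. v < n \<Longrightarrow> x v \<in> A"
    and C: "\<And>a b. a < r \<Longrightarrow> b < r \<Longrightarrow> C b a \<in> A"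
      "\<And>b b'. b < r \<Longrightarrow> b' < r \<Longrightarrow>
         (\<Sum>a<r. C b a * jacobian_matrix \<phi> x f (\<rho> a) (\<gamma> b')) = (if b = b' then d else 0)"
    and d: "d \<in> A" and \<xi>: "curve K {..<n} \<xi>"
    and par: "\<forall>v\<in>params. \<xi> v = fps_const (x v) + (if v = c then fps_X else 0)"
    and k: "1 \<le> k" "k \<le> K"
  shows "\<exists>e. \<forall>j<n. bounded_denom A d e k (\<xi> j)"
  using k
proof (induction k rule: dec_induct)
  case base
  then show ?case using \<xi> xA by (auto simp: bounded_denom_def curve_def on_set_def)
next
  case (step k)
  interpret subring_of_field A by fact
  obtain e where e: "\<forall>j<n. bd d e k (\<xi> j)" using step by auto
  \<comment> \<open>The series are split at order k. The lower part \<open>w\<close> has bounded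
    denominators by induction, and as its k-th coefficient is 0 the bound extends to k + 1
    coefficients.\<close>
  define w where "w = (\<lambda>j. fps_cutoff k (\<xi> j))"
  define t where "t = (\<lambda>j. fps_shift k (\<xi> j))"
  have wt: "\<xi> = (\<lambda>j. w j + fps_X ^ k * t j)" unfolding w_def t_def using fps_cutoff_shift by blast
  have w: "bd d e (Suc k) (w j)" if "j < n" for j
    using e that by (auto simp: bounded_denom_def w_def A_0)
  let ?t = "\<lambda>j. d ^ (e * k) * fps_nth (\<xi> j) k"
  have parA: "fps_nth (\<xi> v) k \<in> A" if "v \<in> params" for v
    using par that A_0 A_1 step(1) by (auto split: if_splits simp: fps_X_def)
  have JA: "jacobian_matrix \<phi> x f i j \<in> A" if "i < m" "j < n" for i j
    unfolding jacobian_matrix_def by (rule mp_eval_pderiv_in_A[OF \<phi>A f_Pn]) (use that xA in auto)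
  have rowA: "(\<Sum>b<r. jacobian_matrix \<phi> x f (\<rho> a) (\<gamma> b) * ?t (\<gamma> b)) \<in> A" if a: "a < r" for a
  proof -
    note ra = \<rho>_less[OF a]
    have "0 = fps_nth (ev_fps \<xi> (f (\<rho> a))) k"
      using curve_vanish_f[OF \<xi> ra] step by (simp add: vanish_def)
    also have "\<dots> = fps_nth (ev_fps w (f (\<rho> a))) k
        + (\<Sum>j<n. mp_eval_pderiv \<phi> (\<lambda>v. fps_nth (w v) 0) j (f (\<rho> a)) * fps_nth (t j) 0)"
      by (subst wt) (rule nth_ev_fps_perturb[OF f_Pn[OF ra]], use step in simp)
    also have "(\<Sum>j<n. mp_eval_pderiv \<phi> (\<lambda>v. fps_nth (w v) 0) j (f (\<rho> a)) * fps_nth (t j) 0) =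
        (\<Sum>j<n. jacobian_matrix \<phi> x f (\<rho> a) j * fps_nth (\<xi> j) k)"
    proof (rule sum.cong[OF refl])
      fix j assume j: "j \<in> {..<n}"
      have "fps_nth (w v) 0 = fps_nth (\<xi> v) 0" for v using step by (simp add: w_def)
      then show "mp_eval_pderiv \<phi> (\<lambda>v. fps_nth (w v) 0) j (f (\<rho> a)) * fps_nth (t j) 0 =
         jacobian_matrix \<phi> x f (\<rho> a) j * fps_nth (\<xi> j) k"
        using pderiv_curve[OF \<xi> f_Pn[OF ra], of j] j by (simp add: jacobian_matrix_def t_def)
    qed
    finally have "(\<Sum>j<n. jacobian_matrix \<phi> x f (\<rho> a) j * fps_nth (\<xi> j) k) = - fps_nth (ev_fps w (f (\<rho> a))) k"
      by (simp add: eq_neg_iff_add_eq_0 add.commute)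
    then have "(\<Sum>j<n. jacobian_matrix \<phi> x f (\<rho> a) j * ?t j) = - (d ^ (e * k) * fps_nth (ev_fps w (f (\<rho> a))) k)"
      by (simp add: mult.left_commute[of _ "d ^ (e * k)"] flip: sum_distrib_left)
    then have "(\<Sum>b<r. jacobian_matrix \<phi> x f (\<rho> a) (\<gamma> b) * ?t (\<gamma> b)) =
        - (d ^ (e * k) * fps_nth (ev_fps w (f (\<rho> a))) k) + - (\<Sum>v\<in>params. jacobian_matrix \<phi> x f (\<rho> a) v * ?t v)"
      unfolding sum_split by (simp add: algebra_simps)
    also have "\<dots> \<in> A"
    proof (intro A_add A_uminus A_sum)
      show "d ^ (e * k) * fps_nth (ev_fps w (f (\<rho> a))) k \<in> A"
        using bd_mp_eval[OF \<phi>A f_Pn[OF ra] w] by (simp add: bounded_denom_def)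
      show "jacobian_matrix \<phi> x f (\<rho> a) v * ?t v \<in> A" if "v \<in> params" for v
        using that by (intro A_mult A_power d JA ra parA) (auto simp: params_def)
    qed
    finally show ?thesis .
  qed
  \<comment> \<open>Multiplying the r rows by the adjugate solves the system at the cost of one
    factor d.\<close>
  have dt: "d * ?t (\<gamma> b) \<in> A" if b: "b < r" for b
  proof -
    have "d * ?t (\<gamma> b) = (\<Sum>b'<r. if b = b' then d * ?t (\<gamma> b') else 0)" using b by simp
    also have "\<dots> = (\<Sum>b'<r. (\<Sum>a<r. C b a * jacobian_matrix \<phi> x f (\<rho> a) (\<gamma> b')) * ?t (\<gamma> b'))"
      using C(2)[OF b] by (intro sum.cong) auto
    also have "\<dots> = (\<Sum>a<r. C b a * (\<Sum>b'<r. jacobian_matrix \<phi> x f (\<rho> a) (\<gamma> b') * ?t (\<gamma> b')))"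
      unfolding sum_distrib_left sum_distrib_right by (subst sum.swap) (simp only: mult.assoc)
    also have "\<dots> \<in> A" by (intro A_sum A_mult C(1) rowA) (use b in auto)
    finally show ?thesis .
  qed
  \<comment> \<open>Replacing e by e + 1 adds k \<ge> 1 factors d at index k, one of which pays for
    Cramer's rule; at smaller indices the additional factors do no harm, as d lies in A.\<close>
  have dA: "d ^ (Suc e * i) * y \<in> A" if "d ^ (e * i) * y \<in> A" for i y
  proof -
    show ?thesis using A_mult[OF A_power[OF d, of i] that] by (simp add: power_add mult.assoc)
  qed
  have dk: "d ^ (Suc e * k) * fps_nth (\<xi> j) k \<in> A" if j: "j < n" for j
  proof -
    have "j \<in> params \<union> \<gamma> ` {..<r}" using j by (simp add: params_un)
    then consider "j \<in> params" | b where "b < r" "j = \<gamma> b" by blast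
    then show ?thesis
    proof cases
      case 1
      then show ?thesis by (intro A_mult A_power d parA)
    next
      case 2
      have "d ^ (Suc e * k) * fps_nth (\<xi> j) k = d ^ (k - 1) * (d * ?t j)"
        using step(1) by (cases k) (simp_all add: power_add mult_ac)
      then show ?thesis using A_mult[OF A_power[OF d, of "k - 1"] dt[OF 2(1)]] 2(2) by metis
    qed
  qed
  show ?case
  proof (rule exI[of _ "Suc e"], intro allI impI)
    fix j assume j: "j < n"
    show "bd d (Suc e) (Suc k) (\<xi> j)"
      unfolding bounded_denom_def
    proof (intro allI impI)
      fix i assume "i < Suc k"
      then consider "i < k" | "i = k" by linarith
      then show "d ^ (Suc e * i) * fps_nth (\<xi> j) i \<in> A"
        by cases (use dk[OF j] dA e j in \<open>simp_all add: bounded_denom_def\<close>)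
    qed
  qed
qed

end

text \<open>A Hasse-Schmidt derivation of length K; the values U k with k at least K are irrelevant.\<close>
definition hs_system :: "('k \<Rightarrow> 'a::comm_ring_1) \<Rightarrow> nat \<Rightarrow> (nat \<Rightarrow> 'a \<Rightarrow> 'a) \<Rightarrow> bool" where
  "hs_system \<phi> K U \<longleftrightarrow> (\<forall>a. U 0 a = a) \<and> (\<forall>k<K. klinear \<phi> (U k) \<and>
     (\<forall>a b. U k (a * b) = (\<Sum>i\<le>k. U i a * U (k - i) b)))"

lemma det_sq_hom:
  assumes "comm_ring_hom h"
  shows "h (det_sq k N) = det_sq k (\<lambda>a b. h (N a b))"
proof -
  interpret comm_ring_hom h by fact
  show ?thesis by (simp add: det_sq_def hom_sum hom_mult hom_prod hom_of_int)
qed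

lemma minors_hom:
  assumes "comm_ring_hom h"
  shows "minors m n (\<lambda>i j. h (M i j)) k = h ` minors m n M k"
  unfolding minors_def det_sq_hom[OF assms, symmetric] by blast

lemma finite_minor_sizes: "finite {k. \<exists>d\<in>minors m n M k. d \<noteq> 0}"
proof -
  have "k \<le> m" if k: "d \<in> minors m n M k" for k d
  proof -
    obtain \<rho> where "inj_on \<rho> {..<k}" "\<rho> ` {..<k} \<subseteq> {..<m}" using k by (auto simp: minors_def)
    then show ?thesis using card_inj_on_le[of \<rho> "{..<k}" "{..<m}"] by simp
  qed
  then show ?thesis using finite_subset[of "{k. \<exists>d\<in>minors m n M k. d \<noteq> 0}" "{..m}"] by auto
qed

lemma mat_rank_maximal:
  assumes "d \<in> minors m n M (Suc (mat_rank m n M))" shows "d = 0"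
proof (rule ccontr)
  assume "d \<noteq> 0"
  then have "Suc (mat_rank m n M) \<in> {k. \<exists>d\<in>minors m n M k. d \<noteq> 0}" using assms by blast
  then have "Suc (mat_rank m n M) \<le> mat_rank m n M"
    unfolding mat_rank_def by (intro Max_ge finite_minor_sizes)
  then show False by simp
qed

lemma to_fract_hom: "comm_ring_hom (to_fract :: 'a::idom \<Rightarrow> 'a fract)"
  by unfold_locales auto

lemma fps_map_hom:
  assumes "comm_ring_hom h" shows "comm_ring_hom (\<lambda>g. Abs_fps (\<lambda>i. h (fps_nth g i)))"
proof -
  interpret comm_ring_hom h by fact
  show ?thesis
    by unfold_locales (auto intro!: fps_ext simp: hom_add hom_mult hom_sum fps_mult_nth fps_one_def)
qed

section \<open>The Taylor homomorphism of A in the direction of a parameter\<close>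

locale affine_minor =
  fixes \<phi> :: "'k::field \<Rightarrow> 'a::idom" and n m :: nat and x :: "nat \<Rightarrow> 'a" and f :: "nat \<Rightarrow> 'k mpoly"
    and \<rho> \<gamma> :: "nat \<Rightarrow> nat" and r :: nat and d :: 'a
  assumes perf: "perfect_field TYPE('k)" and k_alg: "k_algebra_map \<phi>"
    and pres: "is_presentation \<phi> n m x f"
    and r: "r = mat_rank m n (jacobian_matrix \<phi> x f)"
    and d: "d = det_sq r (\<lambda>a b. jacobian_matrix \<phi> x f (\<rho> a) (\<gamma> b))" "d \<noteq> 0"
    and inj_\<rho>: "inj_on \<rho> {..<r}" "\<rho> ` {..<r} \<subseteq> {..<m}"
    and inj_\<gamma>: "inj_on \<gamma> {..<r}" "\<gamma> ` {..<r} \<subseteq> {..<n}"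
begin

lemma jacobian_to_fract:
  "jacobian_matrix (\<lambda>c. to_fract (\<phi> c)) (\<lambda>v. to_fract (x v)) f = (\<lambda>i j. to_fract (jacobian_matrix \<phi> x f i j))"
  unfolding jacobian_matrix_def using mp_eval_pderiv_hom[OF to_fract_hom, of \<phi> x] by metis

lemma mp_eval_to_fract:
  "mp_eval (\<lambda>c. to_fract (\<phi> c)) (\<lambda>v. to_fract (x v)) p = to_fract (mp_eval \<phi> x p)"
  using mp_eval_hom[OF to_fract_hom, of \<phi> x p] by simp

sublocale F: presented_minor "\<lambda>c. to_fract (\<phi> c)" "\<lambda>v. to_fract (x v)" n m f \<rho> \<gamma> r
proof unfold_locales
  show "k_algebra_map (\<lambda>c. to_fract (\<phi> c))"
    unfolding k_algebra_map_def using k_algebra_map_simps[OF k_alg] by simp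
  show "in_Pn n (f i)" if "i < m" for i using pres that by (simp add: is_presentation_def)
  then show "mp_eval (\<lambda>c. to_fract (\<phi> c)) (\<lambda>v. to_fract (x v)) (f i) = 0" if "i < m" for i
  proof -
    \<comment> \<open>The presentation characterises vanishing by combinations of the generators, so
      \<open>f i\<close> is first written as such a combination.\<close>
    have "f i = (\<Sum>j<m. if j = i then f j else 0)" using that by simp
    also have "\<dots> = (\<Sum>j<m. (if j = i then 1 else 0) * f j)" by (rule sum.cong) auto
    finally have "f i = \<dots>" .
    moreover have "in_Pn n (if j = i then 1 else (0 :: 'k mpoly))" for j by (simp add: in_Pn_def)
    ultimately have "\<exists>g. (\<forall>j<m. in_Pn n (g j)) \<and> f i = (\<Sum>j<m. g j * f j)"
      by (intro exI[of _ "\<lambda>j. if j = i then 1 else 0"]) simp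
    then have "mp_eval \<phi> x (f i) = 0"
      using pres \<open>\<And>i. i < m \<Longrightarrow> in_Pn n (f i)\<close>[OF that] unfolding is_presentation_def by blast
    then show ?thesis by (simp add: mp_eval_to_fract)
  qed
  show "\<exists>g. p = (\<Sum>i<m. g i * f i)"
    if "in_Pn n p" "mp_eval (\<lambda>c. to_fract (\<phi> c)) (\<lambda>v. to_fract (x v)) p = 0" for p
  proof -
    have "mp_eval \<phi> x p = 0" using that(2) by (simp add: mp_eval_to_fract)
    with that(1) pres show ?thesis unfolding is_presentation_def by blast
  qed
  have "det_sq r (\<lambda>a b. to_fract (jacobian_matrix \<phi> x f (\<rho> a) (\<gamma> b))) = to_fract d"
    unfolding d det_sq_hom[OF to_fract_hom] ..
  then show "det_sq r (\<lambda>a b. jacobian_matrix (\<lambda>c. to_fract (\<phi> c)) (\<lambda>v. to_fract (x v)) f (\<rho> a) (\<gamma> b)) \<noteq> 0"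
    using d(2) by (simp add: jacobian_to_fract)
  show "D = 0" if D: "D \<in> minors m n (jacobian_matrix (\<lambda>c. to_fract (\<phi> c)) (\<lambda>v. to_fract (x v)) f) (Suc r)" for D
  proof -
    obtain D' where D': "D = to_fract D'" "D' \<in> minors m n (jacobian_matrix \<phi> x f) (Suc r)"
      using D unfolding jacobian_to_fract minors_hom[OF to_fract_hom] by blast
    then show ?thesis using mat_rank_maximal[of D' m n "jacobian_matrix \<phi> x f"] r by simp
  qed
qed (use inj_\<rho> inj_\<gamma> perf in auto)

lemma fraction:
  obtains p q where "in_Pn n p" "in_Pn n q" "mp_eval \<phi> x q dvd 1" "a * mp_eval \<phi> x q = mp_eval \<phi> x p"
  using pres unfolding is_presentation_def by metis

lemma subring: "subring_of_field (range (to_fract :: 'a \<Rightarrow> 'a fract))"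
  by unfold_locales (auto simp flip: to_fract_add to_fract_mult to_fract_uminus to_fract_0 to_fract_1)

text \<open>The coefficients of the Taylor homomorphism in the direction of the parameter c,
  cleared of denominators.\<close>
lemma hasse_schmidt_ex:
  assumes c: "c \<in> F.params" and K: "K \<ge> 1"
  shows "\<exists>e U. hs_system \<phi> K U \<and> (\<forall>p k. k < K \<longrightarrow> in_vars F.params p \<longrightarrow> U k (mp_eval \<phi> x p) =
     d ^ (e * k) * fps_nth (mp_eval (\<lambda>c. fps_const (\<phi> c)) (\<lambda>v. fps_const (x v) + (if v = c then fps_X else 0)) p) k)"
proof -
  let ?A = "range (to_fract :: 'a \<Rightarrow> 'a fract)"
  let ?d = "to_fract d"
  interpret A: subring_of_field ?A by (rule subring)
  obtain \<xi> where \<xi>: "F.curve K {..<n} \<xi>"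
    and par: "\<forall>v\<in>F.params. \<xi> v = fps_const (to_fract (x v)) + (if v = c then fps_X else 0)"
    using F.curve_ex[OF c] by blast
  obtain C where C: "\<And>b b'. b < r \<Longrightarrow> b' < r \<Longrightarrow>
    (\<Sum>a<r. C b a * jacobian_matrix \<phi> x f (\<rho> a) (\<gamma> b')) = (if b = b' then d else 0)"
    using det_sq_left_inverse[of r "\<lambda>a b. jacobian_matrix \<phi> x f (\<rho> a) (\<gamma> b)"] unfolding d by blast
  have C': "(\<Sum>a<r. to_fract (C b a) * jacobian_matrix (\<lambda>c. to_fract (\<phi> c)) (\<lambda>v. to_fract (x v)) f (\<rho> a) (\<gamma> b')) =
     (if b = b' then ?d else 0)" if "b < r" "b' < r" for b b'
  proof -
    interpret comm_ring_hom "to_fract :: 'a \<Rightarrow> _" by (rule to_fract_hom)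
    show ?thesis using arg_cong[OF C[OF that], of to_fract]
      by (simp add: jacobian_to_fract hom_sum hom_mult if_distrib[of to_fract] cong: if_cong)
  qed
  obtain e where e: "\<forall>j<n. bounded_denom ?A ?d e K (\<xi> j)"
    using F.curve_bounded_denom[OF subring _ _ _ C' _ \<xi> par K order_refl] by blast
  have "\<forall>a. \<exists>p q. in_Pn n p \<and> in_Pn n q \<and> mp_eval \<phi> x q dvd 1 \<and> a * mp_eval \<phi> x q = mp_eval \<phi> x p"
    using pres unfolding is_presentation_def by blast
  then obtain p q where pq: "\<And>a. in_Pn n (p a)" "\<And>a. in_Pn n (q a)" "\<And>a. mp_eval \<phi> x (q a) dvd 1"
    "\<And>a. a * mp_eval \<phi> x (q a) = mp_eval \<phi> x (p a)"
    unfolding choice_iff by blast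
  have ev: "F.ev {..<n} P = to_fract (mp_eval \<phi> x P)" if "in_Pn n P" for P
    by (simp add: mp_eval_on_set_lessThan[OF that] mp_eval_to_fract)
  interpret ev: comm_ring_hom "F.ev {..<n}" by (rule F.ev_hom)
  interpret evf: comm_ring_hom "F.ev_fps \<xi>" by (rule F.ev_fps_hom)
  \<comment> \<open>The image of a = p/q under the curve. The representatives p and q are chosen
    without any coherence, so T is a homomorphism only modulo X^K.\<close>
  define T where "T = (\<lambda>a. F.ev_fps \<xi> (p a) * inverse (F.ev_fps \<xi> (q a)))"
  have q0: "fps_nth (F.ev_fps \<xi> (q a)) 0 = to_fract (mp_eval \<phi> x (q a))" for a
    using F.curve_nth_0[OF \<xi>] ev pq by simp
  have p0: "fps_nth (F.ev_fps \<xi> (p a)) 0 = to_fract (mp_eval \<phi> x (p a))" for a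
    using F.curve_nth_0[OF \<xi>] ev pq by simp
  have qn: "mp_eval \<phi> x (q a) \<noteq> 0" for a using pq(3)[of a] by auto
  have Tq: "T a * F.ev_fps \<xi> (q a) = F.ev_fps \<xi> (p a)" for a
    using inverse_mult_eq_1[of "F.ev_fps \<xi> (q a)"] q0[of a] qn[of a] by (simp add: T_def mult.assoc)
  have T0: "fps_nth (T a) 0 = to_fract a" for a
  proof -
    have "fps_nth (T a) 0 * to_fract (mp_eval \<phi> x (q a)) = to_fract a * to_fract (mp_eval \<phi> x (q a))"
      using arg_cong[OF Tq[of a], of "\<lambda>g. fps_nth g 0"] q0 p0 by (simp flip: pq(4) to_fract_mult)
    then show ?thesis using qn[of a] by simp
  qed
  \<comment> \<open>Modulo X^K the value of T does not depend on the fraction representing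
    \<open>a\<close>. Suitable P and Q yield compatibility with sums, products and scalars.\<close>
  have key: "vanish K (T a * F.ev_fps \<xi> Q - F.ev_fps \<xi> P)" if "to_fract a * F.ev {..<n} Q = F.ev {..<n} P" for a P Q
  proof -
    have "F.ev {..<n} (p a * Q - P * q a) =
        to_fract a * to_fract (mp_eval \<phi> x (q a)) * F.ev {..<n} Q - F.ev {..<n} P * to_fract (mp_eval \<phi> x (q a))"
      by (simp add: ev.hom_minus ev.hom_mult ev[OF pq(1)] ev[OF pq(2)] flip: pq(4) to_fract_mult)
    also have "\<dots> = 0" by (simp add: that[symmetric])
    finally have "vanish K (F.ev_fps \<xi> (p a * Q - P * q a))" using \<xi> by (simp add: F.curve_def)
    moreover have "F.ev_fps \<xi> (p a * Q - P * q a) = F.ev_fps \<xi> (q a) * (T a * F.ev_fps \<xi> Q - F.ev_fps \<xi> P)"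
      by (simp add: evf.hom_minus evf.hom_mult algebra_simps flip: Tq)
    ultimately have "vanish K (F.ev_fps \<xi> (q a) * (T a * F.ev_fps \<xi> Q - F.ev_fps \<xi> P))" by simp
    then show ?thesis by (rule vanish_cancel) (use q0 qn in simp)
  qed
  have Tadd: "vanish K (T (a + b) - (T a + T b))" for a b
  proof -
    have "vanish K (T (a + b) * F.ev_fps \<xi> (q a * q b) - F.ev_fps \<xi> (p a * q b + p b * q a))"
      by (rule key) (simp add: ev.hom_add ev.hom_mult ev[OF pq(1)] ev[OF pq(2)] algebra_simps flip: pq(4))
    also have "T (a + b) * F.ev_fps \<xi> (q a * q b) - F.ev_fps \<xi> (p a * q b + p b * q a) =
        F.ev_fps \<xi> (q a) * F.ev_fps \<xi> (q b) * (T (a + b) - (T a + T b))"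
      by (simp add: evf.hom_add evf.hom_mult algebra_simps flip: Tq)
    finally show ?thesis by (rule vanish_cancel) (simp add: q0 qn)
  qed
  have Tmult: "vanish K (T (a * b) - T a * T b)" for a b
  proof -
    have "vanish K (T (a * b) * F.ev_fps \<xi> (q a * q b) - F.ev_fps \<xi> (p a * p b))"
      by (rule key) (simp add: ev.hom_mult ev[OF pq(1)] ev[OF pq(2)] algebra_simps flip: pq(4))
    also have "T (a * b) * F.ev_fps \<xi> (q a * q b) - F.ev_fps \<xi> (p a * p b) =
        F.ev_fps \<xi> (q a) * F.ev_fps \<xi> (q b) * (T (a * b) - T a * T b)"
      by (simp add: evf.hom_mult algebra_simps flip: Tq)
    finally show ?thesis by (rule vanish_cancel) (simp add: q0 qn)
  qed
  have Teval: "vanish K (T (mp_eval \<phi> x P) - F.ev_fps \<xi> P)" if "in_Pn n P" for P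
    using key[of "mp_eval \<phi> x P" 1 P] ev[OF that] by simp
  have nth_diff: "fps_nth g k = fps_nth h k" if "vanish K (g - h)" "k < K" for g h :: "'a fract fps" and k
    using that by (simp add: vanish_def)
  have Tconst: "vanish K (T (\<phi> a) - fps_const (to_fract (\<phi> a)))" for a
  proof -
    have "in_Pn n (Poly_Mapping.single 0 a)" by (simp add: in_Pn_def)
    from Teval[OF this] show ?thesis
      by (simp add: mp_eval_single[OF k_alg] mp_eval_single[OF F.alg_fps])
  qed
  have bT: "bounded_denom ?A ?d e K (T a)" for a
    unfolding T_def
  proof (intro A.bd_mult A.bd_inverse)
    obtain z where "1 = mp_eval \<phi> x (q a) * z" using pq(3)[of a] by (auto simp: dvd_def)
    then have "to_fract (mp_eval \<phi> x (q a)) * to_fract z = 1"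
      by (metis to_fract_1 to_fract_mult)
    then have "inverse (to_fract (mp_eval \<phi> x (q a))) = to_fract z" by (rule inverse_unique)
    then show "inverse (fps_nth (F.ev_fps \<xi> (q a)) 0) \<in> ?A" unfolding q0 by simp
    show "fps_nth (F.ev_fps \<xi> (q a)) 0 \<noteq> 0" by (simp add: q0 qn)
  qed (auto intro!: A.bd_mp_eval pq e[rule_format])
  \<comment> \<open>The weights d^(e k) turn sums of indices into products, so the rescaled
    coefficients lie in A and still satisfy the Leibniz rule.\<close>
  define U where "U = (\<lambda>k a. inv_into UNIV to_fract (?d ^ (e * k) * fps_nth (T a) k))"
  have U: "to_fract (U k a) = ?d ^ (e * k) * fps_nth (T a) k" if "k < K" for k a
    unfolding U_def by (rule f_inv_into_f) (use bT[of a] that in \<open>simp add: bounded_denom_def\<close>)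
  have eqI: "a = b" if "to_fract a = to_fract b" for a b :: 'a using that by simp
  have "hs_system \<phi> K U"
    unfolding hs_system_def
  proof (intro conjI allI impI)
    fix a show "U 0 a = a" using U[of 0 a] K T0 by simp
  next
    fix k assume k: "k < K"
    show "klinear \<phi> (U k)"
      unfolding klinear_def
    proof (intro conjI allI; rule eqI)
      fix a b show "to_fract (U k (a + b)) = to_fract (U k a + U k b)"
        using nth_diff[OF Tadd k] by (simp add: U[OF k] algebra_simps)
    next
      fix a b
      have "fps_nth (T (\<phi> a * b)) k = fps_nth (T (\<phi> a) * T b) k" by (rule nth_diff[OF Tmult k])
      also have "\<dots> = fps_nth (fps_const (to_fract (\<phi> a)) * T b) k"
        by (rule nth_diff[OF _ k]) (metis Tconst left_diff_distrib vanish_mult)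
      finally show "to_fract (U k (\<phi> a * b)) = to_fract (\<phi> a * U k b)" by (simp add: U[OF k])
    qed
    fix a b
    show "U k (a * b) = (\<Sum>i\<le>k. U i a * U (k - i) b)"
    proof (rule eqI)
      interpret comm_ring_hom "to_fract :: 'a \<Rightarrow> _" by (rule to_fract_hom)
      have "to_fract (U k (a * b)) = ?d ^ (e * k) * fps_nth (T a * T b) k"
        using nth_diff[OF Tmult k] by (simp add: U[OF k])
      also have "\<dots> = (\<Sum>i\<le>k. to_fract (U i a) * to_fract (U (k - i) b))"
        unfolding fps_mult_nth sum_distrib_left atLeast0AtMost
      proof (rule sum.cong[OF refl])
        fix i assume i: "i \<in> {..k}"
        then have "e * k = e * i + e * (k - i)" by (simp flip: add_mult_distrib2)
        then have "?d ^ (e * k) = ?d ^ (e * i) * ?d ^ (e * (k - i))" by (simp flip: power_add)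
        then show "?d ^ (e * k) * (fps_nth (T a) i * fps_nth (T b) (k - i)) = to_fract (U i a) * to_fract (U (k - i) b)"
          using i k by (simp add: U)
      qed
      also have "\<dots> = to_fract (\<Sum>i\<le>k. U i a * U (k - i) b)" by (simp add: hom_sum)
      finally show "to_fract (U k (a * b)) = to_fract (\<Sum>i\<le>k. U i a * U (k - i) b)" .
    qed
  qed
  moreover have "U k (mp_eval \<phi> x P) = d ^ (e * k) * fps_nth (mp_eval (\<lambda>c. fps_const (\<phi> c))
      (\<lambda>v. fps_const (x v) + (if v = c then fps_X else 0)) P) k"
    if k: "k < K" and P: "in_vars F.params P" for P k
  proof (rule eqI)
    interpret comm_ring_hom "to_fract :: 'a \<Rightarrow> _" by (rule to_fract_hom)
    have P': "in_Pn n P" using P unfolding in_vars_lessThan[symmetric] in_vars_def F.params_def by blast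
    let ?h = "\<lambda>g. Abs_fps (\<lambda>i. to_fract (fps_nth g i)) :: 'a fract fps"
    let ?G = "mp_eval (\<lambda>c. fps_const (\<phi> c)) (\<lambda>v. fps_const (x v) + (if v = c then fps_X else 0)) P"
    have "?h (fps_const a) = fps_const (to_fract a)" for a by (rule fps_ext) simp
    moreover have "?h (fps_const a + (if b then fps_X else 0)) = fps_const (to_fract a) + (if b then fps_X else 0)" for a b
      by (rule fps_ext) (simp add: fps_X_def)
    ultimately have "?h ?G = F.ev_fps (\<lambda>v. fps_const (to_fract (x v)) + (if v = c then fps_X else 0)) P"
      unfolding mp_eval_hom[OF fps_map_hom[OF to_fract_hom]] by presburger
    also have "\<dots> = F.ev_fps \<xi> P" by (rule mp_eval_in_vars_cong[OF P]) (simp add: par)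
    finally have "?h ?G = F.ev_fps \<xi> P" .
    from arg_cong[OF this, of "\<lambda>g. fps_nth g k"] have "fps_nth (F.ev_fps \<xi> P) k = to_fract (fps_nth ?G k)" by simp
    then show "to_fract (U k (mp_eval \<phi> x P)) = to_fract (d ^ (e * k) * fps_nth ?G k)"
      using nth_diff[OF Teval[OF P'] k] by (simp add: U[OF k] hom_power)
  qed
  ultimately show ?thesis by blast
qed

end

section \<open>Rings of differential operators\<close>

lemma klinear_simps:
  assumes "klinear \<phi> u"
  shows "u (a + b) = u a + u b" "u (\<phi> c * a) = \<phi> c * u a" "u 0 = 0" "u (- a) = - u a" "u (a - b) = u a - u b"
proof -
  show add: "u (a + b) = u a + u b" "u (\<phi> c * a) = \<phi> c * u a" for a b c
    using assms by (auto simp: klinear_def)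
  show z: "u 0 = 0" using add(1)[of 0 0] by simp
  show m: "u (- a) = - u a" for a using add(1)[of a "- a"] z by (simp add: eq_neg_iff_add_eq_0 add.commute)
  show "u (a - b) = u a - u b" using add(1)[of a "- b"] m by simp
qed

lemma klinear_sum:
  assumes "klinear \<phi> u" shows "u (\<Sum>j\<in>I. g j) = (\<Sum>j\<in>I. u (g j))"
  by (induction I rule: infinite_finite_induct) (simp_all add: klinear_simps[OF assms])

lemma dop_klinear: "u \<in> dop \<phi> i \<Longrightarrow> klinear \<phi> u"
  by (cases i) auto

lemma dop_0_comm: "u \<in> dop \<phi> 0 \<Longrightarrow> r * u a - u (r * a) = 0"
  unfolding dop.simps by blast

lemma dop_0_iff: "u \<in> dop \<phi> 0 \<longleftrightarrow> (\<exists>c. u = mo (c :: 'a::comm_ring_1))"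
proof
  assume u: "u \<in> dop \<phi> 0"
  have "u a = u 1 * a" for a
    using dop_0_comm[OF u, of a 1] by (simp add: mult.commute)
  then have "u = mo (u 1)" unfolding mo_def by (rule ext)
  then show "\<exists>c. u = mo c" by blast
next
  assume "\<exists>c. u = mo c"
  then show "u \<in> dop \<phi> 0" by (auto simp: mo_def klinear_def algebra_simps)
qed

lemma dop_Suc_iff: "u \<in> dop \<phi> (Suc i) \<longleftrightarrow> klinear \<phi> u \<and> (\<forall>r. (\<lambda>a. r * u a - u (r * a)) \<in> dop \<phi> i)"
  by simp

declare dop.simps [simp del]

lemma mo_klinear: "klinear \<phi> (mo c)"
  by (simp add: mo_def klinear_def algebra_simps)

lemma mo_in_dop: "mo c \<in> dop \<phi> i"
proof (induction i arbitrary: c)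
  case 0
  show ?case using dop_0_iff by blast
next
  case (Suc i)
  have "(\<lambda>a. r * mo c a - mo c (r * a)) = mo 0" for r by (auto simp: mo_def algebra_simps)
  then show ?case unfolding dop_Suc_iff using Suc[of 0] mo_klinear by simp
qed

lemma zero_in_dop: "(\<lambda>a. 0) \<in> dop \<phi> i"
  using mo_in_dop[of 0 \<phi> i] by (simp add: mo_def)

lemma dop_Suc_mono: "u \<in> dop \<phi> i \<Longrightarrow> u \<in> dop \<phi> (Suc i)"
proof (induction i arbitrary: u)
  case 0
  then obtain c where "u = mo c" unfolding dop_0_iff by blast
  then show ?case using mo_in_dop by simp
next
  case (Suc i)
  then show ?case unfolding dop_Suc_iff by blast
qed

lemma dop_mono: "i \<le> j \<Longrightarrow> dop \<phi> i \<subseteq> dop \<phi> j"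
  by (induction rule: dec_induct) (auto intro: dop_Suc_mono)

lemma klinear_add: "klinear \<phi> u \<Longrightarrow> klinear \<phi> v \<Longrightarrow> klinear \<phi> (\<lambda>a. u a + v a)"
  by (simp add: klinear_def algebra_simps)

lemma klinear_lmult: "klinear \<phi> u \<Longrightarrow> klinear \<phi> (\<lambda>a. c * u a)"
  by (simp add: klinear_def algebra_simps)

lemma dop_add: "u \<in> dop \<phi> i \<Longrightarrow> v \<in> dop \<phi> i \<Longrightarrow> (\<lambda>a. u a + v a) \<in> dop \<phi> i"
proof (induction i arbitrary: u v)
  case 0
  then obtain c c' where "u = mo c" "v = mo c'" unfolding dop_0_iff by blast
  then have "(\<lambda>a. u a + v a) = mo (c + c')" by (auto simp: mo_def algebra_simps)
  then show ?case using mo_in_dop by simp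
next
  case (Suc i)
  have "(\<lambda>a. r * (u a + v a) - (u (r * a) + v (r * a))) \<in> dop \<phi> i" for r
  proof -
    have "(\<lambda>a. (r * u a - u (r * a)) + (r * v a - v (r * a))) \<in> dop \<phi> i"
      using Suc.prems unfolding dop_Suc_iff by (intro Suc.IH) blast+
    then show ?thesis by (simp add: algebra_simps)
  qed
  then show ?case using Suc.prems klinear_add unfolding dop_Suc_iff by blast
qed

lemma dop_lmult: "u \<in> dop \<phi> i \<Longrightarrow> (\<lambda>a. c * u a) \<in> dop \<phi> i"
proof (induction i arbitrary: u)
  case 0
  then obtain c' where "u = mo c'" unfolding dop_0_iff by blast
  then have "(\<lambda>a. c * u a) = mo (c * c')" by (auto simp: mo_def algebra_simps)
  then show ?case using mo_in_dop by simp
next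
  case (Suc i)
  have "(\<lambda>a. r * (c * u a) - c * u (r * a)) \<in> dop \<phi> i" for r
  proof -
    have "(\<lambda>a. c * (r * u a - u (r * a))) \<in> dop \<phi> i"
      using Suc.prems unfolding dop_Suc_iff by (intro Suc.IH) blast
    then show ?thesis by (simp add: right_diff_distrib mult.left_commute)
  qed
  then show ?case using Suc.prems klinear_lmult unfolding dop_Suc_iff by blast
qed

lemma dop_diff:
  assumes u: "u \<in> dop \<phi> i" and v: "v \<in> dop \<phi> i"
  shows "(\<lambda>a. u a - v a) \<in> dop \<phi> i"
proof -
  have "(\<lambda>a. u a - v a) = (\<lambda>a. u a + - 1 * v a)" by (intro ext) simp
  with dop_add[OF u dop_lmult[OF v, of "- 1"]] show ?thesis by (simp only:)
qed

lemma dop_sum: "(\<And>j. j \<in> I \<Longrightarrow> u j \<in> dop \<phi> i) \<Longrightarrow> (\<lambda>a. \<Sum>j\<in>I. u j a) \<in> dop \<phi> i"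
proof (induction I rule: infinite_finite_induct)
  case (insert j I)
  then have "(\<lambda>a. u j a + (\<Sum>j\<in>I. u j a)) \<in> dop \<phi> i" by (intro dop_add) auto
  then show ?case using insert by simp
qed (simp_all add: zero_in_dop)

text \<open>Induction on i + j with [r, u v] = [r, u] v + u [r, v]. Order 0 is separate: the
  filtration has no index -1, but there the commutators are 0.\<close>

lemma dop_comp: "u \<in> dop \<phi> i \<Longrightarrow> v \<in> dop \<phi> j \<Longrightarrow> u \<circ> v \<in> dop \<phi> (i + j)"
proof (induction "i + j" arbitrary: i j u v rule: less_induct)
  case less
  note u = less(2) and v = less(3)
  note klu = dop_klinear[OF u] and klv = dop_klinear[OF v]
  have kl: "klinear \<phi> (u \<circ> v)" using klu klv by (simp add: klinear_def)
  have comm: "(\<lambda>a. r * (u \<circ> v) a - (u \<circ> v) (r * a)) =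
     (\<lambda>a. ((\<lambda>a. r * u a - u (r * a)) \<circ> v) a + (u \<circ> (\<lambda>a. r * v a - v (r * a))) a)" for r
    by (simp add: fun_eq_iff klinear_simps(5)[OF klu])
  have 1: "((\<lambda>a. r * u a - u (r * a)) \<circ> v) \<in> dop \<phi> (i + j - 1)" for r
  proof (cases i)
    case 0
    then have "((\<lambda>a. r * u a - u (r * a)) \<circ> v) = (\<lambda>a. 0)" using dop_0_comm[of u \<phi>] u by (simp add: fun_eq_iff)
    then show ?thesis using zero_in_dop by simp
  next
    case (Suc i')
    then have "(\<lambda>a. r * u a - u (r * a)) \<in> dop \<phi> i'" using u unfolding Suc dop_Suc_iff by blast
    from less(1)[of i' j, OF _ this v] show ?thesis using Suc by simp
  qed
  have 2: "u \<circ> (\<lambda>a. r * v a - v (r * a)) \<in> dop \<phi> (i + j - 1)" for r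
  proof (cases j)
    case 0
    then have "u \<circ> (\<lambda>a. r * v a - v (r * a)) = (\<lambda>a. 0)"
      using dop_0_comm[of v \<phi>] v klinear_simps(3)[OF klu] by (simp add: fun_eq_iff)
    then show ?thesis using zero_in_dop by simp
  next
    case (Suc j')
    then have "(\<lambda>a. r * v a - v (r * a)) \<in> dop \<phi> j'" using v unfolding Suc dop_Suc_iff by blast
    from less(1)[of i j', OF _ u this] show ?thesis using Suc by simp
  qed
  show ?case
  proof (cases "i + j")
    case 0
    then obtain c c' where "u = mo c" "v = mo c'" using u v by (auto simp: dop_0_iff)
    then have "u \<circ> v = mo (c * c')" by (auto simp: mo_def)
    then show ?thesis using mo_in_dop by simp
  next
    case (Suc k)
    have "(\<lambda>a. r * (u \<circ> v) a - (u \<circ> v) (r * a)) \<in> dop \<phi> k" for r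
      unfolding comm using dop_add[OF 1 2, of r r] Suc by simp
    then show ?thesis unfolding Suc dop_Suc_iff using kl by blast
  qed
qed

text \<open>By the Leibniz rule the commutator of \<open>U k\<close> with r is a combination of
  \<open>U 0\<close>, ..., \<open>U (k - 1)\<close> with coefficients in A, hence of smaller order;
  for \<open>k = 0\<close> the operator is the identity.\<close>

lemma hs_system_dop:
  assumes U: "hs_system \<phi> K U" and "k < K"
  shows "U k \<in> dop \<phi> k"
  using \<open>k < K\<close>
proof (induction k rule: less_induct)
  case (less k)
  have kl: "klinear \<phi> (U k)" and leib: "\<And>a b. U k (a * b) = (\<Sum>i\<le>k. U i a * U (k - i) b)"
    and U0: "\<And>a. U 0 a = a"
    using U less(2) by (auto simp: hs_system_def)
  show ?case
  proof (cases k)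
    case 0
    have "U k = mo 1" using 0 U0 by (simp add: mo_def fun_eq_iff)
    then show ?thesis using mo_in_dop by simp
  next
    case (Suc l)
    have "(\<lambda>a. r * U k a - U k (r * a)) \<in> dop \<phi> l" for r
    proof -
      have "r * U k a - U k (r * a) = (\<Sum>i\<le>l. (- U (Suc i) r) * U (l - i) a)" for a
        unfolding Suc leib[unfolded Suc] by (simp add: sum.atMost_Suc_shift U0 sum_negf del: sum.atMost_Suc)
      moreover have "(\<lambda>a. \<Sum>i\<le>l. (- U (Suc i) r) * U (l - i) a) \<in> dop \<phi> l"
      proof (intro dop_sum dop_lmult)
        fix i assume "i \<in> {..l}"
        have "U (l - i) \<in> dop \<phi> (l - i)" using less Suc by auto
        then show "U (l - i) \<in> dop \<phi> l" using dop_mono[of "l - i" l] by auto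
      qed
      ultimately show ?thesis by simp
    qed
    then show ?thesis using kl unfolding Suc dop_Suc_iff by blast
  qed
qed

text \<open>Used both for R and for \<open>Dall \<phi>\<close> itself, so that the ideal theory is
  developed only once.\<close>

locale diffop_ring =
  fixes \<phi> :: "'k \<Rightarrow> 'a::idom" and R :: "('a \<Rightarrow> 'a) set"
  assumes R_sub: "R \<subseteq> Dall \<phi>" and R_mo: "mo c \<in> R"
    and R_add: "u \<in> R \<Longrightarrow> v \<in> R \<Longrightarrow> (\<lambda>a. u a + v a) \<in> R"
    and R_comp: "u \<in> R \<Longrightarrow> v \<in> R \<Longrightarrow> u \<circ> v \<in> R"
begin

lemma R_klinear: "u \<in> R \<Longrightarrow> klinear \<phi> u"
  using R_sub dop_klinear by (auto simp: Dall_def)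

lemma R_id: "id \<in> R"
  using R_mo[of 1] by (simp add: mo_def id_def)

lemma ideal_sum:
  assumes "two_sided_ideal R J"
  shows "(\<And>j. j < N \<Longrightarrow> w j \<in> J) \<Longrightarrow> (\<lambda>a. \<Sum>j<(N::nat). w j a) \<in> J"
proof (induction N)
  case 0
  then show ?case using assms by (simp add: two_sided_ideal_def)
next
  case (Suc N)
  then have "(\<lambda>a. \<Sum>j<N. w j a) \<in> J" "w N \<in> J" by simp_all
  then show ?case using assms by (simp add: two_sided_ideal_def)
qed

lemma ideal_comp:
  assumes "two_sided_ideal R J" "y \<in> J" "u \<in> R"
  shows "u \<circ> y \<in> J" "y \<circ> u \<in> J"
  using assms by (auto simp: two_sided_ideal_def)

lemma ideal_diff:
  "two_sided_ideal R J \<Longrightarrow> w \<in> J \<Longrightarrow> w' \<in> J \<Longrightarrow> (\<lambda>a. w a - w' a) \<in> J"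
  by (auto simp: two_sided_ideal_def)

lemma tsid_subset:
  assumes J: "two_sided_ideal R J" and X: "X \<subseteq> J"
  shows "tsid R X \<subseteq> J"
proof
  fix w assume "w \<in> tsid R X"
  then obtain N u y v where w: "w = (\<lambda>a. \<Sum>j<(N::nat). u j (y j (v j a)))"
    and uyv: "\<forall>j<N. u j \<in> R \<and> y j \<in> X \<and> v j \<in> R" by (auto simp: tsid_def)
  have "(\<lambda>a. \<Sum>j<N. (u j \<circ> (y j \<circ> v j)) a) \<in> J"
  proof (rule ideal_sum[OF J])
    fix j assume j: "j < N"
    have "y j \<circ> v j \<in> J" by (rule ideal_comp(2)[OF J]) (use uyv X j in auto)
    then show "u j \<circ> (y j \<circ> v j) \<in> J" by (rule ideal_comp(1)[OF J]) (use uyv j in auto)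
  qed
  then show "w \<in> J" by (simp add: w)
qed

lemma ideal_eq_ring: "two_sided_ideal R J \<Longrightarrow> id \<in> J \<Longrightarrow> J = R"
  using ideal_comp(1)[of J id] by (auto simp: two_sided_ideal_def)

lemma tsidI:
  assumes "w = (\<lambda>a. \<Sum>j<(N::nat). u j (y j (v j a)))" "\<forall>j<N. u j \<in> R \<and> y j \<in> X \<and> v j \<in> R"
  shows "w \<in> tsid R X"
  unfolding tsid_def using assms
  by (intro CollectI exI[of _ N] exI[of _ u] exI[of _ y] exI[of _ v]) simp

lemma tsid_ideal:
  assumes X: "X \<subseteq> R"
  shows "two_sided_ideal R (tsid R X)"
proof -
  have R0: "(\<lambda>a. 0) \<in> R" using R_mo[of 0] by (simp add: mo_def)
  have Rsum: "(\<lambda>a. \<Sum>j<(N::nat). w j a) \<in> R" if "\<forall>j<N. w j \<in> R" for N w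
    using that by (induction N) (auto intro: R0 R_add)
  have sub: "tsid R X \<subseteq> R"
  proof
    fix w assume "w \<in> tsid R X"
    then obtain N u y v where w: "w = (\<lambda>a. \<Sum>j<(N::nat). u j (y j (v j a)))"
      and uyv: "\<forall>j<N. u j \<in> R \<and> y j \<in> X \<and> v j \<in> R" by (auto simp: tsid_def)
    have "(\<lambda>a. \<Sum>j<N. (u j \<circ> (y j \<circ> v j)) a) \<in> R"
    proof (rule Rsum, intro allI impI R_comp)
      fix j assume "j < N"
      then show "u j \<in> R" "y j \<in> R" "v j \<in> R" using uyv X by auto
    qed
    then show "w \<in> R" by (simp add: w)
  qed
  have zero: "(\<lambda>a. 0) \<in> tsid R X"
    unfolding tsid_def by (rule CollectI, rule exI[of _ 0]) auto
  have add: "(\<lambda>a. w a + w' a) \<in> tsid R X" if ww: "w \<in> tsid R X" "w' \<in> tsid R X" for w w'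
  proof -
    obtain N u y v where w: "w = (\<lambda>a. \<Sum>j<(N::nat). u j (y j (v j a)))"
      and uyv: "\<forall>j<N. u j \<in> R \<and> y j \<in> X \<and> v j \<in> R" using ww(1) by (auto simp: tsid_def)
    obtain N' u' y' v' where w': "w' = (\<lambda>a. \<Sum>j<(N'::nat). u' j (y' j (v' j a)))"
      and uyv': "\<forall>j<N'. u' j \<in> R \<and> y' j \<in> X \<and> v' j \<in> R" using ww(2) by (auto simp: tsid_def)
    let ?c = "\<lambda>g g' j. if j < N then g j else g' (j - N)"
    have "(\<Sum>j<N + N'. ?c u u' j (?c y y' j (?c v v' j a))) = w a + w' a" for a
    proof -
      have split: "(\<Sum>j<N + N'. h j) = (\<Sum>j<N. h j) + (\<Sum>j<N'. h (N + j))" for h :: "nat \<Rightarrow> 'a"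
        by (induction N') (simp_all add: add.assoc)
      show ?thesis unfolding split w w' by simp
    qed
    moreover have "\<forall>j<N + N'. ?c u u' j \<in> R \<and> ?c y y' j \<in> X \<and> ?c v v' j \<in> R"
      using uyv uyv' by auto
    ultimately show ?thesis
      by (intro tsidI[where N = "N + N'" and u = "?c u u'" and y = "?c y y'" and v = "?c v v'"]) simp_all
  qed
  have lcomp: "\<rho> \<circ> w \<in> tsid R X" and rcomp: "w \<circ> \<rho> \<in> tsid R X" if ww: "w \<in> tsid R X" "\<rho> \<in> R" for w \<rho>
  proof -
    obtain N u y v where w: "w = (\<lambda>a. \<Sum>j<(N::nat). u j (y j (v j a)))"
      and uyv: "\<forall>j<N. u j \<in> R \<and> y j \<in> X \<and> v j \<in> R" using ww(1) by (auto simp: tsid_def)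
    have "\<rho> \<circ> w = (\<lambda>a. \<Sum>j<N. (\<rho> \<circ> u j) (y j (v j a)))"
      by (simp add: w fun_eq_iff klinear_sum[OF R_klinear[OF ww(2)]])
    moreover have "\<forall>j<N. \<rho> \<circ> u j \<in> R \<and> y j \<in> X \<and> v j \<in> R" using uyv ww(2) R_comp by auto
    ultimately show "\<rho> \<circ> w \<in> tsid R X" by (rule tsidI)
    have "w \<circ> \<rho> = (\<lambda>a. \<Sum>j<N. u j (y j ((v j \<circ> \<rho>) a)))"
      by (simp add: w fun_eq_iff)
    moreover have "\<forall>j<N. u j \<in> R \<and> y j \<in> X \<and> v j \<circ> \<rho> \<in> R" using uyv ww(2) R_comp by auto
    ultimately show "w \<circ> \<rho> \<in> tsid R X" by (rule tsidI)
  qed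
  have diff: "(\<lambda>a. w a - w' a) \<in> tsid R X" if ww: "w \<in> tsid R X" "w' \<in> tsid R X" for w w'
    using add[OF ww(1) lcomp[OF ww(2) R_mo[of "- 1"]]] by (simp add: mo_def)
  show ?thesis unfolding two_sided_ideal_def by (intro conjI ballI sub zero add diff lcomp rcomp)
qed

lemma tsid_superset: "X \<subseteq> tsid R X"
proof
  fix y assume "y \<in> X"
  then show "y \<in> tsid R X"
    using R_id by (intro tsidI[where N = "Suc 0" and u = "\<lambda>_. id" and y = "\<lambda>_. y" and v = "\<lambda>_. id"]) simp_all
qed

lemma simple_tsid:
  assumes s: "simple_ring R" and X: "X \<subseteq> R" and y: "y \<in> X" "y \<noteq> (\<lambda>a. 0)"
  shows "tsid R X = R"
proof -
  have "tsid R X = {\<lambda>a. 0} \<or> tsid R X = R"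
    using s tsid_ideal[OF X] unfolding simple_ring_def by simp
  moreover have "y \<in> tsid R X" using tsid_superset y(1) by (rule subsetD)
  ultimately show ?thesis using y(2) by auto
qed

lemma ideal_meets_base:
  assumes J: "two_sided_ideal R J" and u: "u \<in> J" "u \<noteq> (\<lambda>a. 0)"
  shows "\<exists>c. c \<noteq> 0 \<and> mo c \<in> J"
proof -
  have "u \<in> R" using J u by (auto simp: two_sided_ideal_def)
  then obtain i where "u \<in> dop \<phi> i" using R_sub by (auto simp: Dall_def)
  then show ?thesis using u
  proof (induction i arbitrary: u)
    case 0
    then obtain c where "u = mo c" using dop_0_iff by blast
    with 0 show ?case by (intro exI[of _ c]) (auto simp: mo_def)
  next
    case (Suc i)
    show ?case
    proof (cases "\<forall>r. (\<lambda>a. r * u a - u (r * a)) = (\<lambda>a. 0)")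
      case True
      then have "u \<in> dop \<phi> 0" using dop_klinear[OF Suc(2)] by (auto simp: fun_eq_iff dop.simps)
      then obtain c where "u = mo c" using dop_0_iff by blast
      with Suc show ?thesis by (intro exI[of _ c]) (auto simp: mo_def)
    next
      case False
      then obtain r where r: "(\<lambda>a. r * u a - u (r * a)) \<noteq> (\<lambda>a. 0)" by blast
      have "mo r \<circ> u \<in> J" "u \<circ> mo r \<in> J" using ideal_comp[OF J Suc(3) R_mo] by auto
      then have "(\<lambda>a. (mo r \<circ> u) a - (u \<circ> mo r) a) \<in> J" by (rule ideal_diff[OF J])
      then have "(\<lambda>a. r * u a - u (r * a)) \<in> J" by (simp add: mo_def)
      moreover have "(\<lambda>a. r * u a - u (r * a)) \<in> dop \<phi> i" using Suc(2) unfolding dop_Suc_iff by blast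
      ultimately show ?thesis using Suc.IH r by blast
    qed
  qed
qed

lemma simple_ringI:
  assumes "\<And>J c. two_sided_ideal R J \<Longrightarrow> c \<noteq> 0 \<Longrightarrow> mo c \<in> J \<Longrightarrow> id \<in> J"
  shows "simple_ring R"
  unfolding simple_ring_def
proof (intro conjI allI impI)
  show "\<exists>u\<in>R. u \<noteq> (\<lambda>a. 0)"
    by (rule bexI[OF _ R_id]) (metis id_apply zero_neq_one)
  fix J assume J: "two_sided_ideal R J"
  show "J = {\<lambda>a. 0} \<or> J = R"
  proof (cases "J \<subseteq> {\<lambda>a. 0}")
    case True
    then show ?thesis using J by (auto simp: two_sided_ideal_def)
  next
    case False
    then obtain u where "u \<in> J" "u \<noteq> (\<lambda>a. 0)" by blast
    from ideal_meets_base[OF J this] show ?thesis using assms[OF J] ideal_eq_ring[OF J] by blast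
  qed
qed

end

lemma Dall_diffop_ring: "diffop_ring \<phi> (Dall (\<phi> :: 'k \<Rightarrow> 'a::idom))"
proof unfold_locales
  fix u v assume "u \<in> Dall \<phi>" "v \<in> Dall \<phi>"
  then obtain i j where ij: "u \<in> dop \<phi> i" "v \<in> dop \<phi> j" by (auto simp: Dall_def)
  then show "u \<circ> v \<in> Dall \<phi>" using dop_comp unfolding Dall_def by blast
  have "u \<in> dop \<phi> (max i j)" "v \<in> dop \<phi> (max i j)"
    using ij dop_mono[of i "max i j" \<phi>] dop_mono[of j "max i j" \<phi>] by auto
  then show "(\<lambda>a. u a + v a) \<in> Dall \<phi>" using dop_add unfolding Dall_def by blast
qed (use mo_in_dop in \<open>auto simp: Dall_def\<close>)

text \<open>In F(a + X) the terms of degree below k do not reach X^k, which leaves the coefficient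
  of degree k. Unlike for the k-th derivative, no factor k! appears.\<close>

lemma nth_poly_shift:
  fixes F :: "'a::comm_ring_1 poly"
  assumes "degree F \<le> k"
  shows "fps_nth (poly (map_poly fps_const F) (fps_const a + fps_X)) k = coeff F k"
  using assms
proof (induction F arbitrary: k)
  case 0
  then show ?case by simp
next
  case (pCons c F)
  interpret fps_const: comm_ring_hom "fps_const :: 'a \<Rightarrow> 'a fps" by unfold_locales auto
  let ?G = "poly (map_poly fps_const F) (fps_const a + fps_X)"
  have e: "poly (map_poly fps_const (pCons c F)) (fps_const a + fps_X) = fps_const c + fps_const a * ?G + fps_X * ?G"
    unfolding fps_const.map_poly_pCons_hom by (simp add: algebra_simps)
  show ?case
  proof (cases k)
    case 0
    then have F: "F = 0" using pCons.prems by (auto simp: degree_pCons_eq_if split: if_splits)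
    show ?thesis unfolding e 0 unfolding F by simp
  next
    case (Suc j)
    then have d: "degree F \<le> j" using pCons.prems by (auto simp: degree_pCons_eq_if split: if_splits)
    then have "coeff F (Suc j) = 0" by (simp add: coeff_eq_0)
    then show ?thesis using pCons.IH[of j] pCons.IH[of "Suc j"] d Suc by (simp add: e)
  qed
qed

section \<open>Ideals stable under Hasse-Schmidt derivations\<close>

context affine_minor
begin

lemma params_finite: "finite F.params"
  by (simp add: F.params_def)

text \<open>A nonzero polynomial in the parameters is reduced to a nonzero constant, up to powers of d, by
  taking the leading coefficient in one parameter after the other.\<close>
lemma stable_ideal_params:
  assumes mult: "\<And>a c. a \<in> J \<Longrightarrow> c * a \<in> J" and sat: "\<And>k a. d ^ k * a \<in> J \<Longrightarrow> a \<in> J"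
    and stable: "\<And>K U k a. hs_system \<phi> K U \<Longrightarrow> k < K \<Longrightarrow> a \<in> J \<Longrightarrow> U k a \<in> J"
    and V: "finite V" "V \<subseteq> F.params"
    and p: "in_vars V p" "mp_eval \<phi> x p \<in> J" "mp_eval \<phi> x p \<noteq> 0"
  shows "1 \<in> J"
  using V p
proof (induction V arbitrary: p rule: finite_induct)
  case empty
  have "Poly_Mapping.keys p \<subseteq> {0}"
    using empty(2) by (auto simp: in_vars_def)
  then have e: "mp_eval \<phi> x p = \<phi> (Poly_Mapping.lookup p 0)"
    by (subst mp_eval_superset[OF k_alg, of "{0}"]) auto
  let ?c = "Poly_Mapping.lookup p 0"
  have "?c \<noteq> 0" using e empty(4) k_algebra_map_simps(1)[OF k_alg] by auto
  then have "\<phi> (inverse ?c) * \<phi> ?c = 1"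
    by (simp add: k_algebra_map_simps(2)[OF k_alg] flip: k_algebra_map_simps(4)[OF k_alg])
  then show ?case using mult[OF empty(3), of "\<phi> (inverse ?c)"] e by simp
next
  case (insert c V)
  let ?P = "as_univariate c p"
  define H where "H = map_poly (mp_eval \<phi> x) ?P"
  interpret comm_ring_hom "mp_eval \<phi> x" by (rule mp_eval_ring_hom[OF k_alg])
  have "poly H (x c) = mp_eval \<phi> x p"
    unfolding H_def using mp_eval_as_univariate[OF k_alg, of x c "x c" p] by simp
  then have H0: "H \<noteq> 0" using insert.prems by auto
  \<comment> \<open>The degree in the parameter \<open>c\<close> dictates the length of the system:
    only its member of order k is applied, and it extracts the leading coefficient of H.\<close>
  define k where "k = degree H"
  obtain e U where U: "hs_system \<phi> (Suc k) U" and Uev: "\<And>p l. l < Suc k \<Longrightarrow> in_vars F.params p \<Longrightarrow> U l (mp_eval \<phi> x p) =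
     d ^ (e * l) * fps_nth (mp_eval (\<lambda>c. fps_const (\<phi> c)) (\<lambda>v. fps_const (x v) + (if v = c then fps_X else 0)) p) l"
    using hasse_schmidt_ex[of c "Suc k"] insert.prems(1) by auto
  have kf: "k_algebra_map (\<lambda>c. fps_const (\<phi> c))"
    unfolding k_algebra_map_def using k_algebra_map_simps[OF k_alg] by simp
  have hc: "comm_ring_hom (fps_const :: 'a \<Rightarrow> _)" by unfold_locales auto
  have "(\<lambda>v. fps_const (x v) + (if v = c then fps_X else 0)) = (\<lambda>v. fps_const (x v))(c := fps_const (x c) + fps_X)"
    by auto
  then have "mp_eval (\<lambda>c. fps_const (\<phi> c)) (\<lambda>v. fps_const (x v) + (if v = c then fps_X else 0)) p =
     poly (map_poly (mp_eval (\<lambda>c. fps_const (\<phi> c)) (\<lambda>v. fps_const (x v))) ?P) (fps_const (x c) + fps_X)"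
    by (simp add: mp_eval_as_univariate[OF kf])
  also have "mp_eval (\<lambda>c. fps_const (\<phi> c)) (\<lambda>v. fps_const (x v)) = (\<lambda>q. fps_const (mp_eval \<phi> x q))"
    using mp_eval_hom[OF hc, of \<phi> x] by auto
  also have "map_poly (\<lambda>q. fps_const (mp_eval \<phi> x q)) ?P = map_poly fps_const H"
    unfolding H_def by (simp add: map_poly_map_poly o_def)
  finally have ev: "mp_eval (\<lambda>c. fps_const (\<phi> c)) (\<lambda>v. fps_const (x v) + (if v = c then fps_X else 0)) p =
     poly (map_poly fps_const H) (fps_const (x c) + fps_X)" .
  have p': "in_vars F.params p" using insert.prems(1,2) by (auto simp: in_vars_def)
  have "U k (mp_eval \<phi> x p) = d ^ (e * k) * coeff H k"
    using Uev[OF _ p', of k] nth_poly_shift[of H k "x c"] by (simp add: ev k_def)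
  moreover have "U k (mp_eval \<phi> x p) \<in> J" using stable[OF U _ insert.prems(3)] by simp
  ultimately have J: "coeff H k \<in> J" using sat by metis
  have cH: "coeff H k = mp_eval \<phi> x (coeff ?P k)" by (simp add: H_def)
  have "coeff H k \<noteq> 0" using H0 by (simp add: k_def)
  moreover have "in_vars V (coeff ?P k)"
    unfolding in_vars_def
  proof
    fix w assume w: "w \<in> Poly_Mapping.keys (coeff ?P k)"
    have "coeff ?P k = (\<Sum>u\<in>Poly_Mapping.keys p. if Poly_Mapping.lookup u c = k then
       Poly_Mapping.single (u - Poly_Mapping.single c (Poly_Mapping.lookup u c)) (Poly_Mapping.lookup p u) else 0)"
      by (simp add: as_univariate_def coeff_sum)
    with w obtain u where u: "u \<in> Poly_Mapping.keys p" "w = u - Poly_Mapping.single c (Poly_Mapping.lookup u c)"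
      by (auto dest!: subsetD[OF keys_sum] split: if_splits)
    have "v \<in> V" if v: "v \<in> Poly_Mapping.keys w" for v
    proof -
      have l: "Poly_Mapping.lookup w v = (if v = c then 0 else Poly_Mapping.lookup u v)"
        unfolding u(2) by (auto simp: lookup_minus lookup_single when_def)
      have "Poly_Mapping.lookup w v \<noteq> 0" using v by (simp only: in_keys_iff not_False_eq_True)
      then have "v \<noteq> c" "v \<in> Poly_Mapping.keys u" unfolding l in_keys_iff by (auto split: if_splits)
      then show ?thesis using u(1) insert.prems(2) by (auto simp: in_vars_def)
    qed
    then show "Poly_Mapping.keys w \<subseteq> V" by blast
  qed
  ultimately show ?case using insert.IH[of "coeff ?P k"] insert.prems(1) J cH by simp
qed

text \<open>Clearing the denominator of b gives a nonzero polynomial in the coordinates. As Frac A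
  is algebraic over the parameters, the ideal also contains a nonzero polynomial in the parameters
  alone.\<close>

lemma stable_ideal_trivial:
  assumes mult: "\<And>a c. a \<in> J \<Longrightarrow> c * a \<in> J" and sat: "\<And>k a. d ^ k * a \<in> J \<Longrightarrow> a \<in> J"
    and stable: "\<And>K U k a. hs_system \<phi> K U \<Longrightarrow> k < K \<Longrightarrow> a \<in> J \<Longrightarrow> U k a \<in> J"
    and b: "b \<in> J" "b \<noteq> 0"
  shows "1 \<in> J"
proof -
  obtain p q where pq: "in_Pn n p" "mp_eval \<phi> x q dvd 1" "b * mp_eval \<phi> x q = mp_eval \<phi> x p"
    by (rule fraction[of b])
  have "mp_eval \<phi> x q \<noteq> 0" using pq(2) by auto
  then have p: "mp_eval \<phi> x p \<in> J" "mp_eval \<phi> x p \<noteq> 0"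
    using mult[OF b(1), of "mp_eval \<phi> x q"] b(2) by (simp_all add: mult.commute flip: pq(3))
  \<comment> \<open>The descent takes place in the fraction field, so the ideal is replaced by its
    image there.\<close>
  have "\<exists>p. in_vars F.params p \<and> mp_eval (\<lambda>c. to_fract (\<phi> c)) (\<lambda>v. to_fract (x v)) p \<in> to_fract ` J \<and>
     mp_eval (\<lambda>c. to_fract (\<phi> c)) (\<lambda>v. to_fract (x v)) p \<noteq> 0"
    by (rule F.descent_params[of "to_fract ` J" p])
       (use p pq(1) mult in \<open>auto simp: mp_eval_to_fract simp flip: to_fract_mult\<close>)
  then obtain p where p: "in_vars F.params p" "mp_eval \<phi> x p \<in> J" "mp_eval \<phi> x p \<noteq> 0"
    by (auto simp: mp_eval_to_fract)
  show ?thesis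
  proof (rule stable_ideal_params[of J F.params p])
    show "c * a \<in> J" if "a \<in> J" for a c by (rule mult[OF that])
    show "a \<in> J" if "d ^ k * a \<in> J" for k a by (rule sat[OF that])
    show "U k a \<in> J" if "hs_system \<phi> K U" "k < K" "a \<in> J" for K U k a by (rule stable[OF that])
  qed (use p params_finite in simp_all)
qed

text \<open>The elements of A that some power of d multiplies into J form a d-saturated ideal. It is
  stable under Hasse-Schmidt derivations, because their members are operators in D(A), and therefore
  contains 1.\<close>

lemma minor_power_in_ideal:
  assumes J: "two_sided_ideal (Dall \<phi>) J" and b: "mo b \<in> J" "b \<noteq> 0"
  shows "\<exists>N. mo (d ^ N) \<in> J"
proof -
  interpret D: diffop_ring \<phi> "Dall \<phi>" by (rule Dall_diffop_ring)
  have mo_mult: "mo (c * a) \<in> J" if "mo a \<in> J" for a c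
  proof -
    have "mo c \<circ> mo a \<in> J" by (rule D.ideal_comp(1)[OF J that D.R_mo])
    then show ?thesis by (simp add: mo_def o_def mult.assoc)
  qed
  have mo_add: "mo (a + a') \<in> J" if "mo a \<in> J" "mo a' \<in> J" for a a'
    using J that unfolding two_sided_ideal_def by (simp add: mo_def algebra_simps)
  have mo_diff: "mo (a - a') \<in> J" if "mo a \<in> J" "mo a' \<in> J" for a a'
    using J that unfolding two_sided_ideal_def by (simp add: mo_def algebra_simps)
  have hs: "mo (U k a) \<in> J" if U: "hs_system \<phi> K U" and "k < K" and a: "mo a \<in> J" for K U k a
    using \<open>k < K\<close>
  proof (induction k rule: less_induct)
    case (less k)
    have Uk: "U i \<in> Dall \<phi>" if "i < K" for i using hs_system_dop[OF U that] by (auto simp: Dall_def)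
    have leib: "U k (a * y) = (\<Sum>i\<le>k. U i a * U (k - i) y)" and U0: "U 0 y = y" for y
      using U less.prems by (auto simp: hs_system_def)
    have "U k (a * y) = (\<Sum>i<k. U i a * U (k - i) y) + U k a * y" for y
      unfolding leib by (simp add: U0 flip: lessThan_Suc_atMost)
    \<comment> \<open>As operators, U_k a is the sum of all U_i(a) U_(k-i) with i \<le> k. Solved
      for the term i = k this puts U_k(a) in J: the left side lies in J, and the other terms do by
      induction.\<close>
    then have e: "mo (U k a) = (\<lambda>y. (U k \<circ> mo a) y - (\<Sum>i<k. (mo (U i a) \<circ> U (k - i)) y))"
      by (auto simp: mo_def fun_eq_iff)
    have 1: "U k \<circ> mo a \<in> J" using D.ideal_comp(1)[OF J a Uk[OF less.prems]] .
    have 2: "(\<lambda>y. \<Sum>i<k. (mo (U i a) \<circ> U (k - i)) y) \<in> J"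
      by (rule D.ideal_sum[OF J], rule D.ideal_comp(2)[OF J]) (use less Uk in auto)
    show ?case unfolding e by (rule D.ideal_diff[OF J 1 2])
  qed
  let ?I = "{a. \<exists>N. mo (d ^ N * a) \<in> J}"
  have zero: "mo 0 \<in> J" using J by (simp add: two_sided_ideal_def mo_def)
  have sum: "mo (\<Sum>i\<in>I. g i) \<in> J" if "\<And>i. i \<in> I \<Longrightarrow> mo (g i) \<in> J" for I :: "nat set" and g
    using that by (induction I rule: infinite_finite_induct) (auto intro: zero mo_add)
  have "1 \<in> ?I"
  proof (rule stable_ideal_trivial)
    show "c * a \<in> ?I" if a: "a \<in> ?I" for a c
    proof -
      obtain N where "mo (d ^ N * a) \<in> J" using a by blast
      then have "mo (c * (d ^ N * a)) \<in> J" by (rule mo_mult)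
      also have "c * (d ^ N * a) = d ^ N * (c * a)" by (rule mult.left_commute)
      finally show ?thesis by blast
    qed
    show "a \<in> ?I" if da: "d ^ k * a \<in> ?I" for k a
    proof -
      obtain N where "mo (d ^ N * (d ^ k * a)) \<in> J" using da by blast
      then have "mo (d ^ (N + k) * a) \<in> J" by (simp add: power_add mult.assoc)
      then show ?thesis by blast
    qed
    show "b \<in> ?I" using b(1) by (intro CollectI exI[of _ 0]) simp
    show "U k a \<in> ?I" if U: "hs_system \<phi> K U" and k: "k < K" and a: "a \<in> ?I" for K U k a
    proof -
      obtain N where N: "mo (d ^ N * a) \<in> J" using a by blast
      show ?thesis using k
      proof (induction k rule: less_induct)
        case (less k)
        have leib: "U k (d ^ N * a) = (\<Sum>i\<le>k. U i (d ^ N) * U (k - i) a)" and U0: "U 0 y = y" for y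
          using U less.prems by (auto simp: hs_system_def)
        have "\<forall>i\<in>{..<k}. \<exists>M. mo (d ^ M * U i a) \<in> J" using less by auto
        from bchoice[OF this] obtain M where M: "mo (d ^ M i * U i a) \<in> J" if "i < k" for i by blast
        \<comment> \<open>U_k(d^N a) consists of d^N U_k(a) and of multiples of U_i(a) with i < k,
          each requiring its own power of d; the sum L of the exponents serves them all.\<close>
        define L where "L = (\<Sum>i<k. M i)"
        have Mle: "M i \<le> L" if "i < k" for i unfolding L_def using that by (intro member_le_sum) auto
        have "mo (d ^ L * U i a) \<in> J" if "i < k" for i
        proof -
          have eq: "d ^ L * U i a = d ^ (L - M i) * (d ^ M i * U i a)"
            using Mle[OF that] unfolding mult.assoc[symmetric] power_add[symmetric] by simp
          show ?thesis unfolding eq by (rule mo_mult[OF M[OF that]])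
        qed
        then have 1: "mo (\<Sum>i<k. U (k - i) (d ^ N) * (d ^ L * U i a)) \<in> J"
          by (intro sum, rule mo_mult) blast
        have 2: "mo (d ^ L * U k (d ^ N * a)) \<in> J" by (rule mo_mult[OF hs[OF U less.prems N]])
        have "(\<Sum>i\<le>k. U i (d ^ N) * U (k - i) a) = (\<Sum>i\<le>k. U (k - i) (d ^ N) * U i a)"
          by (rule sum.reindex_bij_witness[of _ "\<lambda>i. k - i" "\<lambda>i. k - i"]) auto
        also have "\<dots> = (\<Sum>i<k. U (k - i) (d ^ N) * U i a) + d ^ N * U k a"
          by (simp add: U0 flip: lessThan_Suc_atMost)
        finally have "U k (d ^ N * a) = (\<Sum>i<k. U (k - i) (d ^ N) * U i a) + d ^ N * U k a"
          unfolding leib .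
        moreover have "(\<Sum>i<k. U (k - i) (d ^ N) * (d ^ L * U i a)) = d ^ L * (\<Sum>i<k. U (k - i) (d ^ N) * U i a)"
          unfolding sum_distrib_left by (intro sum.cong refl mult.left_commute)
        ultimately have "d ^ (L + N) * U k a = d ^ L * U k (d ^ N * a) - (\<Sum>i<k. U (k - i) (d ^ N) * (d ^ L * U i a))"
          by (simp add: power_add distrib_left mult.assoc)
        then have "mo (d ^ (L + N) * U k a) \<in> J" using mo_diff[OF 2 1] by simp
        then show ?case by blast
      qed
    qed
  qed (use b in auto)
  then show ?thesis by auto
qed

end

section \<open>Simplicity\<close>

definition ring_ideal :: "'a::comm_ring_1 set \<Rightarrow> bool" where
  "ring_ideal I \<longleftrightarrow> 0 \<in> I \<and> (\<forall>a\<in>I. \<forall>b\<in>I. a + b \<in> I) \<and> (\<forall>a\<in>I. \<forall>c. c * a \<in> I)"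

lemma ideal_gen_subset:
  assumes I: "ring_ideal I" and X: "X \<subseteq> I" shows "ideal_gen X \<subseteq> I"
proof
  fix a assume "a \<in> ideal_gen X"
  then obtain N c g where a: "a = (\<Sum>j<(N::nat). c j * g j)" and g: "\<forall>j<N. g j \<in> X"
    by (auto simp: ideal_gen_def)
  from g have "(\<Sum>j<N. c j * g j) \<in> I"
    using I X by (induction N) (auto simp: ring_ideal_def)
  then show "a \<in> I" by (simp add: a)
qed

lemma ideal_gen_superset: "X \<subseteq> ideal_gen X"
proof
  fix a assume "a \<in> X"
  then show "a \<in> ideal_gen X" unfolding ideal_gen_def
    by (intro CollectI exI[of _ 1] exI[of _ "\<lambda>_. 1"] exI[of _ "\<lambda>_. a"]) simp
qed

text \<open>The two factors of a product are reduced to generators one after the other, by passing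
  to the colon ideals \<open>{b. y * b \<in> I}\<close> and
  \<open>{a. a * b \<in> I}\<close>.\<close>

lemma ideal_pow_gen_subset:
  assumes "ring_ideal I" "\<And>xs. set xs \<subseteq> X \<Longrightarrow> length xs = N \<Longrightarrow> prod_list xs \<in> I"
  shows "ideal_pow (ideal_gen X) N \<subseteq> I"
  using assms
proof (induction N arbitrary: I)
  case 0
  have "1 \<in> I" using 0(2)[of "[]"] by simp
  then have "a \<in> I" for a using 0(1) unfolding ring_ideal_def by (metis mult.right_neutral)
  then show ?case by auto
next
  case (Suc N)
  have "a * b \<in> I" if a: "a \<in> ideal_gen X" and b: "b \<in> ideal_pow (ideal_gen X) N" for a b
  proof -
    have "ring_ideal {a. a * b \<in> I}"
      using Suc.prems(1) by (auto simp: ring_ideal_def algebra_simps)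
    moreover have "X \<subseteq> {a. a * b \<in> I}"
    proof
      fix y assume y: "y \<in> X"
      have "ideal_pow (ideal_gen X) N \<subseteq> {b. y * b \<in> I}"
      proof (rule Suc.IH)
        show "ring_ideal {b. y * b \<in> I}"
          using Suc.prems(1) by (auto simp: ring_ideal_def algebra_simps)
        show "prod_list xs \<in> {b. y * b \<in> I}" if "set xs \<subseteq> X" "length xs = N" for xs
          using Suc.prems(2)[of "y # xs"] y that by simp
      qed
      then show "y \<in> {a. a * b \<in> I}" using b by auto
    qed
    ultimately have "ideal_gen X \<subseteq> {a. a * b \<in> I}" by (rule ideal_gen_subset)
    then show ?thesis using a by auto
  qed
  then show ?case unfolding ideal_pow.simps by (intro ideal_gen_subset[OF Suc.prems(1)]) auto
qed

lemma ideal_pow_subset_radical: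
  fixes I X :: "'a::comm_ring_1 set"
  assumes I: "ring_ideal I" and X: "finite X" and pow: "\<And>y. y \<in> X \<Longrightarrow> \<exists>N. y ^ N \<in> I"
  shows "\<exists>N\<ge>1. ideal_pow (ideal_gen X) N \<subseteq> I"
proof -
  obtain e where e: "\<And>y. y \<in> X \<Longrightarrow> y ^ e y \<in> I" using pow by metis
  \<comment> \<open>Pigeonhole: among N factors from X some y occurs at least \<open>e y\<close>
    times, since otherwise there would be at most N - 1 factors.\<close>
  define N where "N = Suc (\<Sum>y\<in>X. e y)"
  have dvd: "y ^ count_list xs y dvd prod_list xs" for y :: 'a and xs
    by (induction xs) (auto intro: mult_dvd_mono dvd_mult)
  have "prod_list xs \<in> I" if xs: "set xs \<subseteq> X" "length xs = N" for xs
  proof -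
    have "\<exists>y\<in>X. e y \<le> count_list xs y"
    proof (rule ccontr)
      assume "\<not> ?thesis"
      then have "(\<Sum>y\<in>X. count_list xs y) \<le> (\<Sum>y\<in>X. e y)" by (intro sum_mono) auto
      moreover have "(\<Sum>y\<in>X. count_list xs y) = length xs" using xs X by (intro sum_count_set)
      ultimately show False using xs by (simp add: N_def)
    qed
    then obtain y where y: "y \<in> X" "e y \<le> count_list xs y" by blast
    have "y ^ e y dvd prod_list xs" using dvd_trans[OF le_imp_power_dvd[OF y(2)] dvd] .
    then show ?thesis using e[OF y(1)] I unfolding dvd_def ring_ideal_def by (metis mult.commute)
  qed
  then have "ideal_pow (ideal_gen X) N \<subseteq> I" by (intro ideal_pow_gen_subset[OF I])
  moreover have "N \<ge> 1" by (simp add: N_def)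
  ultimately show ?thesis by blast
qed

lemma power_in_ideal_pow: "y \<in> J \<Longrightarrow> y ^ i \<in> ideal_pow J i"
proof (induction i)
  case (Suc i)
  then have "y * y ^ i \<in> {a * b | a b. a \<in> J \<and> b \<in> ideal_pow J i}" by blast
  then show ?case using ideal_gen_superset by fastforce
qed simp

text \<open>The index maps are functions on all natural numbers, but only their values below k
  matter.\<close>

lemma finite_minors: "finite (minors m n M k)"
proof -
  have cong: "det_sq k (\<lambda>a b. M (\<rho> a) (\<gamma> b)) = det_sq k (\<lambda>a b. M (restrict \<rho> {..<k} a) (restrict \<gamma> {..<k} b))" for \<rho> \<gamma>
    unfolding det_sq_eq_det by (intro arg_cong[where f=det] cong_mat) auto
  let ?F = "\<lambda>(\<rho>, \<gamma>). det_sq k (\<lambda>a b. M (\<rho> a) (\<gamma> b))"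
  have "minors m n M k \<subseteq> ?F ` (({..<k} \<rightarrow>\<^sub>E {..<m}) \<times> ({..<k} \<rightarrow>\<^sub>E {..<n}))"
  proof
    fix d assume "d \<in> minors m n M k"
    then obtain \<rho> \<gamma> where "d = det_sq k (\<lambda>a b. M (\<rho> a) (\<gamma> b))" "\<rho> ` {..<k} \<subseteq> {..<m}" "\<gamma> ` {..<k} \<subseteq> {..<n}"
      by (auto simp: minors_def)
    then have "d = ?F (restrict \<rho> {..<k}, restrict \<gamma> {..<k})" "restrict \<rho> {..<k} \<in> {..<k} \<rightarrow>\<^sub>E {..<m}"
      "restrict \<gamma> {..<k} \<in> {..<k} \<rightarrow>\<^sub>E {..<n}"
      using cong by auto
    then show "d \<in> ?F ` (({..<k} \<rightarrow>\<^sub>E {..<m}) \<times> ({..<k} \<rightarrow>\<^sub>E {..<n}))" by blast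
  qed
  then show ?thesis by (rule finite_subset) (intro finite_imageI finite_cartesian_product finite_PiE; simp)
qed

text \<open>The 0 \<times> 0 minor is 1, so the maximum that defines the rank is taken over a
  nonempty set.\<close>

lemma nonzero_minor_ex: "\<exists>d\<in>minors m n M (mat_rank m n (M :: nat \<Rightarrow> nat \<Rightarrow> 'a::comm_ring_1)). d \<noteq> 0"
proof -
  have "det_sq 0 (\<lambda>a b. M a b) = 1" by (simp add: det_sq_def)
  then have "1 \<in> minors m n M 0" by (force simp: minors_def)
  then have "0 \<in> {k. \<exists>d\<in>minors m n M k. d \<noteq> 0}" by (intro CollectI bexI[of _ 1]) simp_all
  then have "mat_rank m n M \<in> {k. \<exists>d\<in>minors m n M k. d \<noteq> 0}"
    unfolding mat_rank_def using finite_minor_sizes by (intro Max_in) auto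
  then show ?thesis by simp
qed

lemma mo_eq_0_iff: "mo c = (\<lambda>a. 0) \<longleftrightarrow> c = (0 :: 'a::comm_ring_1)"
  by (auto simp: mo_def fun_eq_iff dest: spec[of _ 1])

lemma mo_ideal:
  assumes "diffop_ring \<phi> R" "two_sided_ideal R J" shows "ring_ideal {a. mo a \<in> J}"
proof -
  interpret diffop_ring \<phi> R by fact
  have "mo (c * a) \<in> J" if "mo a \<in> J" for a c
    using ideal_comp(1)[OF assms(2) that R_mo[of c]] by (simp add: mo_def o_def mult.assoc)
  moreover have "mo (a + b) \<in> J" if "mo a \<in> J" "mo b \<in> J" for a b
  proof -
    have "(\<lambda>y. mo a y + mo b y) \<in> J" using assms(2) that by (simp add: two_sided_ideal_def)
    then show ?thesis by (simp add: mo_def distrib_right)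
  qed
  moreover have "mo 0 \<in> J" using assms(2) by (simp add: two_sided_ideal_def mo_def)
  ultimately show ?thesis by (simp add: ring_ideal_def)
qed

text \<open>A nonzero ideal contains a power of each of the finitely many r \<times> r minors, hence
  by pigeonhole a whole power of the Jacobian ideal. Conversely, powers of a nonzero minor show that
  the powers of the Jacobian ideal are nonzero.\<close>

lemma simple_Dall_iff_jacobian:
  fixes \<phi> :: "'k::field \<Rightarrow> 'a::idom"
  assumes "perfect_field TYPE('k)" "k_algebra_map \<phi>" "is_presentation \<phi> n m x f"
  shows "simple_ring (Dall \<phi>) \<longleftrightarrow>
    (\<forall>i\<ge>1. tsid (Dall \<phi>) (mo ` ideal_pow (jacobian_ideal \<phi> x f m n) i) = Dall \<phi>)"
proof -
  interpret D: diffop_ring \<phi> "Dall \<phi>" by (rule Dall_diffop_ring)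
  let ?M = "jacobian_matrix \<phi> x f"
  let ?r = "mat_rank m n ?M"
  show ?thesis
  proof
    assume s: "simple_ring (Dall \<phi>)"
    obtain d where d: "d \<in> minors m n ?M ?r" "d \<noteq> 0" using nonzero_minor_ex by blast
    have "d ^ i \<in> ideal_pow (jacobian_ideal \<phi> x f m n) i" for i
      using d(1) ideal_gen_superset by (intro power_in_ideal_pow) (auto simp: jacobian_ideal_def)
    then show "\<forall>i\<ge>1. tsid (Dall \<phi>) (mo ` ideal_pow (jacobian_ideal \<phi> x f m n) i) = Dall \<phi>"
      using d(2) D.R_mo
      by (intro allI impI D.simple_tsid[OF s _ imageI[of "d ^ _"]]) (auto simp: mo_eq_0_iff)
  next
    assume jac: "\<forall>i\<ge>1. tsid (Dall \<phi>) (mo ` ideal_pow (jacobian_ideal \<phi> x f m n) i) = Dall \<phi>"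
    show "simple_ring (Dall \<phi>)"
    proof (rule D.simple_ringI)
      fix J c assume J: "two_sided_ideal (Dall \<phi>) J" and c: "c \<noteq> 0" "mo c \<in> J"
      have "\<exists>N. d ^ N \<in> {a. mo a \<in> J}" if d: "d \<in> minors m n ?M ?r" for d
      proof (cases "d = 0")
        case True
        then show ?thesis using mo_ideal[OF Dall_diffop_ring J] by (intro exI[of _ 1]) (simp add: ring_ideal_def)
      next
        case False
        obtain \<rho> \<gamma> where "d = det_sq ?r (\<lambda>a b. ?M (\<rho> a) (\<gamma> b))" "inj_on \<rho> {..<?r}" "\<rho> ` {..<?r} \<subseteq> {..<m}"
          "inj_on \<gamma> {..<?r}" "\<gamma> ` {..<?r} \<subseteq> {..<n}"
          using d by (auto simp: minors_def)
        then interpret affine_minor \<phi> n m x f \<rho> \<gamma> ?r d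
          using assms False by unfold_locales auto
        show ?thesis using minor_power_in_ideal[OF J c(2,1)] by simp
      qed
      from ideal_pow_subset_radical[OF mo_ideal[OF Dall_diffop_ring J] finite_minors[of m n ?M ?r] this]
      obtain N where N: "N \<ge> 1" "mo ` ideal_pow (jacobian_ideal \<phi> x f m n) N \<subseteq> J"
        by (auto simp: jacobian_ideal_def)
      have "Dall \<phi> \<subseteq> J" using D.tsid_subset[OF J N(2)] jac N(1) by simp
      then show "id \<in> J" using D.R_id by blast
    qed
  qed
qed

section \<open>Transfer of simplicity between R and D(A)\<close>

context diffop_ring
begin

lemma R_diff: "u \<in> R \<Longrightarrow> v \<in> R \<Longrightarrow> (\<lambda>a. u a - v a) \<in> R"
  using R_add[of u "mo (- 1) \<circ> v"] R_comp[OF R_mo[of "- 1"], of v] by (simp add: mo_def)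

text \<open>A nonzero ideal of D(A) contains a nonzero element of A, so it meets R in a nonzero
  ideal, which is R and contains 1.\<close>

lemma simple_imp_simple_Dall:
  assumes s: "simple_ring R" shows "simple_ring (Dall \<phi>)"
proof -
  interpret D: diffop_ring \<phi> "Dall \<phi>" by (rule Dall_diffop_ring)
  show ?thesis
  proof (rule D.simple_ringI)
    fix J c assume J: "two_sided_ideal (Dall \<phi>) J" and c: "c \<noteq> 0" "mo c \<in> J"
    have "two_sided_ideal R (J \<inter> R)"
      using J R_mo[of 0] R_add R_diff R_comp R_sub by (auto simp: two_sided_ideal_def mo_def subset_iff)
    then have "J \<inter> R = {\<lambda>a. 0} \<or> J \<inter> R = R" using s by (simp add: simple_ring_def)
    moreover have "J \<inter> R \<noteq> {\<lambda>a. 0}" using c R_mo[of c] mo_eq_0_iff[of c] by blast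
    ultimately show "id \<in> J" using R_id by blast
  qed
qed

lemma simple_tsid_mo: "simple_ring R \<Longrightarrow> b \<noteq> 0 \<Longrightarrow> tsid R {mo b} = R"
  by (rule simple_tsid[of _ "mo b"]) (auto simp: R_mo mo_eq_0_iff)

text \<open>If the identity is a sum of terms u c v of order at most i, then \<sigma> i \<tau> i is a sum of terms
  (\<sigma> i u) c (v \<tau> i) over R.\<close>
lemma simple_Dall_imp_simple:
  assumes D: "simple_ring (Dall \<phi>)"
    and \<sigma>: "\<And>i. i \<ge> 1 \<Longrightarrow> \<sigma> i \<in> bset \<phi> R i" and \<tau>: "\<And>i. i \<ge> 1 \<Longrightarrow> \<tau> i \<in> cset \<phi> R i"
    and gen: "\<And>i. i \<ge> 1 \<Longrightarrow> tsid R {mo (\<sigma> i * \<tau> i)} = R"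
  shows "simple_ring R"
proof (rule simple_ringI)
  interpret D: diffop_ring \<phi> "Dall \<phi>" by (rule Dall_diffop_ring)
  fix J c assume J: "two_sided_ideal R J" and c: "c \<noteq> 0" "mo c \<in> J"
  have "id \<in> tsid (Dall \<phi>) {mo c}" using D.simple_tsid_mo[OF D c(1)] D.R_id by simp
  then obtain N u y v where id: "id = (\<lambda>a. \<Sum>j<(N::nat). u j (y j (v j a)))"
    and uyv: "\<forall>j<N. u j \<in> Dall \<phi> \<and> y j \<in> {mo c} \<and> v j \<in> Dall \<phi>" unfolding tsid_def by blast
  have "\<exists>i. \<forall>j<N. u j \<in> dop \<phi> i \<and> v j \<in> dop \<phi> i"
    using uyv
  proof (induction N)
    case (Suc N)
    then obtain i where i: "\<forall>j<N. u j \<in> dop \<phi> i \<and> v j \<in> dop \<phi> i" by auto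
    obtain k l where kl: "u N \<in> dop \<phi> k" "v N \<in> dop \<phi> l" using Suc.prems by (auto simp: Dall_def)
    let ?i = "max i (max k l)"
    have "dop \<phi> i \<subseteq> dop \<phi> ?i" "dop \<phi> k \<subseteq> dop \<phi> ?i" "dop \<phi> l \<subseteq> dop \<phi> ?i" by (intro dop_mono; simp)+
    with i kl show ?case by (intro exI[of _ ?i]) (auto simp: less_Suc_eq)
  qed simp
  then obtain i where "\<forall>j<N. u j \<in> dop \<phi> i \<and> v j \<in> dop \<phi> i" by blast
  \<comment> \<open>The multipliers are given only for orders at least 1, hence the passage to
    \<open>Suc i\<close>.\<close>
  then have i: "u j \<in> dop \<phi> (Suc i)" "v j \<in> dop \<phi> (Suc i)" if "j < N" for j
    using dop_Suc_mono that by blast+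
  let ?s = "\<sigma> (Suc i)" and ?t = "\<tau> (Suc i)"
  have "(\<lambda>a. \<Sum>j<N. ((mo ?s \<circ> u j) \<circ> (mo c \<circ> (v j \<circ> mo ?t))) a) \<in> J"
  proof (rule ideal_sum[OF J])
    fix j assume j: "j < N"
    have "mo ?s \<circ> u j \<in> R" "v j \<circ> mo ?t \<in> R"
      using \<sigma>[of "Suc i"] \<tau>[of "Suc i"] i[OF j] by (auto simp: bset_def cset_def simp del: dop.simps)
    then show "(mo ?s \<circ> u j) \<circ> (mo c \<circ> (v j \<circ> mo ?t)) \<in> J" using c(2) by (intro ideal_comp[OF J])
  qed
  moreover have "(\<Sum>j<N. ((mo ?s \<circ> u j) \<circ> (mo c \<circ> (v j \<circ> mo ?t))) a) = mo (?s * ?t) a" for a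
  proof -
    have "(\<Sum>j<N. ((mo ?s \<circ> u j) \<circ> (mo c \<circ> (v j \<circ> mo ?t))) a) = ?s * (\<Sum>j<N. u j (y j (v j (?t * a))))"
      unfolding sum_distrib_left using uyv by (intro sum.cong) (auto simp: mo_def)
    also have "\<dots> = ?s * id (?t * a)" by (subst id) simp
    finally show ?thesis by (simp add: mo_def mult.assoc)
  qed
  ultimately have "mo (?s * ?t) \<in> J" by simp
  then have "R \<subseteq> J" using tsid_subset[OF J, of "{mo (?s * ?t)}"] gen[of "Suc i"] by simp
  then show "id \<in> J" using R_id by blast
qed

text \<open>Let s be the new factor and P the product of the old ones. Then d s P = s (d P) - [s, d]
  P; the first term lies in R by the choice of s, the second by induction, as [s, d] has order at
  most i.\<close>

lemma prod_in_cset: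
  assumes \<sigma>: "\<And>i. i \<ge> 1 \<Longrightarrow> \<sigma> i \<in> bset \<phi> R i"
  shows "(\<Prod>j\<in>{1..i}. \<sigma> j) \<in> cset \<phi> R i"
proof (induction i)
  case 0
  have "d \<circ> mo 1 \<in> R \<inter> dop \<phi> 0" if d: "d \<in> dop \<phi> 0" for d
  proof -
    have "d \<circ> mo 1 = d" by (auto simp: mo_def)
    moreover have "d \<in> R" using d R_mo unfolding dop_0_iff by blast
    ultimately show ?thesis using d by simp
  qed
  then show ?case unfolding cset_def by simp
next
  case (Suc i)
  let ?P = "\<Prod>j\<in>{1..i}. \<sigma> j" and ?s = "\<sigma> (Suc i)"
  have P: "(\<Prod>j\<in>{1..Suc i}. \<sigma> j) = ?s * ?P" by (simp add: mult.commute)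
  have "d \<circ> mo (?s * ?P) \<in> R \<inter> dop \<phi> (Suc i)" if d: "d \<in> dop \<phi> (Suc i)" for d
  proof -
    let ?e = "\<lambda>a. ?s * d a - d (?s * a)"
    have "?e \<in> dop \<phi> i" using d unfolding dop_Suc_iff by blast
    then have e: "?e \<circ> mo ?P \<in> R" "?e \<circ> mo ?P \<in> dop \<phi> (Suc i)"
      using Suc.IH dop_Suc_mono unfolding cset_def by blast+
    have "d \<circ> mo ?P \<in> dop \<phi> (Suc i)" using dop_comp[OF d mo_in_dop[of ?P \<phi> 0]] by simp
    then have "mo ?s \<circ> (d \<circ> mo ?P) \<in> R" "mo ?s \<circ> (d \<circ> mo ?P) \<in> dop \<phi> (Suc i)"
      using \<sigma>[of "Suc i"] unfolding bset_def by auto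
    from R_diff[OF this(1) e(1)] dop_diff[OF this(2) e(2)] show ?thesis
      by (simp add: mo_def o_def mult.assoc del: dop.simps)
  qed
  then show ?case unfolding cset_def P by blast
qed

text \<open>The mirror image: P t d = P (d t) + P [t, d], where d t lies in R by the choice of
  t.\<close>

lemma prod_in_bset:
  assumes \<tau>: "\<And>i. i \<ge> 1 \<Longrightarrow> \<tau> i \<in> cset \<phi> R i"
  shows "(\<Prod>j\<in>{1..i}. \<tau> j) \<in> bset \<phi> R i"
proof (induction i)
  case 0
  have "mo 1 \<circ> d \<in> R \<inter> dop \<phi> 0" if d: "d \<in> dop \<phi> 0" for d
  proof -
    have "mo 1 \<circ> d = d" by (auto simp: mo_def)
    moreover have "d \<in> R" using d R_mo unfolding dop_0_iff by blast
    ultimately show ?thesis using d by simp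
  qed
  then show ?case unfolding bset_def by simp
next
  case (Suc i)
  let ?P = "\<Prod>j\<in>{1..i}. \<tau> j" and ?t = "\<tau> (Suc i)"
  have P: "(\<Prod>j\<in>{1..Suc i}. \<tau> j) = ?P * ?t" by simp
  have "mo (?P * ?t) \<circ> d \<in> R \<inter> dop \<phi> (Suc i)" if d: "d \<in> dop \<phi> (Suc i)" for d
  proof -
    let ?e = "\<lambda>a. ?t * d a - d (?t * a)"
    have "?e \<in> dop \<phi> i" using d unfolding dop_Suc_iff by blast
    then have e: "mo ?P \<circ> ?e \<in> R" "mo ?P \<circ> ?e \<in> dop \<phi> (Suc i)"
      using Suc.IH dop_Suc_mono unfolding bset_def by blast+
    have "d \<circ> mo ?t \<in> R" "d \<circ> mo ?t \<in> dop \<phi> (Suc i)"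
      using \<tau>[of "Suc i"] d unfolding cset_def by auto
    then have "mo ?P \<circ> (d \<circ> mo ?t) \<in> R" "mo ?P \<circ> (d \<circ> mo ?t) \<in> dop \<phi> (Suc i)"
      using R_comp[OF R_mo] dop_comp[OF mo_in_dop[of ?P \<phi> 0], of "d \<circ> mo ?t" "Suc i"] by simp_all
    from R_add[OF e(1) this(1)] dop_add[OF e(2) this(2)] show ?thesis
      by (simp add: mo_def o_def algebra_simps del: dop.simps)
  qed
  then show ?case unfolding bset_def P by blast
qed

end

section \<open>Comparison of the seven conditions\<close>

theorem theorem1p11:
  fixes \<phi> :: "'k::field \<Rightarrow> 'a::idom" and n m :: nat and x :: "nat \<Rightarrow> 'a"
    and f :: "nat \<Rightarrow> 'k mpoly"
    and R :: "('a \<Rightarrow> 'a) set" and S :: "'a set" and s t :: "nat \<Rightarrow> 'a"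
  assumes perfect: "perfect_field TYPE('k)"
    and alg: "k_algebra_map \<phi>"
    and pres: "is_presentation \<phi> n m x f"
    and Rsub: "subalg \<phi> (Dall \<phi>) R"
    and AR: "range mo \<subseteq> R"
    and S1: "1 \<in> S" and S0: "0 \<notin> S" and Smult: "\<forall>a\<in>S. \<forall>b\<in>S. a * b \<in> S"
    and loc: "\<forall>d\<in>Dall \<phi>. \<exists>\<sigma>\<in>S. mo \<sigma> \<circ> d \<in> R"
    and s_in: "\<forall>i\<ge>1. s i \<in> S \<and> s i \<in> bset \<phi> R i"
    and t_in: "\<forall>i\<ge>1. t i \<in> S \<and> t i \<in> cset \<phi> R i"
  shows
   "(simple_ring R \<longleftrightarrow>
       (\<forall>i\<ge>1. tsid (Dall \<phi>) (mo ` ideal_pow (jacobian_ideal \<phi> x f m n) i) = Dall \<phi>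
               \<and> tsid R {mo (s i * t i)} = R))
  \<and> (simple_ring R \<longleftrightarrow>
       simple_ring (Dall \<phi>) \<and> (\<forall>i\<ge>1. tsid R {mo (s i * t i)} = R))
  \<and> (simple_ring R \<longleftrightarrow>
       (\<forall>i\<ge>1. tsid (Dall \<phi>) (mo ` ideal_pow (jacobian_ideal \<phi> x f m n) i) = Dall \<phi>)
       \<and> tsid R {mo (s 1 ^ 2)} = R
       \<and> (\<forall>i\<ge>2. tsid R {mo ((\<Prod>j\<in>{1..<i}. s j) * s i ^ 2)} = R))
  \<and> (simple_ring R \<longleftrightarrow>
       simple_ring (Dall \<phi>)
       \<and> tsid R {mo (s 1 ^ 2)} = R
       \<and> (\<forall>i\<ge>2. tsid R {mo ((\<Prod>j\<in>{1..<i}. s j) * s i ^ 2)} = R))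
  \<and> (simple_ring R \<longleftrightarrow>
       (\<forall>i\<ge>1. tsid (Dall \<phi>) (mo ` ideal_pow (jacobian_ideal \<phi> x f m n) i) = Dall \<phi>)
       \<and> tsid R {mo (t 1 ^ 2)} = R
       \<and> (\<forall>i\<ge>2. tsid R {mo ((\<Prod>j\<in>{1..<i}. t j) * t i ^ 2)} = R))
  \<and> (simple_ring R \<longleftrightarrow>
       simple_ring (Dall \<phi>)
       \<and> tsid R {mo (t 1 ^ 2)} = R
       \<and> (\<forall>i\<ge>2. tsid R {mo ((\<Prod>j\<in>{1..<i}. t j) * t i ^ 2)} = R))"
proof -
  interpret R: diffop_ring \<phi> R
    using Rsub AR by unfold_locales (auto simp: subalg_def)
  let ?D = "simple_ring (Dall \<phi>)"
  let ?jac = "\<lambda>i. tsid (Dall \<phi>) (mo ` ideal_pow (jacobian_ideal \<phi> x f m n) i) = Dall \<phi>"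
  \<comment> \<open>Conditions (2), (4), (6) differ from (3), (5), (7) by this equivalence
    only.\<close>
  have jac: "?D \<longleftrightarrow> (\<forall>i\<ge>1. ?jac i)" by (rule simple_Dall_iff_jacobian[OF perfect alg pres])
  have sb: "s i \<in> bset \<phi> R i" "s i \<noteq> 0" and tc: "t i \<in> cset \<phi> R i" "t i \<noteq> 0" if "i \<ge> 1" for i
    using s_in t_in S0 that by metis+
  have st: "simple_ring R \<longleftrightarrow> ?D \<and> (\<forall>i\<ge>1. tsid R {mo (s i * t i)} = R)"
  proof (intro iffI conjI)
    assume "simple_ring R"
    then show "?D" "\<forall>i\<ge>1. tsid R {mo (s i * t i)} = R"
      using R.simple_imp_simple_Dall R.simple_tsid_mo sb(2) tc(2) by auto
  qed (use R.simple_Dall_imp_simple[of s t] sb(1) tc(1) in blast)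
  have fwd: "tsid R {mo (w 1 ^ 2)} = R" "\<forall>i\<ge>2. tsid R {mo ((\<Prod>j\<in>{1..<i}. w j) * w i ^ 2)} = R"
    if "simple_ring R" "\<And>i. i \<ge> 1 \<Longrightarrow> w i \<noteq> 0" for w :: "nat \<Rightarrow> 'a"
    using that by (auto intro!: R.simple_tsid_mo)
  \<comment> \<open>s_1 ... s_(i-1) s_i^2 is (s_1 ... s_i) s_i, a product of an element of c_i and
    one of b_i; for the t_i the roles are exchanged. At i = 1 it is s_1^2, the case that the
    conditions list separately.\<close>
  have gen: "tsid R {mo ((\<Prod>j\<in>{1..i}. w j) * w i)} = R"
    if w: "tsid R {mo (w 1 ^ 2)} = R" "\<forall>i\<ge>2. tsid R {mo ((\<Prod>j\<in>{1..<i}. w j) * w i ^ 2)} = R"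
      and i: "i \<ge> 1" for w :: "nat \<Rightarrow> 'a" and i
  proof (cases "i = 1")
    case True
    then show ?thesis using w(1) by (simp add: power2_eq_square)
  next
    case False
    have "{1..i} = insert i {1..<i}" using i by auto
    then have "(\<Prod>j\<in>{1..i}. w j) * w i = (\<Prod>j\<in>{1..<i}. w j) * w i ^ 2"
      by (simp add: power2_eq_square mult_ac)
    then show ?thesis using w(2) i False by simp
  qed
  have ss: "simple_ring R \<longleftrightarrow> ?D \<and> tsid R {mo (s 1 ^ 2)} = R \<and>
      (\<forall>i\<ge>2. tsid R {mo ((\<Prod>j\<in>{1..<i}. s j) * s i ^ 2)} = R)"
  proof (intro iffI conjI)
    assume h: "?D \<and> tsid R {mo (s 1 ^ 2)} = R \<and> (\<forall>i\<ge>2. tsid R {mo ((\<Prod>j\<in>{1..<i}. s j) * s i ^ 2)} = R)"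
    show "simple_ring R"
    proof (rule R.simple_Dall_imp_simple[of s "\<lambda>i. \<Prod>j\<in>{1..i}. s j"])
      show "tsid R {mo (s i * (\<Prod>j\<in>{1..i}. s j))} = R" if "i \<ge> 1" for i
        using gen[of s i] h that by (simp add: mult.commute)
    qed (use h sb(1) R.prod_in_cset in blast)+
  qed (use R.simple_imp_simple_Dall fwd[of s] sb(2) in blast)+
  have tt: "simple_ring R \<longleftrightarrow> ?D \<and> tsid R {mo (t 1 ^ 2)} = R \<and>
      (\<forall>i\<ge>2. tsid R {mo ((\<Prod>j\<in>{1..<i}. t j) * t i ^ 2)} = R)"
  proof (intro iffI conjI)
    assume h: "?D \<and> tsid R {mo (t 1 ^ 2)} = R \<and> (\<forall>i\<ge>2. tsid R {mo ((\<Prod>j\<in>{1..<i}. t j) * t i ^ 2)} = R)"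
    show "simple_ring R"
    proof (rule R.simple_Dall_imp_simple[of "\<lambda>i. \<Prod>j\<in>{1..i}. t j" t])
      show "tsid R {mo ((\<Prod>j\<in>{1..i}. t j) * t i)} = R" if "i \<ge> 1" for i
        using gen[of t i] h that by simp
    qed (use h tc(1) R.prod_in_bset in blast)+
  qed (use R.simple_imp_simple_Dall fwd[of t] tc(2) in blast)+
  have "(\<forall>i\<ge>1. ?jac i \<and> tsid R {mo (s i * t i)} = R) \<longleftrightarrow> ?D \<and> (\<forall>i\<ge>1. tsid R {mo (s i * t i)} = R)"
    unfolding jac by blast
  with st ss tt jac show ?thesis by (intro conjI) simp_all
qed

end
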